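(* Let $S^1$ be the circle, and for $k\ge 1$ let $(S^1)^{(k)}$ denote the $k$-th symmetric potency of $S^1$, so that $S^1=(S^1)^{(1)}\subset (S^1)^{(2)}\subset (S^1)^{(3)}$. Then: (1) $(S^1)^{(3)}$ is homeomorphic to the $3$-sphere $S^3$. (2) $(S^1)^{(2)}$ is homeomorphic to a Möbius band, and $(S^1)^{(1)}$ is its boundary. Moreover $(S^1)^{(2)}$ is included in $(S^1)^{(3)}\cong S^3$ as a full and a half twisted Möbius band. (3) In particular, the inclusion $S^1=(S^1)^{(1)}\subset (S^1)^{(3)}\cong S^3$ is a trefoil knot.
   Context: For a topological space $X$ and a positive integer $k$, the $k$-th symmetric potency $(X)^{(k)}$ of $X$ is the set $\{A\subset X : 0<|A|\le k\}$ of non-empty subsets of $X$ of cardinality at most $k$, equipped with the quotient topology given by the projection $\pi\colon X^k\to (X)^{(k)}$, $\pi(x_1,\dots,x_k)=\{x_1,\dots,x_k\}$, where $X^k$ is the $k$-fold Cartesian product. There are canonical inclusions $(X)^{(1)}\subset (X)^{(2)}\subset (X)^{(3)}\subset\cdots$, and $(X)^{(1)}$ is identified with $X$ via $x\mapsto\{x\}$. A "full and a half twisted Möbius band" in $S^3$ is an unknotted band with three half twists (a full twist plus a half twist), i.e. up to a homeomorphism of $S^3$ the subset $\{((2+t\cos\tfrac{3\theta}{2})\cos\theta,\,(2+t\cos\tfrac{3\theta}{2})\sin\theta,\,t\sin\tfrac{3\theta}{2}) : \theta\in[0,2\pi],\ t\in[-1,1]\}$ of $\mathbb{R}^3\subset\mathbb{R}^3\cup\{\infty\}=S^3$.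 Handedness (left or right) of the band and of the trefoil knot is not specified. *)

theory Defs
  imports "HOL-Analysis.Analysis"
begin

definition quotient_topology :: "'a topology \<Rightarrow> ('a \<Rightarrow> 'b) \<Rightarrow> 'b topology" where
  "quotient_topology X f =
     topology (\<lambda>U. U \<subseteq> f ` topspace X \<and> openin X {x \<in> topspace X. f x \<in> U})"

lemma openin_quotient_topology:
  "openin (quotient_topology X f) U \<longleftrightarrow>
     U \<subseteq> f ` topspace X \<and> openin X {x \<in> topspace X. f x \<in> U}"
proof -
  let ?L = "\<lambda>U. U \<subseteq> f ` topspace X \<and> openin X {x \<in> topspace X. f x \<in> U}"
  have "?L (S \<inter> T)" if "?L S" "?L T" for S T
  proof -
    have "{x \<in> topspace X. f x \<in> S \<inter> T} =
        {x \<in> topspace X. f x \<in> S} \<inter> {x \<in> topspace X. f x \<in> T}" by blast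
    with that show ?thesis by (auto intro: openin_Int)
  qed
  moreover have "?L (\<Union>\<K>)" if "\<forall>K\<in>\<K>. ?L K" for \<K>
  proof -
    have eq: "{x \<in> topspace X. f x \<in> \<Union>\<K>} = (\<Union>K\<in>\<K>. {x \<in> topspace X. f x \<in> K})" by blast
    have "openin X (\<Union>K\<in>\<K>. {x \<in> topspace X. f x \<in> K})"
      using that by (intro openin_Union) auto
    with that eq show ?thesis by auto
  qed
  ultimately have "istopology ?L" unfolding istopology_def by blast
  then show ?thesis unfolding quotient_topology_def by simp
qed

lemma topspace_quotient_topology [simp]: "topspace (quotient_topology X f) = f ` topspace X"
proof
  show "topspace (quotient_topology X f) \<subseteq> f ` topspace X"
    using openin_quotient_topology openin_topspace by metis
  have "{x \<in> topspace X. f x \<in> f ` topspace X} = topspace X" by blast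
  then have "openin (quotient_topology X f) (f ` topspace X)"
    by (simp add: openin_quotient_topology)
  then show "f ` topspace X \<subseteq> topspace (quotient_topology X f)" by (rule openin_subset)
qed

lemma quotient_map_quotient_topology: "quotient_map X (quotient_topology X f) f"
  by (auto simp: quotient_map_def openin_quotient_topology)

text \<open>The \<open>k\<close>-th symmetric potency, for \<open>k \<ge> 1\<close>. A point of the \<open>k\<close>-fold product is a function
  on \<open>{..<k}\<close>, and its image is the set of its coordinates.\<close>

definition sym_potency :: "nat \<Rightarrow> 'a topology \<Rightarrow> 'a set topology" where
  "sym_potency k X =
     quotient_topology (product_topology (\<lambda>_. X) {..<k}) (\<lambda>x. x ` {..<k})"

lemma topspace_sym_potency:
  assumes "k \<ge> 1"
  shows "topspace (sym_potency k X) =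
    {A. A \<subseteq> topspace X \<and> finite A \<and> 0 < card A \<and> card A \<le> k}" (is "?l = ?r")
proof
  show "?l \<subseteq> ?r"
  proof
    fix A assume "A \<in> ?l"
    then obtain x where x: "x \<in> {..<k} \<rightarrow>\<^sub>E topspace X" "A = x ` {..<k}"
      by (auto simp: sym_potency_def)
    have "0 \<in> {..<k}" using assms by simp
    then have "A \<noteq> {}" using x(2) by blast
    moreover have "card A \<le> k" using x(2) card_image_le[of "{..<k}" x] by simp
    moreover have "finite A" using x(2) by simp
    moreover have "A \<subseteq> topspace X" using x by auto
    ultimately show "A \<in> ?r" by (simp add: card_gt_0_iff)
  qed
next
  show "?r \<subseteq> ?l"
  proof
    fix A assume A: "A \<in> ?r"
    then obtain e where e: "e ` {0..<card A} = A" "inj_on e {0..<card A}"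
      using ex_bij_betw_nat_finite[of A] by (auto simp: bij_betw_def)
    define x where "x = restrict (\<lambda>i. if i < card A then e i else e 0) {..<k}"
    have "x ` {..<k} = A"
    proof
      show "x ` {..<k} \<subseteq> A" using e A by (auto simp: x_def)
      show "A \<subseteq> x ` {..<k}"
      proof
        fix a assume "a \<in> A"
        then obtain i where "i < card A" "a = e i" using e(1) by (metis atLeastLessThan_iff imageE)
        then show "a \<in> x ` {..<k}" using A by (intro image_eqI[of _ _ i]) (auto simp: x_def)
      qed
    qed
    moreover from this have "x \<in> {..<k} \<rightarrow>\<^sub>E topspace X"
      using A by (auto simp: x_def)
    ultimately show "A \<in> ?l" by (auto simp: sym_potency_def)
  qed
qed

definition circle :: "complex topology" where
  "circle = top_of_set (sphere 0 1)"

definition sphere3 :: "(real^4) topology" where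
  "sphere3 = top_of_set (sphere 0 1)"

text \<open>The unit square with each point \<open>(0, t)\<close> glued to \<open>(1, 1 - t)\<close>.\<close>

definition moebius_rel :: "((real \<times> real) \<times> (real \<times> real)) set" where
  "moebius_rel = {(p, q). p \<in> {0..1} \<times> {0..1} \<and> q \<in> {0..1} \<times> {0..1} \<and>
     (p = q \<or> (\<exists>t. {p, q} = {(0, t), (1, 1 - t)}))}"

definition moebius_band :: "(real \<times> real) set topology" where
  "moebius_band = quotient_topology (top_of_set ({0..1} \<times> {0..1})) (\<lambda>p. moebius_rel `` {p})"

lemma equiv_moebius_rel: "equiv ({0..1} \<times> {0..1}) moebius_rel"
proof (rule equivI)
  show "trans moebius_rel"
    by (rule transI) (auto simp: moebius_rel_def doubleton_eq_iff)
qed (auto simp: moebius_rel_def refl_on_def sym_def insert_commute)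

text \<open>The boundary of a surface with boundary: the points without an open neighbourhood that is
  homeomorphic to an open subset of the plane.\<close>

definition surface_boundary :: "'a topology \<Rightarrow> 'a set" where
  "surface_boundary X = {x \<in> topspace X. \<not> (\<exists>(U :: 'a set) (V :: (real \<times> real) set).
     openin X U \<and> x \<in> U \<and> open V \<and> subtopology X U homeomorphic_space top_of_set V)}"

definition three_half_twist_band :: "(real^3) set" where
  "three_half_twist_band =
     {vector [(2 + t * cos (3 * \<theta> / 2)) * cos \<theta>,
              (2 + t * cos (3 * \<theta> / 2)) * sin \<theta>,
              t * sin (3 * \<theta> / 2)] | \<theta> t. \<theta> \<in> {0..2 * pi} \<and> t \<in> {-1..1}}"

text \<open>The standard \<open>(2,3)\<close> torus knot, on the torus around the circle of radius 2.\<close>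

definition trefoil :: "(real^3) set" where
  "trefoil =
     {vector [(2 + cos (3 * s)) * cos (2 * s),
              (2 + cos (3 * s)) * sin (2 * s),
              sin (3 * s)] | s. s \<in> {0..2 * pi}}"

text \<open>The map \<open>f\<close> embeds \<open>X\<close> in the 3-sphere as the model \<open>B\<close> in 3-space, up to a homeomorphism of
  the 3-sphere. The homeomorphism \<open>\<phi>\<close> combines an identification of the one-point compactification
  of 3-space with the 3-sphere and an arbitrary homeomorphism of the 3-sphere, which may reverse the
  orientation, so that the handedness of \<open>B\<close> does not matter.\<close>

definition embeds_as :: "'a topology \<Rightarrow> ('a \<Rightarrow> real^4) \<Rightarrow> (real^3) set \<Rightarrow> bool" where
  "embeds_as X f B \<longleftrightarrow> embedding_map X sphere3 f \<and>
     (\<exists>\<phi>. homeomorphic_map (Alexandroff_compactification euclidean) sphere3 \<phi> \<and>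
          f ` topspace X = \<phi> ` Some ` B)"

end

theory Submission
  imports Defs
begin

text \<open>The circle group acts on the sets of at most three points of the circle by rotation, and on the unit
sphere of \<open>\<complex>\<^sup>2\<close> with weights 2 and 3, by \<open>u \<cdot> (z, w) = (u\<^sup>2 z, u\<^sup>3 w)\<close>. The exceptional orbits
correspond: equilateral triangles and the circle \<open>z = 0\<close> have stabilizers of order 3, antipodal pairs
and the circle \<open>w = 0\<close> have stabilizers of order 2. The proof writes down an equivariant homeomorphism.

Three distinct points \<open>a, b, c\<close> of the circle span an ideal triangle of the hyperbolic disc. Let \<open>p\<close> be
its conformal barycenter, the point that goes to 0 under exactly those disc automorphisms that make
the triangle equilateral. With chords \<open>A = \<bar>b - c\<bar>\<close>, \<open>B = \<bar>c - a\<bar>\<close>, \<open>C = \<bar>a - b\<bar>\<close> it is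
\<open>p = (a A\<^sup>2 + b B\<^sup>2 + c C\<^sup>2) / (A\<^sup>2 + B\<^sup>2 + C\<^sup>2 + \<surd>3 A B C)\<close>. The formula extends continuously to all
triples, with \<open>\<bar>p\<bar> = 1\<close> precisely on the degenerate ones, where \<open>p\<close> is the repeated point. An equilateral
triangle is determined by the product of its vertices; hence \<open>p\<close> and \<open>M = a b c\<close> determine the multiset
of the three points, and the multisets form a solid torus, circle times closed disc
(\<open>barycenter_eq_iff\<close>, \<open>triple_eq_of_barycenter_and_product\<close>, \<open>barycenter_product_surj\<close>).

Passing from multisets to sets identifies \<open>{a, a, b}\<close> with \<open>{a, b, b}\<close> on the boundary torus. In terms of
\<open>M\<close> and \<open>Y = M p\<^sup>*\<close>, where \<open>p\<^sup>*\<close> is the complex conjugate of \<open>p\<close>, one has \<open>Y = a b\<close> there, and the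
identification exchanges \<open>M\<close> with \<open>Y\<^sup>3 / M\<close>. The map
\<open>(M, Y) \<mapsto> (\<bar>Y\<bar> Y, M + \<bar>Y\<bar> Y\<^sup>3 M\<^sup>*)\<close>, followed by radial projection to the unit sphere of \<open>\<complex>\<^sup>2\<close>, makes exactly
this identification: for a fixed argument of \<open>Y\<close> the quotient of the coordinates is, up to constants,
the Joukowski function \<open>\<zeta> + 1 / \<zeta>\<close> of a variable with \<open>\<bar>\<zeta>\<bar> = 1 / \<bar>Y\<bar>\<^sup>2\<close>, which is injective outside the
closed unit disc and folds the unit circle (\<open>fold_vector_ray_eq\<close>, \<open>fold_vector_surj\<close>).
This gives the homeomorphism of the third symmetric potency with the 3-sphere
(\<open>homeomorphic_map_potency_sphere\<close>).

On pairs the resulting map is the radial projection of \<open>(a b, a b (a + b))\<close>. If \<open>a b = e\<^sup>i\<^sup>\<theta>\<close>, then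
\<open>a + b\<close> is a real multiple \<open>2 t\<close> of a square root of \<open>a b\<close>, so that the image is the direction of
\<open>(e\<^sup>i\<^sup>\<theta>, 2 t e\<^sup>3\<^sup>i\<^sup>\<theta>\<^sup>/\<^sup>2)\<close>: while the core turns once, the fibre makes three half turns, and the singletons are
the boundary \<open>t = \<plusminus> 1\<close>, a trefoil. To compare this with the model in 3-space, an explicit
homeomorphism from the one-point compactification of 3-space to the same sphere is chosen such that
the point of the model band with parameters \<open>\<theta>, t\<close> has exactly these coordinates
(\<open>homeomorphic_map_space_sphere\<close>, \<open>space_sphere_band_point\<close>). An arbitrary homeomorphism \<open>h\<close> of the third
potency with the 3-sphere then differs from the constructed one by a homeomorphism of the sphere
only, which the notion of embedding as a model allows.

The parameters \<open>\<theta>, t\<close> also exhibit the second potency as the Moebius band. Its boundary consists of the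
singletons: near a singleton there is a continuous injection into a closed planar disc that takes the
singleton to the rim, which invariance of domain forbids at a point with a planar neighbourhood.\<close>

section \<open>The conformal barycenter of an ideal triangle\<close>

definition side_sum :: "complex \<Rightarrow> complex \<Rightarrow> complex \<Rightarrow> real" where
  "side_sum a b c = (cmod (b - c))\<^sup>2 + (cmod (c - a))\<^sup>2 + (cmod (a - b))\<^sup>2"

definition weighted_sum :: "complex \<Rightarrow> complex \<Rightarrow> complex \<Rightarrow> complex" where
  "weighted_sum a b c =
     of_real ((cmod (b - c))\<^sup>2) * a + of_real ((cmod (c - a))\<^sup>2) * b + of_real ((cmod (a - b))\<^sup>2) * c"

definition side_prod :: "complex \<Rightarrow> complex \<Rightarrow> complex \<Rightarrow> real" where
  "side_prod a b c = sqrt 3 * (cmod (b - c) * cmod (c - a) * cmod (a - b))"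

text \<open>Away from the triple diagonal the quotient is continuous, since the denominator vanishes only
there. The first case is the continuous extension.\<close>

definition barycenter :: "complex \<Rightarrow> complex \<Rightarrow> complex \<Rightarrow> complex" where
  "barycenter a b c =
     (if a = b \<and> b = c then a
      else weighted_sum a b c / of_real (side_sum a b c + side_prod a b c))"

lemma unit_mult_cnj: "cmod a = 1 \<Longrightarrow> a * cnj a = 1"
  by (simp add: complex_norm_square [symmetric])

lemma chord_squared:
  assumes "cmod a = 1" "cmod b = 1"
  shows "of_real ((cmod (a - b))\<^sup>2) = 2 - a * cnj b - cnj a * b"
proof -
  have "of_real ((cmod (a - b))\<^sup>2) = (a - b) * (cnj a - cnj b)"
    by (simp add: complex_norm_square del: of_real_power)
  also have "\<dots> = a * cnj a + b * cnj b - a * cnj b - cnj a * b" by (simp add: algebra_simps)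
  finally show ?thesis using assms by (simp add: unit_mult_cnj)
qed

lemma side_prod_nonneg: "side_prod a b c \<ge> 0"
  by (simp add: side_prod_def)


lemma side_sum_pos: "\<not> (a = b \<and> b = c) \<Longrightarrow> side_sum a b c > 0"
proof -
  assume "\<not> (a = b \<and> b = c)"
  then have "cmod (a - b) > 0 \<or> cmod (b - c) > 0" by auto
  then show ?thesis
    by (auto simp: side_sum_def add_pos_nonneg add_nonneg_pos)
qed

lemma side_prod_pos_iff: "side_prod a b c > 0 \<longleftrightarrow> a \<noteq> b \<and> b \<noteq> c \<and> c \<noteq> a"
  by (auto simp: side_prod_def zero_less_mult_iff)

text \<open>Expanding the square produces the terms \<open>a b\<^sup>* + a\<^sup>* b = 2 - C\<^sup>2\<close>, where the star denotes complex
conjugation; the contributions of the 2 complete the square of the sum, and the three others add up to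
\<open>3 A\<^sup>2 B\<^sup>2 C\<^sup>2\<close>. This is the reason for the factor \<open>\<surd>3\<close> in the formula for the barycenter.\<close>

lemma norm_weighted_sum:
  assumes "cmod a = 1" "cmod b = 1" "cmod c = 1"
  shows "(cmod (weighted_sum a b c))\<^sup>2 = (side_sum a b c)\<^sup>2 - (side_prod a b c)\<^sup>2"
proof -
  define A B C where ABC: "A = complex_of_real ((cmod (b - c))\<^sup>2)"
    "B = complex_of_real ((cmod (c - a))\<^sup>2)" "C = complex_of_real ((cmod (a - b))\<^sup>2)"
  have u: "a * cnj a = 1" "b * cnj b = 1" "c * cnj c = 1"
    using assms by (simp_all add: unit_mult_cnj)
  have ab: "a * cnj b + cnj a * b = 2 - C" "b * cnj c + cnj b * c = 2 - A" "c * cnj a + cnj c * a = 2 - B"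
    using chord_squared[OF assms(1,2)] chord_squared[OF assms(2,3)] chord_squared[OF assms(3,1)]
    by (simp_all add: ABC del: of_real_power)
  have sp: "(complex_of_real (side_prod a b c))\<^sup>2 = 3 * A * B * C"
    by (simp add: side_prod_def ABC power_mult_distrib flip: of_real_power)
  have w: "weighted_sum a b c = A * a + B * b + C * c"
    by (simp add: weighted_sum_def ABC)
  have cn: "cnj A = A" "cnj B = B" "cnj C = C" by (simp_all add: ABC)
  have "of_real ((cmod (weighted_sum a b c))\<^sup>2) = (A * a + B * b + C * c) * (A * cnj a + B * cnj b + C * cnj c)"
    by (simp only: complex_norm_square w complex_cnj_add complex_cnj_mult cn)
  also have "\<dots> = A * A * (a * cnj a) + B * B * (b * cnj b) + C * C * (c * cnj c)
      + A * B * (a * cnj b + cnj a * b) + B * C * (b * cnj c + cnj b * c) + C * A * (c * cnj a + cnj c * a)"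
    by (simp add: algebra_simps)
  also have "\<dots> = (A + B + C)\<^sup>2 - 3 * A * B * C"
    unfolding u ab by (simp add: algebra_simps power2_eq_square)
  also have "A + B + C = of_real (side_sum a b c)"
    by (simp add: side_sum_def ABC)
  also have "(of_real (side_sum a b c))\<^sup>2 - 3 * A * B * C
      = complex_of_real ((side_sum a b c)\<^sup>2 - (side_prod a b c)\<^sup>2)"
    by (simp add: sp)
  finally show ?thesis using of_real_eq_iff by blast
qed

lemma barycenter_scaled:
  assumes "\<not> (a = b \<and> b = c)"
  shows "weighted_sum a b c = of_real (side_sum a b c + side_prod a b c) * barycenter a b c"
proof -
  have "side_sum a b c + side_prod a b c > 0"
    using side_sum_pos[OF assms] side_prod_nonneg[of a b c] by linarith
  then show ?thesis using assms
    by (auto simp: barycenter_def simp del: of_real_add)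
qed

text \<open>The difference of squares in \<open>norm_weighted_sum\<close> contains the denominator as a factor. What
remains shows at once whether the barycenter lies inside the disc or on the circle.\<close>

lemma barycenter_norm_squared:
  assumes "cmod a = 1" "cmod b = 1" "cmod c = 1" "\<not> (a = b \<and> b = c)"
  shows "(side_sum a b c + side_prod a b c) * (cmod (barycenter a b c))\<^sup>2 = side_sum a b c - side_prod a b c"
proof -
  define D where "D = side_sum a b c + side_prod a b c"
  have D: "D > 0"
    using side_sum_pos[OF assms(4)] side_prod_nonneg[of a b c] by (simp add: D_def)
  have "D * (D * (cmod (barycenter a b c))\<^sup>2) = (cmod (weighted_sum a b c))\<^sup>2"
    using D by (simp add: barycenter_scaled[OF assms(4)] norm_mult D_def[symmetric]
        power_mult_distrib del: of_real_add) (simp add: power2_eq_square)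
  also have "\<dots> = D * (side_sum a b c - side_prod a b c)"
    using norm_weighted_sum[OF assms(1-3)] by (simp add: D_def power2_eq_square algebra_simps)
  finally show ?thesis using D by (simp add: D_def[symmetric])
qed

lemma norm_barycenter_le:
  assumes "cmod a = 1" "cmod b = 1" "cmod c = 1"
  shows "cmod (barycenter a b c) \<le> 1"
proof (cases "a = b \<and> b = c")
  case True
  then show ?thesis using assms by (simp add: barycenter_def)
next
  case False
  have D: "side_sum a b c + side_prod a b c > 0"
    using side_sum_pos[OF False] side_prod_nonneg[of a b c] by linarith
  have "(side_sum a b c + side_prod a b c) * (cmod (barycenter a b c))\<^sup>2
      \<le> (side_sum a b c + side_prod a b c) * 1"
    using barycenter_norm_squared[OF assms False] side_prod_nonneg[of a b c] by simp
  then have "(cmod (barycenter a b c))\<^sup>2 \<le> 1\<^sup>2"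
    using D mult_le_cancel_left_pos[OF D] by simp
  then show ?thesis by (rule power2_le_imp_le) simp
qed

lemma norm_barycenter_less_iff:
  assumes "cmod a = 1" "cmod b = 1" "cmod c = 1"
  shows "cmod (barycenter a b c) < 1 \<longleftrightarrow> a \<noteq> b \<and> b \<noteq> c \<and> c \<noteq> a"
proof (cases "a = b \<and> b = c")
  case True
  then show ?thesis using assms by (simp add: barycenter_def)
next
  case False
  define D where "D = side_sum a b c + side_prod a b c"
  have D: "D > 0"
    using side_sum_pos[OF False] side_prod_nonneg[of a b c] by (simp add: D_def)
  have "cmod (barycenter a b c) < 1 \<longleftrightarrow> (cmod (barycenter a b c))\<^sup>2 < 1\<^sup>2"
    by (metis abs_norm_cancel abs_one abs_square_less_1 one_power2)
  also have "\<dots> \<longleftrightarrow> D * (cmod (barycenter a b c))\<^sup>2 < D * 1"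
    using D by simp
  also have "\<dots> \<longleftrightarrow> side_prod a b c > 0"
    using barycenter_norm_squared[OF assms False] by (auto simp: D_def)
  finally show ?thesis by (simp add: side_prod_pos_iff)
qed

lemma barycenter_swap12: "barycenter b a c = barycenter a b c"
proof -
  have "cmod (b - a) = cmod (a - b)" "cmod (c - b) = cmod (b - c)" "cmod (a - c) = cmod (c - a)"
    by (simp_all only: norm_minus_commute)
  then show ?thesis
    by (simp add: barycenter_def weighted_sum_def side_sum_def side_prod_def ac_simps)
qed

lemma barycenter_swap23: "barycenter a c b = barycenter a b c"
proof -
  have "cmod (b - a) = cmod (a - b)" "cmod (c - b) = cmod (b - c)" "cmod (a - c) = cmod (c - a)"
    by (simp_all only: norm_minus_commute)
  then show ?thesis
    by (auto simp add: barycenter_def weighted_sum_def side_sum_def side_prod_def ac_simps)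
qed

lemma barycenter_double: "barycenter a a b = a"
proof (cases "a = b")
  case False
  then have "of_real ((cmod (a - b))\<^sup>2) \<noteq> (0::complex)" by simp
  then show ?thesis using False
    by (simp add: barycenter_def weighted_sum_def side_sum_def side_prod_def norm_minus_commute[of b a]
        flip: mult_2 mult_2_right)
qed (simp add: barycenter_def)

text \<open>For \<open>\<bar>p\<bar> < 1\<close> the left-hand side is, up to a positive factor, the weighted sum of the triangle after the disc
automorphism that moves \<open>p\<close> to 0. Its zeros as a polynomial in \<open>p\<close> are the barycenter and the mirror
image of the barycenter in the unit circle; for distinct points of the circle, the barycenter is
therefore the only zero in the open disc.\<close>

lemma barycenter_factorization:
  assumes "cmod a = 1" "cmod b = 1" "cmod c = 1" "\<not> (a = b \<and> b = c)"
  defines "q \<equiv> barycenter a b c"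
  shows "weighted_sum a b c - 2 * p * of_real (side_sum a b c) + p\<^sup>2 * cnj (weighted_sum a b c)
    = of_real (side_sum a b c + side_prod a b c) * (q - p) * (1 - p * cnj q)"
proof -
  define S k where "S = complex_of_real (side_sum a b c)" "k = complex_of_real (side_prod a b c)"
  have V: "weighted_sum a b c = (S + k) * q"
    using barycenter_scaled[OF assms(4)] by (simp add: q_def S_k_def)
  have cnS: "cnj S = S" "cnj k = k" by (simp_all add: S_k_def)
  have "complex_of_real ((side_sum a b c + side_prod a b c) * (cmod q)\<^sup>2) = S - k"
    unfolding q_def barycenter_norm_squared[OF assms(1-4)] by (simp add: S_k_def)
  then have N: "(S + k) * (q * cnj q) = S - k"
    by (simp add: S_k_def complex_norm_square del: of_real_power)
  have "(S + k) * (q - p) * (1 - p * cnj q) = (S + k) * q - p * ((S + k) + (S + k) * (q * cnj q)) + p\<^sup>2 * ((S + k) * cnj q)"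
    by (simp add: algebra_simps power2_eq_square)
  also have "\<dots> = (S + k) * q - 2 * p * S + p\<^sup>2 * ((S + k) * cnj q)"
    unfolding N by simp
  finally show ?thesis
    by (simp add: V cnS S_k_def)
qed

text \<open>Without the summand \<open>side_prod\<close> in the denominator the barycenter would be a convex combination of
the three points; that summand is small compared to \<open>side_sum\<close> near the diagonal. The estimate yields
continuity at the triples \<open>(u, u, u)\<close>, where the defining quotient is of the form 0 / 0.\<close>

lemma barycenter_near_diagonal:
  assumes "cmod a = 1" "cmod b = 1" "cmod c = 1" "cmod u = 1"
  shows "cmod (barycenter a b c - u) \<le> 3 * (cmod (a - u) + cmod (b - u) + cmod (c - u))"
proof (cases "a = b \<and> b = c")
  case True
  then show ?thesis by (simp add: barycenter_def)
next
  case False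
  define A B C where ABC: "A = cmod (b - c)" "B = cmod (c - a)" "C = cmod (a - b)"
  define m where "m = cmod (a - u) + cmod (b - u) + cmod (c - u)"
  define S k where Sk: "S = side_sum a b c" "k = side_prod a b c"
  have D: "S > 0" "k \<ge> 0"
    using side_sum_pos[OF False] side_prod_nonneg[of a b c] by (simp_all add: Sk)
  have S: "S = A\<^sup>2 + B\<^sup>2 + C\<^sup>2" by (simp add: Sk side_sum_def ABC)
  have nn: "A \<ge> 0" "B \<ge> 0" "C \<ge> 0" "m \<ge> 0" by (simp_all add: ABC m_def)
  have Am: "A \<le> m"
    using norm_triangle_ineq4[of "b - u" "c - u"] by (simp add: ABC m_def) (smt (verit) norm_ge_zero)
  have s3: "sqrt 3 \<le> 2" by (rule real_le_lsqrt) auto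
  have "2 * (B * C) \<le> B\<^sup>2 + C\<^sup>2" using sum_squares_bound[of B C] by simp
  then have BC: "2 * (B * C) \<le> S" using S by (smt (verit) zero_le_power2)
  have "k = sqrt 3 * (A * (B * C))" by (simp add: Sk side_prod_def ABC)
  also have "\<dots> \<le> 2 * (A * (B * C))" by (rule mult_right_mono[OF s3]) (simp add: nn)
  also have "\<dots> = A * (2 * (B * C))" by simp
  also have "\<dots> \<le> m * S" using Am BC nn by (intro mult_mono) auto
  finally have km: "k \<le> m * S" .
  have "weighted_sum a b c - of_real S * u = of_real (A\<^sup>2) * (a - u) + of_real (B\<^sup>2) * (b - u) + of_real (C\<^sup>2) * (c - u)"
    by (simp add: weighted_sum_def S ABC algebra_simps)
  also have "cmod \<dots> \<le> A\<^sup>2 * cmod (a - u) + B\<^sup>2 * cmod (b - u) + C\<^sup>2 * cmod (c - u)"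
    by (intro norm_triangle_mono) (simp_all add: norm_mult norm_power)
  also have "\<dots> \<le> A\<^sup>2 * m + B\<^sup>2 * m + C\<^sup>2 * m"
    by (intro add_mono mult_left_mono) (auto simp: m_def)
  also have "\<dots> = m * S" by (simp add: S algebra_simps)
  finally have VS: "cmod (weighted_sum a b c - of_real S * u) \<le> m * S" .
  have "of_real (S + k) * (barycenter a b c - u) = (weighted_sum a b c - of_real S * u) - of_real k * u"
    using barycenter_scaled[OF False] by (simp add: Sk algebra_simps)
  then have "(S + k) * cmod (barycenter a b c - u) = cmod ((weighted_sum a b c - of_real S * u) - of_real k * u)"
    using D by (metis add_nonneg_nonneg less_eq_real_def norm_mult norm_of_real abs_of_nonneg)
  also have "\<dots> \<le> m * S + k"
    using norm_triangle_ineq4[of "weighted_sum a b c - of_real S * u" "of_real k * u"] VS assms(4) D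
    by (simp add: norm_mult)
  also have "\<dots> \<le> 2 * (m * S)" using km by linarith
  also have "\<dots> \<le> 3 * (m * S)" using nn D by simp
  also have "\<dots> \<le> (S + k) * (3 * m)" using D nn by (simp add: algebra_simps)
  finally show ?thesis using D by (simp add: m_def)
qed

section \<open>Disc automorphisms and equilateral triangles\<close>

definition disc_shift :: "complex \<Rightarrow> complex \<Rightarrow> complex" where
  "disc_shift p x = (x - p) / (1 - cnj p * x)"

lemma disc_shift_denominator:
  assumes "cmod p < 1" "cmod x \<le> 1"
  shows "1 - cnj p * x \<noteq> 0" "1 + cnj p * x \<noteq> 0"
proof -
  have "cmod (cnj p * x) < 1"
    using assms mult_left_le[of "cmod x" "cmod p"] by (simp add: norm_mult)
  then have "cmod (cnj p * x) \<noteq> cmod 1" "cmod (cnj p * x) \<noteq> cmod (- 1)" by auto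
  then show "1 - cnj p * x \<noteq> 0" "1 + cnj p * x \<noteq> 0"
    by (auto simp: add_eq_0_iff)
qed

lemma one_minus_norm_squared:
  "complex_of_real (1 - (cmod p)\<^sup>2) = 1 - p * cnj p"
  by (simp add: complex_norm_square del: of_real_power)

lemma one_minus_norm_squared_nonzero:
  assumes "cmod p < 1"
  shows "1 - p * cnj p \<noteq> 0"
proof -
  have "(cmod p)\<^sup>2 < 1" using assms by (simp add: abs_square_less_1)
  then show ?thesis unfolding one_minus_norm_squared[symmetric] by (simp only: of_real_eq_0_iff)
qed

lemma norm_disc_shift:
  assumes "cmod p < 1" "cmod x = 1"
  shows "cmod (disc_shift p x) = 1"
proof -
  have "x * cnj (1 - cnj p * x) = x - p * (x * cnj x)" by (simp add: algebra_simps)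
  then have "x - p = x * cnj (1 - cnj p * x)" using assms by (simp add: unit_mult_cnj)
  then have "cmod (x - p) = cmod (1 - cnj p * x)"
    by (metis assms(2) complex_mod_cnj mult_1 norm_mult)
  then show ?thesis using disc_shift_denominator(1)[of p x] assms
    by (simp add: disc_shift_def norm_divide)
qed

lemma disc_shift_diff:
  assumes "1 - cnj p * x \<noteq> 0" "1 - cnj p * y \<noteq> 0"
  shows "disc_shift p x - disc_shift p y
    = (1 - p * cnj p) * (x - y) / ((1 - cnj p * x) * (1 - cnj p * y))"
  using assms by (simp add: disc_shift_def divide_simps) (simp add: algebra_simps)

lemma disc_shift_eq_iff:
  assumes "cmod p < 1" "cmod x = 1" "cmod y = 1"
  shows "disc_shift p x = disc_shift p y \<longleftrightarrow> x = y"
proof -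
  have n: "1 - cnj p * x \<noteq> 0" "1 - cnj p * y \<noteq> 0"
    using disc_shift_denominator(1) assms by auto
  have "disc_shift p x - disc_shift p y = 0 \<longleftrightarrow> x - y = 0"
    using disc_shift_diff[OF n] n one_minus_norm_squared_nonzero[OF assms(1)] by simp
  then show ?thesis by simp
qed

lemma disc_shift_unshift:
  assumes "cmod p < 1" "1 + cnj p * y \<noteq> 0"
  shows "disc_shift p ((y + p) / (1 + cnj p * y)) = y"
proof -
  have r: "1 - p * cnj p \<noteq> 0" by (rule one_minus_norm_squared_nonzero[OF assms(1)])
  have "(y + p) / (1 + cnj p * y) - p = y * (1 - p * cnj p) / (1 + cnj p * y)"
    using assms(2) by (simp add: field_simps)
  moreover have "1 - cnj p * ((y + p) / (1 + cnj p * y)) = (1 - p * cnj p) / (1 + cnj p * y)"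
    using assms(2) by (simp add: field_simps)
  ultimately show ?thesis
    unfolding disc_shift_def using r assms(2) by simp
qed

lemma disc_unshift_shift:
  assumes "cmod p < 1" "cmod x = 1"
  shows "(disc_shift p x + p) / (1 + cnj p * disc_shift p x) = x"
proof -
  have n: "1 - cnj p * x \<noteq> 0" using disc_shift_denominator(1) assms by auto
  have r: "1 - p * cnj p \<noteq> 0" by (rule one_minus_norm_squared_nonzero[OF assms(1)])
  have "disc_shift p x + p = x * (1 - p * cnj p) / (1 - cnj p * x)"
    using n by (simp add: disc_shift_def field_simps)
  moreover have "1 + cnj p * disc_shift p x = (1 - p * cnj p) / (1 - cnj p * x)"
    using n by (simp add: disc_shift_def field_simps)
  ultimately show ?thesis using r n by simp
qed

lemma norm_disc_unshift:
  assumes "cmod p < 1" "cmod y = 1"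
  shows "cmod ((y + p) / (1 + cnj p * y)) = 1"
  using norm_disc_shift[of "- p" y] assms by (simp add: disc_shift_def)

text \<open>Disc automorphisms scale chords by \<open>disc_shift_diff\<close>; after clearing the common denominator,
every vertex contributes \<open>x - 2 p + p\<^sup>2 x\<^sup>*\<close>, which is affine in \<open>x\<close> and its conjugate.\<close>

lemma weighted_sum_disc_shift:
  assumes "cmod p < 1" "cmod a = 1" "cmod b = 1" "cmod c = 1"
  shows "weighted_sum (disc_shift p a) (disc_shift p b) (disc_shift p c)
     * of_real ((cmod (1 - cnj p * a))\<^sup>2 * (cmod (1 - cnj p * b))\<^sup>2 * (cmod (1 - cnj p * c))\<^sup>2)
    = of_real ((1 - (cmod p)\<^sup>2)\<^sup>2)
     * (weighted_sum a b c - 2 * p * of_real (side_sum a b c) + p\<^sup>2 * cnj (weighted_sum a b c))"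
proof -
  define \<delta> where "\<delta> x = (cmod (1 - cnj p * x))\<^sup>2" for x
  define r where "r = (1 - (cmod p)\<^sup>2)\<^sup>2"
  have n: "1 - cnj p * x \<noteq> 0" if "cmod x = 1" for x
    using disc_shift_denominator(1) assms(1) that by auto
  have chord: "(cmod (disc_shift p x - disc_shift p y))\<^sup>2 * (\<delta> x * \<delta> y) = r * (cmod (x - y))\<^sup>2"
    if "cmod x = 1" "cmod y = 1" for x y
  proof -
    have "cmod (1 - p * cnj p) = cmod (complex_of_real (1 - (cmod p)\<^sup>2))"
      by (simp only: one_minus_norm_squared)
    then have "(cmod (1 - p * cnj p))\<^sup>2 = r" by (simp only: norm_of_real r_def power2_abs)
    then show ?thesis
      unfolding disc_shift_diff[OF n[OF that(1)] n[OF that(2)]] norm_divide norm_mult power_divide power_mult_distrib \<delta>_def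
      using n[OF that(1)] n[OF that(2)] by simp
  qed
  have pt: "disc_shift p x * of_real (\<delta> x) = x - 2 * p + p\<^sup>2 * cnj x" if "cmod x = 1" for x
  proof -
    have "of_real (\<delta> x) = (1 - cnj p * x) * (1 - p * cnj x)"
      by (simp add: \<delta>_def complex_norm_square del: of_real_power)
    then have "disc_shift p x * of_real (\<delta> x) = (x - p) * (1 - p * cnj x)"
      using n[OF that] by (simp add: disc_shift_def)
    also have "\<dots> = x - p - p * (x * cnj x) + p\<^sup>2 * cnj x"
      by (simp add: algebra_simps power2_eq_square)
    finally show ?thesis using that by (simp add: unit_mult_cnj)
  qed
  have term_eq: "of_real ((cmod (disc_shift p y - disc_shift p z))\<^sup>2) * disc_shift p x * of_real (\<delta> x * \<delta> y * \<delta> z)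
      = of_real r * (of_real ((cmod (y - z))\<^sup>2) * (x - 2 * p + p\<^sup>2 * cnj x))"
    if "cmod x = 1" "cmod y = 1" "cmod z = 1" for x y z
  proof -
    have "of_real ((cmod (disc_shift p y - disc_shift p z))\<^sup>2) * disc_shift p x * of_real (\<delta> x * \<delta> y * \<delta> z)
      = of_real ((cmod (disc_shift p y - disc_shift p z))\<^sup>2 * (\<delta> y * \<delta> z)) * (disc_shift p x * of_real (\<delta> x))"
      by (simp add: mult_ac)
    then show ?thesis by (simp add: chord[OF that(2,3)] pt[OF that(1)])
  qed
  have "weighted_sum (disc_shift p a) (disc_shift p b) (disc_shift p c) * of_real (\<delta> a * \<delta> b * \<delta> c)
    = of_real r * (of_real ((cmod (b - c))\<^sup>2) * (a - 2 * p + p\<^sup>2 * cnj a)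
       + of_real ((cmod (c - a))\<^sup>2) * (b - 2 * p + p\<^sup>2 * cnj b)
       + of_real ((cmod (a - b))\<^sup>2) * (c - 2 * p + p\<^sup>2 * cnj c))"
    using term_eq[OF assms(2,3,4)] term_eq[OF assms(3,4,2)] term_eq[OF assms(4,2,3)]
    by (simp add: weighted_sum_def distrib_left distrib_right mult_ac)
  also have "\<dots> = of_real r * (weighted_sum a b c - 2 * p * of_real (side_sum a b c) + p\<^sup>2 * cnj (weighted_sum a b c))"
    by (simp add: weighted_sum_def side_sum_def algebra_simps)
  finally show ?thesis by (simp add: \<delta>_def r_def)
qed

lemma weighted_sum_elementary:
  assumes "cmod a = 1" "cmod b = 1" "cmod c = 1"
  shows "weighted_sum a b c = 2 * (3 * (a + b + c) - cnj (a + b + c) * (a * b + b * c + c * a))"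
proof -
  define a' b' c' where cj: "a' = cnj a" "b' = cnj b" "c' = cnj c"
  have u: "a * a' = 1" "b * b' = 1" "c * c' = 1"
    using assms by (simp_all add: unit_mult_cnj cj)
  have "weighted_sum a b c = (2 - b * c' - b' * c) * a + (2 - c * a' - c' * a) * b + (2 - a * b' - a' * b) * c"
    unfolding weighted_sum_def chord_squared[OF assms(1,2)] chord_squared[OF assms(2,3)] chord_squared[OF assms(3,1)] cj ..
  also have "\<dots> = 2 * (3 * (a + b + c) - (a' + b' + c') * (a * b + b * c + c * a))"
    using u by algebra
  finally show ?thesis by (simp add: cj)
qed

lemma unit_triple_elementary:
  assumes "cmod a = 1" "cmod b = 1" "cmod c = 1"
  shows "a * b + b * c + c * a = a * b * c * cnj (a + b + c)"
proof -
  define a' b' c' where cj: "a' = cnj a" "b' = cnj b" "c' = cnj c"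
  have u: "a * a' = 1" "b * b' = 1" "c * c' = 1"
    using assms by (simp_all add: unit_mult_cnj cj)
  have "a * b + b * c + c * a = a * b * c * (a' + b' + c')" using u by algebra
  then show ?thesis by (simp add: cj)
qed

text \<open>For points of the circle the second elementary symmetric function is, up to a unit factor, the
conjugate of the first. If the weighted sum vanishes, the modulus \<open>n\<close> of \<open>a + b + c\<close> therefore satisfies
\<open>3 n = n\<^sup>2\<close>, and \<open>n = 3\<close> would force the three points to coincide. A vanishing sum of three unit
numbers means that they form an equilateral triangle.\<close>

lemma weighted_sum_eq_0_iff:
  assumes "cmod a = 1" "cmod b = 1" "cmod c = 1" "a \<noteq> b"
  shows "weighted_sum a b c = 0 \<longleftrightarrow> a + b + c = 0"
proof
  assume "weighted_sum a b c = 0"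
  then have "3 * (a + b + c) = cnj (a + b + c) * (a * b * c * cnj (a + b + c))"
    unfolding weighted_sum_elementary[OF assms(1-3)] unit_triple_elementary[OF assms(1-3)]
    by (simp del: complex_cnj_add distrib_left_numeral)
  then have "cmod (3 * (a + b + c)) = cmod (cnj (a + b + c) * (a * b * c * cnj (a + b + c)))" by simp
  then have e: "3 * cmod (a + b + c) = cmod (a + b + c) * cmod (a + b + c)"
    using assms by (simp add: norm_mult del: complex_cnj_add distrib_left_numeral)
  have "cmod (a + b + c) \<noteq> 3"
  proof
    assume 3: "cmod (a + b + c) = 3"
    have "cmod (a + b) \<ge> 2" using norm_triangle_ineq[of "a + b" c] 3 assms by simp
    then have "2\<^sup>2 \<le> (cmod (a + b))\<^sup>2" by (rule power_mono) simp
    then have "4 \<le> (cmod (a + b))\<^sup>2" by simp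
    moreover have "(cmod (a + b))\<^sup>2 + (cmod (a - b))\<^sup>2 = 4"
      using cmod_power2[of a] cmod_power2[of b] assms(1,2)
      by (simp add: cmod_power2 power2_sum power2_diff)
    moreover have "(cmod (a - b))\<^sup>2 > 0" using assms(4) by simp
    ultimately show False by linarith
  qed
  then have "cmod (a + b + c) = 0" using e by auto
  then show "a + b + c = 0" by (simp only: norm_eq_zero)
next
  assume "a + b + c = 0"
  then show "weighted_sum a b c = 0"
    unfolding weighted_sum_elementary[OF assms(1-3)] by (metis complex_cnj_zero mult_zero_left mult_zero_right diff_0_right)
qed

text \<open>This identifies the explicit formula with the conformal barycenter: the automorphism that takes the
barycenter to 0 makes the triangle equilateral, and no other point of the disc has this property.\<close>

theorem barycenter_eq_iff:
  assumes abc: "cmod a = 1" "cmod b = 1" "cmod c = 1" and "cmod p < 1"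
    and ne: "a \<noteq> b" "b \<noteq> c" "c \<noteq> a"
  shows "barycenter a b c = p \<longleftrightarrow> disc_shift p a + disc_shift p b + disc_shift p c = 0"
proof -
  define q where "q = barycenter a b c"
  have q: "cmod q < 1" using norm_barycenter_less_iff[OF abc] ne by (simp add: q_def)
  have D: "side_sum a b c + side_prod a b c \<noteq> 0"
    using side_sum_pos[of a b c] side_prod_nonneg[of a b c] ne by auto
  have pq: "1 - p * cnj q \<noteq> 0"
    using disc_shift_denominator(1)[of q p] q assms(4) by (simp add: mult.commute)
  have r: "1 - (cmod p)\<^sup>2 \<noteq> 0"
    using assms(4) by (simp add: abs_square_less_1 less_imp_neq power_less_one_iff)
  have n: "1 - cnj p * x \<noteq> 0" if "cmod x = 1" for x
    using disc_shift_denominator(1) assms(4) that by auto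
  have "disc_shift p a + disc_shift p b + disc_shift p c = 0
      \<longleftrightarrow> weighted_sum (disc_shift p a) (disc_shift p b) (disc_shift p c) = 0"
    using disc_shift_eq_iff[OF assms(4)] abc ne norm_disc_shift[OF assms(4)]
    by (subst weighted_sum_eq_0_iff) auto
  also have "\<dots> \<longleftrightarrow> weighted_sum a b c - 2 * p * of_real (side_sum a b c) + p\<^sup>2 * cnj (weighted_sum a b c) = 0"
  proof -
    have nz: "complex_of_real ((cmod (1 - cnj p * a))\<^sup>2 * (cmod (1 - cnj p * b))\<^sup>2 * (cmod (1 - cnj p * c))\<^sup>2) \<noteq> 0"
      using n abc by simp
    have nz': "complex_of_real ((1 - (cmod p)\<^sup>2)\<^sup>2) \<noteq> 0" using r by (subst of_real_eq_0_iff) simp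
    show ?thesis
      using weighted_sum_disc_shift[OF assms(4) abc] nz nz' by (metis mult_eq_0_iff)
  qed
  also have "\<dots> \<longleftrightarrow> q - p = 0"
    unfolding barycenter_factorization[OF abc, of p, simplified ne, simplified, folded q_def]
    using D pq by (simp flip: of_real_add)
  finally show ?thesis by (auto simp: q_def)
qed

lemma product_of_disc_unshifts:
  fixes x y z p p' :: complex
  assumes "x + y + z = 0" "x * y + y * z + z * x = 0"
  shows "(x + p) * (y + p) * (z + p) = x * y * z + p ^ 3"
    "(1 + p' * x) * (1 + p' * y) * (1 + p' * z) = 1 + p' ^ 3 * (x * y * z)"
proof -
  have "(x + p) * (y + p) * (z + p) = x * y * z + p * (x * y + y * z + z * x) + p\<^sup>2 * (x + y + z) + p ^ 3"
    by (simp add: algebra_simps power2_eq_square power3_eq_cube)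
  then show "(x + p) * (y + p) * (z + p) = x * y * z + p ^ 3" using assms by simp
  have "(1 + p' * x) * (1 + p' * y) * (1 + p' * z)
      = 1 + p' * (x + y + z) + p'\<^sup>2 * (x * y + y * z + z * x) + p' ^ 3 * (x * y * z)"
    by (simp add: algebra_simps power2_eq_square power3_eq_cube)
  then show "(1 + p' * x) * (1 + p' * y) * (1 + p' * z) = 1 + p' ^ 3 * (x * y * z)" using assms by simp
qed

text \<open>An equilateral triangle consists of the cube roots of the product \<open>t\<close> of its vertices. The vertices of
the original triangle are therefore determined by \<open>p\<close> and \<open>t\<close>, and their product arises from \<open>t\<close> by a
disc automorphism, in which only the cube of \<open>p\<close> survives because the first two elementary symmetric
functions of an equilateral triangle vanish.\<close>

lemma barycenter_normal_form:
  assumes abc: "cmod a = 1" "cmod b = 1" "cmod c = 1" and ne: "a \<noteq> b" "b \<noteq> c" "c \<noteq> a"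
  defines "p \<equiv> barycenter a b c"
  defines "t \<equiv> disc_shift p a * disc_shift p b * disc_shift p c"
  shows "(X - disc_shift p a) * (X - disc_shift p b) * (X - disc_shift p c) = X ^ 3 - t"
    and "cmod t = 1" and "a * b * c = (t + p ^ 3) / (1 + cnj (p ^ 3) * t)"
proof -
  have p: "cmod p < 1" using norm_barycenter_less_iff[OF abc] ne by (simp add: p_def)
  note u = norm_disc_shift[OF p abc(1)] norm_disc_shift[OF p abc(2)] norm_disc_shift[OF p abc(3)]
  define x y z where xyz: "x = disc_shift p a" "y = disc_shift p b" "z = disc_shift p c"
  have s: "x + y + z = 0"
    using barycenter_eq_iff[OF abc p ne] by (simp add: p_def xyz)
  then have s2: "x * y + y * z + z * x = 0"
    using unit_triple_elementary[OF u] unfolding xyz by simp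
  have "(X - x) * (X - y) * (X - z) = X ^ 3 - (x + y + z) * X\<^sup>2 + (x * y + y * z + z * x) * X - x * y * z"
    by (simp add: algebra_simps power2_eq_square power3_eq_cube)
  then show "(X - disc_shift p a) * (X - disc_shift p b) * (X - disc_shift p c) = X ^ 3 - t"
    using s s2 by (simp add: xyz t_def)
  show "cmod t = 1" by (simp add: t_def norm_mult u)
  have inv: "a = (x + p) / (1 + cnj p * x)" "b = (y + p) / (1 + cnj p * y)" "c = (z + p) / (1 + cnj p * z)"
    using disc_unshift_shift[OF p] abc by (simp_all add: xyz)
  have "a * b * c = ((x + p) * (y + p) * (z + p)) / ((1 + cnj p * x) * (1 + cnj p * y) * (1 + cnj p * z))"
    by (subst inv(1), subst inv(2), subst inv(3)) simp
  then show "a * b * c = (t + p ^ 3) / (1 + cnj (p ^ 3) * t)"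
    unfolding product_of_disc_unshifts[OF s s2] by (simp add: t_def xyz)
qed

text \<open>The product determines \<open>t\<close> because disc automorphisms are injective, and \<open>t\<close> determines the
equilateral triangle.\<close>

lemma triple_eq_of_barycenter_and_product:
  assumes abc: "cmod a = 1" "cmod b = 1" "cmod c = 1" and ne: "a \<noteq> b" "b \<noteq> c" "c \<noteq> a"
    and def: "cmod d = 1" "cmod e = 1" "cmod f = 1" and ne': "d \<noteq> e" "e \<noteq> f" "f \<noteq> d"
    and bary: "barycenter a b c = barycenter d e f" and prod: "a * b * c = d * e * f"
  shows "{a, b, c} = {d, e, f}"
proof -
  define p where "p = barycenter a b c"
  have p': "barycenter d e f = p" using bary by (simp add: p_def)
  have p: "cmod p < 1" using norm_barycenter_less_iff[OF abc] ne by (simp add: p_def)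
  define t where "t = disc_shift p a * disc_shift p b * disc_shift p c"
  define t' where "t' = disc_shift p d * disc_shift p e * disc_shift p f"
  note nf = barycenter_normal_form[OF abc ne, folded p_def, folded t_def]
  note nf' = barycenter_normal_form[OF def ne', unfolded p', folded t'_def]
  have p3: "cmod (p ^ 3) < 1" using p by (simp add: norm_power power_less_one_iff)
  have "disc_shift (p ^ 3) (a * b * c) = t" "disc_shift (p ^ 3) (d * e * f) = t'"
    unfolding nf(3) nf'(3)
    using disc_shift_unshift[OF p3] disc_shift_denominator(2)[OF p3] nf(2) nf'(2) by auto
  then have tt: "t = t'" using prod by simp
  have sub: "x \<in> {a, b, c}" if x: "x \<in> {d, e, f}" for x
  proof -
    have xn: "cmod x = 1" using x def by auto
    have "disc_shift p x ^ 3 - t' = 0"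
      using nf'(1)[of "disc_shift p x", symmetric] x by auto
    then have "(disc_shift p x - disc_shift p a) * (disc_shift p x - disc_shift p b) * (disc_shift p x - disc_shift p c) = 0"
      unfolding nf(1) tt .
    then have "disc_shift p x = disc_shift p a \<or> disc_shift p x = disc_shift p b \<or> disc_shift p x = disc_shift p c"
      by simp
    then show ?thesis using disc_shift_eq_iff[OF p xn] abc by auto
  qed
  have "card {d, e, f} = 3" "card {a, b, c} = 3" using ne ne' by auto
  then show ?thesis using sub by (intro card_subset_eq[symmetric]) auto
qed

text \<open>The triangle is the preimage of the equilateral triangle of the cube roots of \<open>t\<close> under
\<open>disc_shift p\<close>, with \<open>t\<close> chosen so that the product of the vertices is the given one.\<close>

lemma barycenter_product_surj:
  assumes p: "cmod p < 1" and M: "cmod M = 1"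
  shows "\<exists>a b c. cmod a = 1 \<and> cmod b = 1 \<and> cmod c = 1 \<and> barycenter a b c = p \<and> a * b * c = M"
proof -
  have p3: "cmod (p ^ 3) < 1" using p by (simp add: norm_power power_less_one_iff)
  define t where "t = disc_shift (p ^ 3) M"
  have t: "cmod t = 1" using norm_disc_shift[OF p3 M] by (simp add: t_def)
  define u where "u = cis (Arg t / 3)"
  have "t \<noteq> 0" using t by auto
  then have "cis (Arg t) = t"
    using t cis_Arg[of t] by (simp add: sgn_div_norm)
  moreover have "real 3 * (Arg t / 3) = Arg t" by simp
  then have "u ^ 3 = cis (Arg t)" by (simp only: u_def Complex.DeMoivre)
  ultimately have u3: "u ^ 3 = t" by simp
  have un: "cmod u = 1" by (simp add: u_def)
  \<comment> \<open>a primitive cube root of unity\<close>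
  define w where "w = cis (2 * pi / 3)"
  have w3: "w ^ 3 = 1" by (simp add: w_def Complex.DeMoivre)
  have w1: "w \<noteq> 1"
  proof
    assume "w = 1"
    then have "Re w = 1" by simp
    then show False by (simp add: w_def cos_120)
  qed
  have "(w - 1) * (1 + w + w\<^sup>2) = 0"
    using w3 by (simp add: algebra_simps power2_eq_square power3_eq_cube)
  then have w0: "1 + w + w\<^sup>2 = 0" using w1 by simp
  have wn: "cmod w = 1" by (simp add: w_def)
  have w2: "w \<noteq> w\<^sup>2" "w\<^sup>2 \<noteq> 1"
    using w1 wn w3 by (auto simp: power2_eq_square power3_eq_cube)
  define x y z where xyz: "x = u" "y = u * w" "z = u * w\<^sup>2"
  have xyzn: "cmod x = 1" "cmod y = 1" "cmod z = 1" by (simp_all add: xyz norm_mult norm_power un wn)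
  have u0: "u \<noteq> 0" using un by auto
  have dist: "x \<noteq> y" "y \<noteq> z" "z \<noteq> x" using w1 w2 u0 by (simp_all add: xyz)
  have s: "x + y + z = 0"
  proof -
    have "x + y + z = u * (1 + w + w\<^sup>2)" by (simp add: xyz algebra_simps)
    then show ?thesis using w0 by simp
  qed
  have s2: "x * y + y * z + z * x = 0"
    using unit_triple_elementary[OF xyzn] s by simp
  have "x * y * z = u ^ 3 * w ^ 3" by (simp add: xyz power2_eq_square power3_eq_cube)
  then have s3: "x * y * z = t" using u3 w3 by simp
  define f where "f v = (v + p) / (1 + cnj p * v)" for v
  have f: "cmod (f v) = 1" "disc_shift p (f v) = v" if "cmod v = 1" for v
    using norm_disc_unshift[OF p that] disc_shift_unshift[OF p] disc_shift_denominator(2)[OF p] that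
    by (auto simp: f_def)
  have ne: "f x \<noteq> f y" "f y \<noteq> f z" "f z \<noteq> f x"
    using f(2) xyzn dist by metis+
  have "barycenter (f x) (f y) (f z) = p"
    using barycenter_eq_iff[OF f(1)[OF xyzn(1)] f(1)[OF xyzn(2)] f(1)[OF xyzn(3)] p ne] f(2) xyzn s
    by simp
  moreover have "f x * f y * f z = (t + p ^ 3) / (1 + cnj p ^ 3 * t)"
    unfolding s3[symmetric] product_of_disc_unshifts[OF s s2, symmetric] by (simp add: f_def)
  moreover have "(t + p ^ 3) / (1 + cnj p ^ 3 * t) = M"
    using disc_unshift_shift[OF p3 M] by (simp add: t_def)
  ultimately show ?thesis using f(1) xyzn by metis
qed

section \<open>Folding the boundary of the solid torus\<close>

text \<open>The powers of \<open>\<bar>Y\<bar>\<close> are chosen to make the map continuous at \<open>Y = 0\<close> and to make the quotient of the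
two coordinates a Joukowski function, see \<open>fold_vector_polar\<close>.\<close>

definition fold_vector :: "complex \<Rightarrow> complex \<Rightarrow> complex \<times> complex" where
  "fold_vector M Y = (of_real (cmod Y) * Y, M + of_real (cmod Y) * Y ^ 3 * cnj M)"

lemma fold_vector_nonzero:
  assumes "cmod M = 1"
  shows "fold_vector M Y \<noteq> 0"
  using assms by (cases "Y = 0") (auto simp: fold_vector_def zero_prod_def)

lemma joukowski_eq_iff:
  fixes x y :: complex
  assumes "x \<noteq> 0" "y \<noteq> 0"
  shows "x + 1 / x = y + 1 / y \<longleftrightarrow> x = y \<or> x * y = 1"
proof -
  have "x + 1 / x - (y + 1 / y) = (x - y) * (x * y - 1) / (x * y)"
    using assms by (simp add: field_simps)
  then have "x + 1 / x - (y + 1 / y) = 0 \<longleftrightarrow> x = y \<or> x * y = 1"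
    using assms by simp
  then show ?thesis by simp
qed

lemma joukowski_surj:
  fixes w :: complex
  obtains x where "cmod x \<ge> 1" "x + 1 / x = w"
proof -
  \<comment> \<open>The roots \<open>x, y\<close> of \<open>X\<^sup>2 - w X + 1\<close> are inverse to each other, so one of them has modulus at least 1.\<close>
  define s where "s = csqrt (w\<^sup>2 - 4)"
  define x y where "x = (w + s) / 2" and "y = (w - s) / 2"
  have "x * y = (w\<^sup>2 - s\<^sup>2) / 4" by (simp add: x_def y_def algebra_simps power2_eq_square)
  then have xy: "x * y = 1" by (simp add: s_def)
  have sum: "x + y = w" by (simp add: x_def y_def field_simps)
  have nz: "x \<noteq> 0" "y \<noteq> 0" using xy by auto
  have inv: "y = 1 / x" "x = 1 / y" using xy nz by (auto simp: field_simps)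
  have "cmod x * cmod y = 1" using xy by (metis norm_mult norm_one)
  then have "\<not> (cmod x < 1 \<and> cmod y < 1)"
    using mult_strict_mono[of "cmod x" 1 "cmod y" 1] by auto
  then have "cmod x \<ge> 1 \<or> cmod y \<ge> 1" by auto
  then show ?thesis
  proof
    assume "cmod x \<ge> 1" then show ?thesis using that[of x] sum unfolding inv(1) by simp
  next
    assume "cmod y \<ge> 1" then show ?thesis using that[of y] sum unfolding inv(2) by (simp add: add.commute)
  qed
qed

text \<open>Here \<open>l\<close> is a square root of the cube of the direction \<open>k\<^sup>2\<close> of \<open>Y\<close>. The argument of the Joukowski
function has modulus \<open>1 / s\<^sup>2\<close> and the direction of \<open>M / l\<close>, so it sweeps the complement of the open
unit disc as \<open>Y\<close> moves along a radius of the closed disc and \<open>M\<close> along the circle.\<close>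

lemma fold_vector_polar:
  assumes "cmod M = 1" "cmod k = 1" "s > 0" "Y = of_real s * k\<^sup>2" "l\<^sup>2 = k ^ 6" "cmod l = 1"
  shows "fold_vector M Y = (of_real (s\<^sup>2) * k\<^sup>2,
     l * of_real (s\<^sup>2) * (M / (l * of_real (s\<^sup>2)) + 1 / (M / (l * of_real (s\<^sup>2)))))"
proof -
  have M: "M \<noteq> 0" using assms(1) by auto
  have cM: "cnj M = 1 / M" using unit_mult_cnj[OF assms(1)] M by (simp add: field_simps)
  have l: "l \<noteq> 0" using assms(6) by auto
  have "cmod Y = s" using assms by (simp add: norm_mult norm_power)
  moreover have "Y ^ 3 = of_real (s ^ 3) * l\<^sup>2"
    unfolding assms(4,5) by (simp add: power_mult_distrib flip: power_mult)
  then have "of_real s * Y ^ 3 * cnj M = of_real (s ^ 4) * l\<^sup>2 / M"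
    by (simp add: cM power3_eq_cube power4_eq_xxxx)
  ultimately show ?thesis
    using M l assms(3,4) by (simp add: fold_vector_def field_simps power2_eq_square power4_eq_xxxx)
qed

text \<open>The first coordinates give equal directions of \<open>Y\<close> and \<open>Y'\<close>. The second ones give equal Joukowski
values, hence equal or inverse arguments; inverse arguments of modulus at least 1 have modulus 1, which
is the identification on the boundary torus.\<close>

lemma fold_vector_ray_eq:
  assumes M: "cmod M = 1" "cmod M' = 1" and Y: "cmod Y \<le> 1" "cmod Y' \<le> 1" and "c > 0"
    and eq: "fold_vector M Y = c *\<^sub>R fold_vector M' Y'"
  shows "Y = Y' \<and> (M = M' \<or> cmod Y = 1 \<and> M * M' = Y ^ 3)"
proof (cases "Y = 0")
  case True
  then have Y': "Y' = 0" using eq \<open>c > 0\<close> by (auto simp: fold_vector_def)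
  then have "M = c *\<^sub>R M'" using eq True by (simp add: fold_vector_def)
  moreover then have "c = 1" using M \<open>c > 0\<close> by (metis abs_of_pos mult.right_neutral norm_scaleR)
  ultimately show ?thesis using True Y' by simp
next
  case False
  define s s' where "s = cmod Y" "s' = cmod Y'"
  have first: "of_real s * Y = of_real c * (of_real s' * Y')"
    using eq by (simp add: fold_vector_def s_s'_def scaleR_conv_of_real)
  then have ss: "s\<^sup>2 = c * s'\<^sup>2"
    using \<open>c > 0\<close> by (metis abs_norm_cancel abs_of_pos norm_mult norm_of_real power2_eq_square s_s'_def)
  have s: "s > 0" "s' > 0" using False ss \<open>c > 0\<close> by (auto simp: s_s'_def)
  \<comment> \<open>\<open>k\<^sup>2\<close> is the common direction of \<open>Y\<close> and \<open>Y'\<close>, and \<open>l\<^sup>2\<close> is its cube.\<close>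
  define k where "k = csqrt (Y / of_real s)"
  have k2: "k\<^sup>2 = Y / of_real s" by (simp add: k_def)
  have "cmod (k\<^sup>2) = 1" using s by (simp add: k2 norm_divide s_s'_def)
  then have k: "cmod k = 1" by (simp add: norm_power power2_eq_1_iff) (smt (verit) norm_ge_zero)
  define l where "l = k ^ 3"
  have l: "l\<^sup>2 = k ^ 6" "cmod l = 1" "l \<noteq> 0"
    using k by (auto simp: l_def norm_power simp flip: power_mult)
  have Yk: "Y = of_real s * k\<^sup>2" using s by (simp add: k2)
  have "of_real (s'\<^sup>2) * Y' = of_real s' * (of_real s * Y) / of_real c"
    using first \<open>c > 0\<close> by (simp add: power2_eq_square)
  also have "\<dots> = of_real s' * of_real (s\<^sup>2) * k\<^sup>2 / of_real c"
    by (simp add: Yk power2_eq_square)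
  also have "\<dots> = of_real (s'\<^sup>2) * (of_real s' * k\<^sup>2)"
    unfolding ss using \<open>c > 0\<close> by (simp add: power2_eq_square)
  finally have Yk': "Y' = of_real s' * k\<^sup>2" using s by simp
  define x x' where "x = M / (l * of_real (s\<^sup>2))" "x' = M' / (l * of_real (s'\<^sup>2))"
  have M0: "M \<noteq> 0" "M' \<noteq> 0" using M by auto
  have x0: "x \<noteq> 0" "x' \<noteq> 0" using M0 l s by (auto simp: x_x'_def)
  have "l * of_real (s\<^sup>2) * (x + 1 / x) = of_real c * (l * of_real (s'\<^sup>2) * (x' + 1 / x'))"
    using eq unfolding fold_vector_polar[OF M(1) k s(1) Yk l(1,2)] fold_vector_polar[OF M(2) k s(2) Yk' l(1,2)]
      x_x'_def scaleR_Pair by (simp only: scaleR_conv_of_real prod.inject)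
  also have "\<dots> = l * of_real (s\<^sup>2) * (x' + 1 / x')"
    by (simp add: ss)
  finally have "x + 1 / x = x' + 1 / x'" using l s by simp
  then consider "x = x'" | "x * x' = 1" using joukowski_eq_iff x0 by blast
  then show ?thesis
  proof cases
    case 1
    then have "cmod x = cmod x'" by simp
    then have "s\<^sup>2 = s'\<^sup>2" using M l s by (simp add: x_x'_def norm_divide norm_mult norm_power)
    then have "s = s'" using s by simp
    then show ?thesis using 1 l s Yk Yk' by (simp add: x_x'_def)
  next
    case 2
    then have "cmod x * cmod x' = 1" by (metis norm_mult norm_one)
    then have "s\<^sup>2 * s'\<^sup>2 = 1" using M l s by (simp add: x_x'_def norm_divide norm_mult norm_power field_simps)
    moreover have "s\<^sup>2 \<le> 1" "s'\<^sup>2 \<le> 1" using Y s by (simp_all add: s_s'_def power_le_one)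
    moreover from this have "s\<^sup>2 * s'\<^sup>2 \<le> s\<^sup>2" "s\<^sup>2 * s'\<^sup>2 \<le> s'\<^sup>2"
      by (simp_all add: mult_left_le mult_left_le_one_le)
    ultimately have "s\<^sup>2 = 1" "s'\<^sup>2 = 1" by linarith+
    then have s1: "s = 1" "s' = 1" using s by (simp_all add: power2_eq_1_iff)
    then have "M * M' = l\<^sup>2" using 2 l by (simp add: x_x'_def field_simps power2_eq_square)
    then show ?thesis using s1 Yk Yk' l k by (simp add: norm_power flip: power_mult)
  qed
qed

text \<open>The Joukowski function maps the complement of the open unit disc onto the plane. Its argument yields
\<open>M\<close> through the direction and \<open>\<bar>Y\<bar>\<close> through the modulus.\<close>

lemma fold_vector_surj:
  assumes "(z, w) \<noteq> (0, 0)"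
  obtains M Y c where "cmod M = 1" "cmod Y \<le> 1" "c > 0" "c *\<^sub>R fold_vector M Y = (z, w)"
proof (cases "z = 0")
  case True
  then have w: "w \<noteq> 0" using assms by simp
  show ?thesis
    by (rule that[of "sgn w" 0 "cmod w"])
      (use True w in \<open>auto simp: fold_vector_def norm_sgn sgn_div_norm\<close>)
next
  case False
  define k where "k = csqrt (sgn z)"
  have k2: "k\<^sup>2 = sgn z" by (simp add: k_def)
  have "cmod (k\<^sup>2) = 1" using False by (simp add: k2 norm_sgn)
  then have k: "cmod k = 1" by (simp add: norm_power power2_eq_1_iff) (smt (verit) norm_ge_zero)
  define l where "l = k ^ 3"
  have l: "l\<^sup>2 = k ^ 6" "cmod l = 1" "l \<noteq> 0"
    using k by (auto simp: l_def norm_power simp flip: power_mult)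
  obtain x where x: "cmod x \<ge> 1" "x + 1 / x = w / (l * of_real (cmod z))"
    using joukowski_surj by blast
  then have x0: "cmod x > 0" "x \<noteq> 0" by auto
  define s where "s = 1 / sqrt (cmod x)"
  have s: "s > 0" using x0 by (simp add: s_def)
  have s2: "s\<^sup>2 = 1 / cmod x" using x0 by (simp add: s_def power_divide)
  define M where "M = l * sgn x"
  have M: "cmod M = 1" using l x0 by (simp add: M_def norm_mult norm_sgn)
  have "M / (l * of_real (s\<^sup>2)) = x"
    using l x0 by (simp add: M_def s2 sgn_div_norm scaleR_conv_of_real)
  then have f: "fold_vector M (of_real s * k\<^sup>2) = (of_real (s\<^sup>2) * k\<^sup>2, l * of_real (s\<^sup>2) * (x + 1 / x))"
    using fold_vector_polar[OF M k s refl l(1,2)] by simp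
  define c where "c = cmod z * cmod x"
  have c: "c > 0" using False x0 by (simp add: c_def)
  have cs: "c * s\<^sup>2 = cmod z" using x0 by (simp add: c_def s2)
  have "c *\<^sub>R (of_real (s\<^sup>2) * k\<^sup>2) = of_real (c * s\<^sup>2) * k\<^sup>2"
    by (simp add: scaleR_conv_of_real)
  also have "\<dots> = z" unfolding cs k2 using False by (simp add: sgn_div_norm scaleR_conv_of_real)
  finally have 1: "c *\<^sub>R (of_real (s\<^sup>2) * k\<^sup>2) = z" .
  have "c *\<^sub>R (l * of_real (s\<^sup>2) * (x + 1 / x)) = of_real (c * s\<^sup>2) * (l * (x + 1 / x))"
    by (simp add: scaleR_conv_of_real)
  also have "\<dots> = w" unfolding cs x(2) using False l by simp
  finally have 2: "c *\<^sub>R (l * of_real (s\<^sup>2) * (x + 1 / x)) = w" .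
  have "s\<^sup>2 \<le> 1" unfolding s2 using x x0 by simp
  then have "s\<^sup>2 \<le> 1\<^sup>2" by simp
  then have "s \<le> 1" by (rule power2_le_imp_le) simp
  then have "cmod (of_real s * k\<^sup>2) \<le> 1" using s k by (simp add: norm_mult norm_power)
  then show ?thesis
    using that[OF M _ c, of "of_real s * k\<^sup>2"] f 1 2 by simp
qed

text \<open>The conjugate turns the barycenter, of weight 1 under rotation, into a coordinate of weight 2.\<close>

definition triple_vector :: "complex \<Rightarrow> complex \<Rightarrow> complex \<Rightarrow> complex \<times> complex" where
  "triple_vector a b c = fold_vector (a * b * c) (a * b * c * cnj (barycenter a b c))"

lemma triple_vector_nonzero:
  assumes "cmod a = 1" "cmod b = 1" "cmod c = 1"
  shows "triple_vector a b c \<noteq> 0"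
  unfolding triple_vector_def by (rule fold_vector_nonzero) (simp add: norm_mult assms)

lemma triple_vector_swap12: "triple_vector b a c = triple_vector a b c"
  by (simp add: triple_vector_def barycenter_swap12[of b a] mult.commute)

lemma triple_vector_swap23: "triple_vector a c b = triple_vector a b c"
  by (simp add: triple_vector_def barycenter_swap23[of a c] mult_ac)

text \<open>Symmetry in \<open>a\<close> and \<open>b\<close> of the right-hand side is what makes the map depend on sets only, and not on
multisets.\<close>

lemma triple_vector_double:
  assumes "cmod a = 1" "cmod b = 1"
  shows "triple_vector a a b = (a * b, a * b * (a + b))"
proof -
  define a' b' where ab: "a' = cnj a" "b' = cnj b"
  have u: "a * a' = 1" "b * b' = 1" using assms by (simp_all add: unit_mult_cnj ab)
  have Y: "a * a * b * cnj (barycenter a a b) = a * b"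
    using u by (simp add: barycenter_double flip: ab)
  have "(a * b) ^ 3 * (a' * a' * b') = a * b * b" using u by algebra
  then have "(a * b) ^ 3 * cnj (a * a * b) = a * b * b" by (simp add: ab)
  then show ?thesis
    unfolding triple_vector_def Y fold_vector_def using assms
    by (simp add: norm_mult distrib_left del: complex_cnj_mult)
qed

lemma triple_vector_set_cong:
  assumes "cmod a = 1" "cmod b = 1" "cmod c = 1" "cmod d = 1" "cmod e = 1" "cmod f = 1"
    and "{a, b, c} = {d, e, f}"
  shows "triple_vector a b c = triple_vector d e f"
proof -
  note swaps = triple_vector_swap12 triple_vector_swap23
  have perm: "triple_vector x y z = triple_vector y x z" "triple_vector x y z = triple_vector x z y"
    "triple_vector x y z = triple_vector y z x" "triple_vector x y z = triple_vector z x y"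
    "triple_vector x y z = triple_vector z y x" for x y z
    by (rule swaps trans[OF swaps(1,2)] trans[OF swaps(2,1)] trans[OF swaps(1) trans[OF swaps(2,1)]])+
  have degenerate: "\<exists>x y. {u, v, w} = {x, y} \<and> triple_vector u v w = triple_vector x x y"
    if deg: "\<not> (u \<noteq> v \<and> v \<noteq> w \<and> w \<noteq> u)" for u v w
  proof -
    consider "u = v" | "v = w" | "w = u" using deg by blast
    then show ?thesis
    proof cases
      case 1 then show ?thesis by (intro exI[of _ u] exI[of _ w]) simp
    next
      case 2 then show ?thesis using perm(3)[of u v v] by (intro exI[of _ v] exI[of _ u]) auto
    next
      case 3 then show ?thesis using perm(2)[of u v u] by (intro exI[of _ u] exI[of _ v]) auto
    qed
  qed
  have dbl: "triple_vector x x y = triple_vector y y x" if "cmod x = 1" "cmod y = 1" for x y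
    unfolding triple_vector_double[OF that] triple_vector_double[OF that(2,1)] by (simp add: algebra_simps)
  show ?thesis
  proof (cases "a \<noteq> b \<and> b \<noteq> c \<and> c \<noteq> a")
    case True
    have "card {a, b, c} = 3" using True by auto
    then have "card {d, e, f} = 3" using assms(7) by simp
    then have "d \<noteq> e \<and> e \<noteq> f \<and> f \<noteq> d" by (auto simp: card_insert_if split: if_splits)
    moreover have "a \<in> {d, e, f}" "b \<in> {d, e, f}" "c \<in> {d, e, f}"
      unfolding assms(7)[symmetric] by auto
    ultimately have "(a = d \<and> b = e \<and> c = f) \<or> (a = d \<and> b = f \<and> c = e) \<or> (a = e \<and> b = d \<and> c = f)
       \<or> (a = e \<and> b = f \<and> c = d) \<or> (a = f \<and> b = d \<and> c = e) \<or> (a = f \<and> b = e \<and> c = d)"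
      using True by fast
    then show ?thesis
      by (elim disjE conjE) (simp_all only: perm[of d e f, symmetric])
  next
    case False
    obtain x y where xy: "{a, b, c} = {x, y}" "triple_vector a b c = triple_vector x x y"
      using degenerate[OF False] by (elim exE conjE)
    have "x \<in> {a, b, c}" "y \<in> {a, b, c}" unfolding xy(1) by auto
    then have xyn: "cmod x = 1" "cmod y = 1" using assms(1-3) by auto
    have deg': "\<not> (d \<noteq> e \<and> e \<noteq> f \<and> f \<noteq> d)"
    proof
      assume "d \<noteq> e \<and> e \<noteq> f \<and> f \<noteq> d"
      then have "card {d, e, f} = 3" by auto
      moreover have "card {x, y} \<le> 2" by (simp add: card_insert_if)
      ultimately show False using xy(1) assms(7) by simp
    qed
    obtain x' y' where xy': "{d, e, f} = {x', y'}" "triple_vector d e f = triple_vector x' x' y'"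
      using degenerate[OF deg'] by (elim exE conjE)
    have "{x, y} = {x', y'}" using assms(7) unfolding xy(1) xy'(1) .
    then have "(x = x' \<and> y = y') \<or> (x = y' \<and> y = x')" by (auto simp: doubleton_eq_iff)
    then show ?thesis using dbl[OF xyn] xy(2) xy'(2) by auto
  qed
qed

lemma barycenter_degenerate:
  assumes "\<not> (a \<noteq> b \<and> b \<noteq> c \<and> c \<noteq> a)"
  obtains x y where "{a, b, c} = {x, y}" "a * b * c = x * x * y" "barycenter a b c = x"
proof -
  consider "a = b" | "b = c" | "c = a" using assms by blast
  then show ?thesis
  proof cases
    case 1 then show ?thesis using that[of a c] by (auto simp: barycenter_double)
  next
    case 2 then show ?thesis using that[of b a] barycenter_double[of b a]
        barycenter_swap23[of b a b] barycenter_swap12[of b a b] by (auto simp: mult_ac)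
  next
    case 3 then show ?thesis using that[of a b] barycenter_double[of a b]
        barycenter_swap23[of a a b] by (auto simp: mult_ac)
  qed
qed

text \<open>In the interior \<open>M\<close> and the barycenter are recovered and determine the set. On the boundary
\<open>Y = x y\<close> and \<open>M = x\<^sup>2 y\<close>, so \<open>M\<close> and \<open>Y\<close> determine \<open>x\<close> and \<open>y\<close>, and replacing \<open>M\<close> by \<open>Y\<^sup>3 / M\<close> exchanges
the two.\<close>

lemma triple_vector_ray_eq_imp_set_eq:
  assumes abc: "cmod a = 1" "cmod b = 1" "cmod c = 1" and def: "cmod d = 1" "cmod e = 1" "cmod f = 1"
    and "r > 0" and eq: "triple_vector a b c = r *\<^sub>R triple_vector d e f"
  shows "{a, b, c} = {d, e, f}"
proof -
  define M M' p p' where Mp: "M = a * b * c" "M' = d * e * f" "p = barycenter a b c" "p' = barycenter d e f"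
  have M: "cmod M = 1" "cmod M' = 1" by (simp_all add: Mp norm_mult abc def)
  have p: "cmod p \<le> 1" "cmod p' \<le> 1" using norm_barycenter_le abc def by (simp_all add: Mp)
  have nY: "cmod (M * cnj p) = cmod p" "cmod (M' * cnj p') = cmod p'" by (simp_all add: norm_mult M)
  have "cmod (M * cnj p) \<le> 1" "cmod (M' * cnj p') \<le> 1" using p nY by simp_all
  from fold_vector_ray_eq[OF M this \<open>r > 0\<close> eq[unfolded triple_vector_def, folded Mp]]
  have r: "M * cnj p = M' * cnj p'" "M = M' \<or> cmod (M * cnj p) = 1 \<and> M * M' = (M * cnj p) ^ 3"
    by blast+
  have np: "cmod p = cmod p'" using r(1) nY by metis
  show ?thesis
  proof (cases "cmod p < 1")
    case True
    then have "M = M'" using r(2) nY by simp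
    moreover from this have "p = p'" using r(1) M by auto
    moreover have "a \<noteq> b" "b \<noteq> c" "c \<noteq> a" "d \<noteq> e" "e \<noteq> f" "f \<noteq> d"
      using norm_barycenter_less_iff[OF abc] norm_barycenter_less_iff[OF def] True np by (auto simp: Mp)
    ultimately show ?thesis using abc def by (intro triple_eq_of_barycenter_and_product) (auto simp: Mp)
  next
    case False
    have "\<not> (a \<noteq> b \<and> b \<noteq> c \<and> c \<noteq> a)"
      using norm_barycenter_less_iff[OF abc] False by (simp add: Mp)
    then obtain x y where xy: "{a, b, c} = {x, y}" "M = x * x * y" "p = x"
      unfolding Mp by (rule barycenter_degenerate)
    have "\<not> (d \<noteq> e \<and> e \<noteq> f \<and> f \<noteq> d)"
      using norm_barycenter_less_iff[OF def] False np by (simp add: Mp)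
    then obtain x' y' where xy': "{d, e, f} = {x', y'}" "M' = x' * x' * y'" "p' = x'"
      unfolding Mp by (rule barycenter_degenerate)
    have "x \<in> {a, b, c}" "y \<in> {a, b, c}" "x' \<in> {d, e, f}" "y' \<in> {d, e, f}"
      unfolding xy(1) xy'(1) by auto
    then have n: "cmod x = 1" "cmod y = 1" "cmod x' = 1" "cmod y' = 1" using abc def by auto
    then have nz: "x \<noteq> 0" "y \<noteq> 0" "x' \<noteq> 0" "y' \<noteq> 0" by auto
    have Y: "M * cnj p = x * y" "M' * cnj p' = x' * y'"
      using unit_mult_cnj[OF n(1)] unit_mult_cnj[OF n(3)] by (simp_all add: xy xy' mult_ac)
    then have pr: "x * y = x' * y'" using r(1) by simp
    have "(x = x' \<and> y = y') \<or> (x = y' \<and> y = x')"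
      using r(2)
    proof
      assume "M = M'"
      then have "x * (x * y) = x' * (x * y)" by (simp add: xy xy' pr mult.assoc)
      then have "x = x'" using nz by simp
      then show ?thesis using pr nz by simp
    next
      assume "cmod (M * cnj p) = 1 \<and> M * M' = (M * cnj p) ^ 3"
      then have "M * M' = (x * y) ^ 3" unfolding Y by simp
      then have "x * (x * y) * (x' * (x' * y')) = (x * y) * (x * y) * (x * y)"
        unfolding xy(2) xy'(2) by (simp only: mult.assoc power3_eq_cube)
      then have "x * x' = x * y" unfolding pr[symmetric] using nz by (simp add: mult_ac)
      then have "x' = y" using nz by simp
      then show ?thesis using pr nz by (simp add: mult.commute)
    qed
    then have "{x, y} = {x', y'}" by auto
    then show ?thesis unfolding xy(1) xy'(1) .
  qed
qed

lemma triple_vector_surj: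
  assumes "v \<noteq> 0"
  obtains a b c r where "cmod a = 1" "cmod b = 1" "cmod c = 1" "r > 0" "v = r *\<^sub>R triple_vector a b c"
proof -
  obtain z w where v: "v = (z, w)" by (cases v)
  with assms have "(z, w) \<noteq> (0, 0)" by (simp add: zero_prod_def)
  then obtain M Y c where MY: "cmod M = 1" "cmod Y \<le> 1" "c > 0" "c *\<^sub>R fold_vector M Y = (z, w)"
    by (rule fold_vector_surj)
  define p where "p = M * cnj Y"
  have p: "cmod p \<le> 1" using MY by (simp add: p_def norm_mult)
  have Y: "M * cnj p = Y" using unit_mult_cnj[OF MY(1)] by (simp add: p_def)
  have "\<exists>a b c. cmod a = 1 \<and> cmod b = 1 \<and> cmod c = 1 \<and> barycenter a b c = p \<and> a * b * c = M"
  proof (cases "cmod p < 1")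
    case True
    then show ?thesis using barycenter_product_surj MY(1) by blast
  next
    case False
    then have p1: "cmod p = 1" using p by simp
    then have "p \<noteq> 0" by auto
    then show ?thesis using p1 MY(1) barycenter_double[of p "M / (p * p)"]
      by (intro exI[of _ p] exI[of _ p] exI[of _ "M / (p * p)"]) (simp add: norm_divide norm_mult)
  qed
  then obtain a b c' where "cmod a = 1" "cmod b = 1" "cmod c' = 1" "barycenter a b c' = p" "a * b * c' = M"
    by blast
  then show ?thesis using that[of a b c' c] MY Y v by (simp add: triple_vector_def)
qed

lemma continuous_on_barycenter:
  "continuous_on (sphere 0 1 \<times> sphere 0 1 \<times> sphere 0 1) (\<lambda>(a, b, c). barycenter a b c)"
    (is "continuous_on ?T ?F")
  unfolding continuous_on_eq_continuous_within
proof
  fix x assume x: "x \<in> ?T"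
  obtain a b c where abc: "x = (a, b, c)" by (cases x)
  show "continuous (at x within ?T) ?F"
  proof (cases "a = b \<and> b = c")
    case True
    define g where "g = (\<lambda>y :: complex \<times> complex \<times> complex.
      3 * (cmod (fst y - a) + cmod (fst (snd y) - a) + cmod (snd (snd y) - a)))"
    have "(g \<longlongrightarrow> g x) (at x within ?T)"
      unfolding g_def by (intro tendsto_intros)
    then have "(g \<longlongrightarrow> 0) (at x within ?T)" using True abc by (simp add: g_def)
    moreover have "eventually (\<lambda>y. norm (?F y - ?F x) \<le> g y) (at x within ?T)"
      unfolding eventually_at_filter
    proof (intro always_eventually allI impI)
      fix y assume y: "y \<in> ?T"
      obtain a' b' c' where y': "y = (a', b', c')" by (cases y)
      have "?F x = a" using True by (simp add: abc barycenter_def)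
      then show "norm (?F y - ?F x) \<le> g y"
        using barycenter_near_diagonal[of a' b' c' a] x y by (simp add: g_def y' abc)
    qed
    ultimately have "((\<lambda>y. ?F y - ?F x) \<longlongrightarrow> 0) (at x within ?T)"
      by (rule Lim_null_comparison[rotated])
    then show ?thesis unfolding continuous_within by (subst (asm) LIM_zero_iff)
  next
    case False
    define G where "G = (\<lambda>y. weighted_sum (fst y) (fst (snd y)) (snd (snd y))
       / of_real (side_sum (fst y) (fst (snd y)) (snd (snd y)) + side_prod (fst y) (fst (snd y)) (snd (snd y))))"
    have "side_sum a b c + side_prod a b c \<noteq> 0"
      using side_sum_pos[OF False] side_prod_nonneg[of a b c] by linarith
    then have "complex_of_real (side_sum (fst x) (fst (snd x)) (snd (snd x)) + side_prod (fst x) (fst (snd x)) (snd (snd x))) \<noteq> 0"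
      by (simp add: abc flip: of_real_add)
    then have lim: "(G \<longlongrightarrow> G x) (at x within ?T)"
      unfolding G_def weighted_sum_def side_sum_def side_prod_def by (intro tendsto_intros)
    have ev: "eventually (\<lambda>y. G y = ?F y) (at x within ?T)"
    proof -
      have "open {y :: complex \<times> complex \<times> complex. \<not> (fst y = fst (snd y) \<and> fst (snd y) = snd (snd y))}"
        by (intro open_Collect_neg closed_Collect_conj closed_Collect_eq continuous_intros)
      then show ?thesis
        unfolding eventually_at_topological using False abc
        by (intro exI conjI) (auto simp: G_def barycenter_def)
    qed
    have Gx: "G x = ?F x"
      by (simp only: G_def abc barycenter_def fst_conv snd_conv prod.case False if_False)
    show ?thesis unfolding continuous_within
      by (rule Lim_transform_eventually[OF lim[unfolded Gx] ev])
  qed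
qed

lemma continuous_on_triple_vector:
  "continuous_on (sphere 0 1 \<times> sphere 0 1 \<times> sphere 0 1) (\<lambda>(a, b, c). triple_vector a b c)"
  unfolding triple_vector_def fold_vector_def case_prod_unfold
  by (intro continuous_intros continuous_on_barycenter[unfolded case_prod_unfold])

section \<open>Symmetric potencies\<close>

lemma continuous_map_euclidean_Pair:
  assumes "continuous_map X euclidean f" "continuous_map X euclidean g"
  shows "continuous_map X euclidean (\<lambda>x. (f x, g x))"
  using assms continuous_map_paired[of X euclidean euclidean f g] by simp

lemma topspace_circle: "topspace circle = sphere 0 1"
  by (simp add: circle_def)

lemma compact_space_circle: "compact_space circle"
  by (simp add: circle_def compact_space_subtopology)


lemma continuous_map_circle_coordinate:
  assumes "i < k"
  shows "continuous_map (product_topology (\<lambda>_. circle) {..<k}) euclidean (\<lambda>x. x i)"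
proof -
  have "continuous_map (product_topology (\<lambda>_. circle) {..<k}) circle (\<lambda>x. x i)"
    using assms by (intro continuous_map_product_projection) simp
  then show ?thesis unfolding circle_def by (rule continuous_map_into_fulltopology)
qed

lemma continuous_map_torus2:
  assumes "continuous_on (sphere 0 1 \<times> sphere 0 1) (\<lambda>(a, b). f a b)"
  shows "continuous_map (product_topology (\<lambda>_. circle) {..<2::nat}) euclidean (\<lambda>x. f (x 0) (x 1))"
proof -
  have "continuous_map (product_topology (\<lambda>_. circle) {..<2::nat}) euclidean (\<lambda>x. (x 0, x 1))"
    by (intro continuous_map_euclidean_Pair continuous_map_circle_coordinate) auto
  then have "continuous_map (product_topology (\<lambda>_. circle) {..<2::nat}) (top_of_set (sphere 0 1 \<times> sphere 0 1)) (\<lambda>x. (x 0, x 1))"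
    by (rule continuous_map_into_subtopology) (auto simp: topspace_circle PiE_iff)
  moreover have "continuous_map (top_of_set (sphere 0 1 \<times> sphere 0 1)) euclidean (\<lambda>(a, b). f a b)"
    using assms by simp
  ultimately have "continuous_map (product_topology (\<lambda>_. circle) {..<2::nat}) euclidean ((\<lambda>(a, b). f a b) \<circ> (\<lambda>x. (x 0, x 1)))"
    by (rule continuous_map_compose)
  then show ?thesis by (simp add: o_def)
qed

lemma continuous_map_torus3:
  assumes "continuous_on (sphere 0 1 \<times> sphere 0 1 \<times> sphere 0 1) (\<lambda>(a, b, c). f a b c)"
  shows "continuous_map (product_topology (\<lambda>_. circle) {..<3::nat}) euclidean (\<lambda>x. f (x 0) (x 1) (x 2))"
proof -
  have "continuous_map (product_topology (\<lambda>_. circle) {..<3::nat}) euclidean (\<lambda>x. (x 0, x 1, x 2))"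
    by (intro continuous_map_euclidean_Pair continuous_map_circle_coordinate) auto
  then have "continuous_map (product_topology (\<lambda>_. circle) {..<3::nat}) (top_of_set (sphere 0 1 \<times> sphere 0 1 \<times> sphere 0 1)) (\<lambda>x. (x 0, x 1, x 2))"
    by (rule continuous_map_into_subtopology) (auto simp: topspace_circle PiE_iff)
  moreover have "continuous_map (top_of_set (sphere 0 1 \<times> sphere 0 1 \<times> sphere 0 1)) euclidean (\<lambda>(a, b, c). f a b c)"
    using assms by simp
  ultimately have "continuous_map (product_topology (\<lambda>_. circle) {..<3::nat}) euclidean ((\<lambda>(a, b, c). f a b c) \<circ> (\<lambda>x. (x 0, x 1, x 2)))"
    by (rule continuous_map_compose)
  then show ?thesis by (simp add: o_def)
qed

lemma quotient_map_sym_potency: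
  "quotient_map (product_topology (\<lambda>_. X) {..<k}) (sym_potency k X) (\<lambda>x. x ` {..<k})"
  unfolding sym_potency_def by (rule quotient_map_quotient_topology)

text \<open>By this lemma, continuity on a potency is checked for formulas in the coordinates of the product.\<close>

lemma continuous_map_from_sym_potency_iff:
  "continuous_map (sym_potency k X) Y g
    \<longleftrightarrow> continuous_map (product_topology (\<lambda>_. X) {..<k}) Y (\<lambda>x. g (x ` {..<k}))"
  using continuous_compose_quotient_map_eq[OF quotient_map_sym_potency, of X k Y g]
  by (simp add: o_def)

lemma compact_space_sym_potency:
  assumes "compact_space X"
  shows "compact_space (sym_potency k X)"
proof -
  have "compactin (sym_potency k X) ((\<lambda>x. x ` {..<k}) ` topspace (product_topology (\<lambda>_. X) {..<k}))"
    using assms by (intro image_compactin[OF _ quotient_imp_continuous_map[OF quotient_map_sym_potency]])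
      (auto simp only: compact_space_product_topology simp flip: compact_space_def)
  then show ?thesis
    unfolding quotient_imp_surjective_map[OF quotient_map_sym_potency] compact_space_def .
qed

text \<open>Repeating the first coordinate lifts the inclusion to the products.\<close>

lemma continuous_map_sym_potency_inclusion:
  assumes "1 \<le> m" "m \<le> n"
  shows "continuous_map (sym_potency m X) (sym_potency n X) (\<lambda>A. A)"
proof -
  \<comment> \<open>The default index 0 is available because \<open>m\<close> is positive.\<close>
  define ext where "ext x = restrict (\<lambda>i. x (if i < m then i else 0)) {..<n}" for x :: "nat \<Rightarrow> 'a"
  have "continuous_map (product_topology (\<lambda>_. X) {..<m}) (product_topology (\<lambda>_. X) {..<n}) ext"
    unfolding continuous_map_componentwise
    using assms by (auto simp: ext_def intro!: continuous_map_product_projection)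
  then have "continuous_map (product_topology (\<lambda>_. X) {..<m}) (sym_potency n X) ((\<lambda>x. x ` {..<n}) \<circ> ext)"
    by (rule continuous_map_compose) (rule quotient_imp_continuous_map[OF quotient_map_sym_potency])
  moreover have "ext x ` {..<n} = x ` {..<m}" for x
  proof
    show "ext x ` {..<n} \<subseteq> x ` {..<m}" using assms by (auto simp: ext_def)
    show "x ` {..<m} \<subseteq> ext x ` {..<n}"
      using assms by (auto simp: ext_def image_iff)
  qed
  ultimately show ?thesis by (simp add: continuous_map_from_sym_potency_iff o_def)
qed

lemma continuous_map_doubleton:
  assumes "continuous_map Z X f" "continuous_map Z X g"
  shows "continuous_map Z (sym_potency 2 X) (\<lambda>z. {f z, g z})"
proof -
  have "continuous_map Z (product_topology (\<lambda>_. X) {..<2::nat}) (\<lambda>z. restrict (\<lambda>i. if i = 0 then f z else g z) {..<2::nat})"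
    unfolding continuous_map_componentwise
  proof (intro conjI ballI)
    fix k :: nat assume "k \<in> {..<2}"
    then show "continuous_map Z X (\<lambda>z. restrict (\<lambda>i. if i = 0 then f z else g z) {..<2} k)"
      using assms by (cases "k = 0") simp_all
  qed auto
  then have "continuous_map Z (sym_potency 2 X) ((\<lambda>x. x ` {..<2::nat}) \<circ> (\<lambda>z. restrict (\<lambda>i. if i = 0 then f z else g z) {..<2::nat}))"
    by (rule continuous_map_compose) (rule quotient_imp_continuous_map[OF quotient_map_sym_potency])
  moreover have "(\<lambda>x. x ` {..<2::nat}) \<circ> (\<lambda>z. restrict (\<lambda>i. if i = 0 then f z else g z) {..<2::nat}) = (\<lambda>z. {f z, g z})"
    by (auto simp: numeral_2_eq_2 lessThan_Suc)
  ultimately show ?thesis by simp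
qed

lemma image_lessThan_2: "x ` {..<2::nat} = {x 0, x 1}"
  by (auto simp: numeral_2_eq_2 lessThan_Suc)

lemma image_lessThan_3: "x ` {..<3::nat} = {x 0, x 1, x 2}"
  by (auto simp: numeral_3_eq_3 numeral_2_eq_2 lessThan_Suc)

lemma sym_potency_1_points: "topspace (sym_potency 1 X) = {{a} | a. a \<in> topspace X}"
proof
  show "topspace (sym_potency 1 X) \<subseteq> {{a} | a. a \<in> topspace X}"
  proof
    fix A assume "A \<in> topspace (sym_potency 1 X)"
    then have "A \<subseteq> topspace X" "card A = 1" by (auto simp: topspace_sym_potency)
    then show "A \<in> {{a} | a. a \<in> topspace X}" by (auto simp: card_1_singleton_iff)
  qed
qed (auto simp: topspace_sym_potency)

lemma sym_potency_2_points: "topspace (sym_potency 2 X) = {{a, b} | a b. a \<in> topspace X \<and> b \<in> topspace X}"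
proof
  show "topspace (sym_potency 2 X) \<subseteq> {{a, b} | a b. a \<in> topspace X \<and> b \<in> topspace X}"
  proof
    fix A assume "A \<in> topspace (sym_potency 2 X)"
    then have "A \<in> (\<lambda>x. x ` {..<2::nat}) ` ({..<2} \<rightarrow>\<^sub>E topspace X)"
      by (simp add: sym_potency_def)
    then obtain x where "A = x ` {..<2::nat}" "x \<in> {..<2::nat} \<rightarrow>\<^sub>E topspace X" by (rule imageE)
    then show "A \<in> {{a, b} | a b. a \<in> topspace X \<and> b \<in> topspace X}"
      unfolding image_lessThan_2
      by (intro CollectI exI[of _ "x 0"] exI[of _ "x 1"]) (simp add: PiE_iff)
  qed
qed (auto simp: topspace_sym_potency card_insert_if)

lemma sym_potency_3_points:
  "topspace (sym_potency 3 X) = {{a, b, c} | a b c. a \<in> topspace X \<and> b \<in> topspace X \<and> c \<in> topspace X}"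
proof
  show "topspace (sym_potency 3 X) \<subseteq> {{a, b, c} | a b c. a \<in> topspace X \<and> b \<in> topspace X \<and> c \<in> topspace X}"
  proof
    fix A assume "A \<in> topspace (sym_potency 3 X)"
    then have "A \<in> (\<lambda>x. x ` {..<3::nat}) ` ({..<3} \<rightarrow>\<^sub>E topspace X)"
      by (simp add: sym_potency_def)
    then obtain x where "A = x ` {..<3::nat}" "x \<in> {..<3::nat} \<rightarrow>\<^sub>E topspace X" by (rule imageE)
    then show "A \<in> {{a, b, c} | a b c. a \<in> topspace X \<and> b \<in> topspace X \<and> c \<in> topspace X}"
      unfolding image_lessThan_3
      by (intro CollectI exI[of _ "x 0"] exI[of _ "x 1"] exI[of _ "x 2"]) (simp add: PiE_iff)
  qed
qed (auto simp: topspace_sym_potency card_insert_if)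

section \<open>The third potency is the 3-sphere\<close>

text \<open>The vector is independent of the enumeration of \<open>A\<close> by \<open>triple_vector_set_cong\<close>; the
projection to the sphere removes its length.\<close>

definition potency_sphere :: "complex set \<Rightarrow> complex \<times> complex" where
  "potency_sphere A = (SOME v. \<exists>a b c. cmod a = 1 \<and> cmod b = 1 \<and> cmod c = 1 \<and> A = {a, b, c} \<and> v = sgn (triple_vector a b c))"

lemma potency_sphere_triple:
  assumes "cmod a = 1" "cmod b = 1" "cmod c = 1"
  shows "potency_sphere {a, b, c} = sgn (triple_vector a b c)"
proof -
  let ?P = "\<lambda>v. \<exists>d e f. cmod d = 1 \<and> cmod e = 1 \<and> cmod f = 1 \<and> {a, b, c} = {d, e, f} \<and> v = sgn (triple_vector d e f)"
  have "?P (sgn (triple_vector a b c))" using assms by blast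
  then have "?P (potency_sphere {a, b, c})" unfolding potency_sphere_def by (rule someI)
  then show ?thesis using triple_vector_set_cong[OF assms] by auto
qed

lemma potency_sphere_doubleton:
  assumes "cmod a = 1" "cmod b = 1"
  shows "potency_sphere {a, b} = sgn (a * b, a * b * (a + b))"
  using potency_sphere_triple[of a a b] triple_vector_double[of a b] assms by simp

lemma sgn_eq_imp_ray:
  fixes x y :: "'a::real_normed_vector"
  assumes "sgn x = sgn y" "x \<noteq> 0" "y \<noteq> 0"
  obtains r where "r > 0" "x = r *\<^sub>R y"
proof
  show "norm x / norm y > 0" using assms by simp
  have "x = norm x *\<^sub>R sgn x" using assms(2) by (simp add: sgn_div_norm)
  also have "\<dots> = norm x *\<^sub>R sgn y" using assms(1) by simp
  also have "\<dots> = (norm x / norm y) *\<^sub>R y" by (simp add: sgn_div_norm divide_inverse)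
  finally show "x = (norm x / norm y) *\<^sub>R y" .
qed

lemma continuous_on_sgn:
  fixes f :: "'a::topological_space \<Rightarrow> 'b::real_normed_vector"
  assumes "continuous_on S f" "\<And>x. x \<in> S \<Longrightarrow> f x \<noteq> 0"
  shows "continuous_on S (\<lambda>x. sgn (f x))"
  unfolding sgn_div_norm using assms by (intro continuous_intros) auto

text \<open>The inverse map, which amounts to solving a cubic equation, is continuous by compactness of the
potency.\<close>

theorem homeomorphic_map_potency_sphere:
  "homeomorphic_map (sym_potency 3 circle) (top_of_set (sphere 0 1)) potency_sphere"
proof (rule continuous_imp_homeomorphic_map)
  show "compact_space (sym_potency 3 circle)"
    by (rule compact_space_sym_potency[OF compact_space_circle])
  show "Hausdorff_space (top_of_set (sphere 0 (1::real) :: (complex \<times> complex) set))"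
    by (simp add: Hausdorff_space_subtopology)
  have val: "potency_sphere (x ` {..<3::nat}) = sgn (triple_vector (x 0) (x 1) (x 2))"
    if "x \<in> topspace (product_topology (\<lambda>_. circle) {..<3::nat})" for x
    unfolding image_lessThan_3
    by (rule potency_sphere_triple) (use that in \<open>auto simp: topspace_circle PiE_iff\<close>)
  have "continuous_on (sphere 0 1 \<times> sphere 0 1 \<times> sphere 0 1) (\<lambda>(a, b, c). sgn (triple_vector a b c))"
    unfolding case_prod_unfold
    by (rule continuous_on_sgn[OF continuous_on_triple_vector[unfolded case_prod_unfold]])
      (auto simp: triple_vector_nonzero)
  then have "continuous_map (product_topology (\<lambda>_. circle) {..<3::nat}) euclidean (\<lambda>x. sgn (triple_vector (x 0) (x 1) (x 2)))"
    by (rule continuous_map_torus3)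
  then have "continuous_map (product_topology (\<lambda>_. circle) {..<3::nat}) euclidean (\<lambda>x. potency_sphere (x ` {..<3::nat}))"
    by (rule continuous_map_eq) (simp only: val)
  then have "continuous_map (sym_potency 3 circle) euclidean potency_sphere"
    by (simp only: continuous_map_from_sym_potency_iff)
  moreover have "potency_sphere A \<in> sphere 0 1" if "A \<in> topspace (sym_potency 3 circle)" for A
    using that potency_sphere_triple triple_vector_nonzero
    by (auto simp: sym_potency_3_points topspace_circle norm_sgn)
  ultimately show "continuous_map (sym_potency 3 circle) (top_of_set (sphere 0 1)) potency_sphere"
    by (intro continuous_map_into_subtopology) auto
  show "potency_sphere ` topspace (sym_potency 3 circle) = topspace (top_of_set (sphere 0 1))"
  proof
    show "potency_sphere ` topspace (sym_potency 3 circle) \<subseteq> topspace (top_of_set (sphere 0 1))"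
      using \<open>\<And>A. A \<in> topspace (sym_potency 3 circle) \<Longrightarrow> potency_sphere A \<in> sphere 0 1\<close> by auto
    show "topspace (top_of_set (sphere 0 1)) \<subseteq> potency_sphere ` topspace (sym_potency 3 circle)"
    proof
      fix v :: "complex \<times> complex" assume "v \<in> topspace (top_of_set (sphere 0 1))"
      then have v: "norm v = 1" by simp
      then have "v \<noteq> 0" by auto
      then obtain a b c r where abc: "cmod a = 1" "cmod b = 1" "cmod c = 1" "r > 0" "v = r *\<^sub>R triple_vector a b c"
        by (rule triple_vector_surj)
      have "v = sgn v" using v by (simp add: sgn_div_norm)
      also have "\<dots> = sgn (triple_vector a b c)" using abc by (simp add: sgn_scaleR)
      also have "\<dots> = potency_sphere {a, b, c}" using abc by (simp add: potency_sphere_triple)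
      finally show "v \<in> potency_sphere ` topspace (sym_potency 3 circle)"
        using abc by (auto simp: sym_potency_3_points topspace_circle)
    qed
  qed
  show "inj_on potency_sphere (topspace (sym_potency 3 circle))"
  proof
    fix A B assume A: "A \<in> topspace (sym_potency 3 circle)" and B: "B \<in> topspace (sym_potency 3 circle)"
      and eq: "potency_sphere A = potency_sphere B"
    obtain a b c where a: "A = {a, b, c}" "cmod a = 1" "cmod b = 1" "cmod c = 1"
      using A by (auto simp: sym_potency_3_points topspace_circle)
    obtain d e f where d: "B = {d, e, f}" "cmod d = 1" "cmod e = 1" "cmod f = 1"
      using B by (auto simp: sym_potency_3_points topspace_circle)
    have "sgn (triple_vector a b c) = sgn (triple_vector d e f)"
      using eq by (simp only: a(1) d(1) potency_sphere_triple[OF a(2-4)] potency_sphere_triple[OF d(2-4)])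
    then obtain r where "r > 0" "triple_vector a b c = r *\<^sub>R triple_vector d e f"
      by (rule sgn_eq_imp_ray[OF _ triple_vector_nonzero[OF a(2-4)] triple_vector_nonzero[OF d(2-4)]])
    then show "A = B"
      unfolding a(1) d(1) by (rule triple_vector_ray_eq_imp_set_eq[OF a(2-4) d(2-4)])
  qed
qed

text \<open>The Hausdorff property of a quotient is not automatic; here it is inherited from the sphere.\<close>

lemma Hausdorff_space_sym_potency_3_circle: "Hausdorff_space (sym_potency 3 circle)"
  using homeomorphic_Hausdorff_space[OF homeomorphic_map_imp_homeomorphic_space[OF homeomorphic_map_potency_sphere]]
  by (simp add: Hausdorff_space_subtopology)

lemma Hausdorff_space_sym_potency_circle:
  assumes "1 \<le> k" "k \<le> 3"
  shows "Hausdorff_space (sym_potency k circle)"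
  using Hausdorff_space_injective_preimage[OF Hausdorff_space_sym_potency_3_circle
      continuous_map_sym_potency_inclusion[OF assms]] by simp

lemma embedding_map_sym_potency_circle:
  assumes "1 \<le> m" "m \<le> n" "n \<le> 3"
  shows "embedding_map (sym_potency m circle) (sym_potency n circle) (\<lambda>A. A)"
  using assms by (intro continuous_imp_embedding_map continuous_map_sym_potency_inclusion
      compact_space_sym_potency compact_space_circle Hausdorff_space_sym_potency_circle) auto

lemma homeomorphic_map_circle_singleton: "homeomorphic_map circle (sym_potency 1 circle) (\<lambda>x. {x})"
proof (rule continuous_imp_homeomorphic_map)
  have "continuous_map circle (product_topology (\<lambda>_. circle) {..<1::nat}) (\<lambda>x. restrict (\<lambda>i. x) {..<1::nat})"
    unfolding continuous_map_componentwise by auto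
  then have "continuous_map circle (sym_potency 1 circle) ((\<lambda>x. x ` {..<1::nat}) \<circ> (\<lambda>x. restrict (\<lambda>i. x) {..<1::nat}))"
    by (rule continuous_map_compose) (rule quotient_imp_continuous_map[OF quotient_map_sym_potency])
  moreover have "(\<lambda>x. x ` {..<1::nat}) \<circ> (\<lambda>x. restrict (\<lambda>i::nat. x) {..<1::nat}) = (\<lambda>x::complex. {x})"
    by (auto simp: image_iff)
  ultimately show "continuous_map circle (sym_potency 1 circle) (\<lambda>x. {x})" by simp
  show "compact_space circle" by (rule compact_space_circle)
  show "Hausdorff_space (sym_potency 1 circle)" by (rule Hausdorff_space_sym_potency_circle) auto
  show "(\<lambda>x. {x}) ` topspace circle = topspace (sym_potency 1 circle)"
    unfolding sym_potency_1_points by auto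
qed auto

section \<open>The second potency is the Moebius band\<close>

lemma homeomorphic_space_of_quotient_maps:
  assumes f: "quotient_map X Y f" and g: "quotient_map X Z g"
    and fib: "\<And>x y. x \<in> topspace X \<Longrightarrow> y \<in> topspace X \<Longrightarrow> f x = f y \<longleftrightarrow> g x = g y"
  shows "Y homeomorphic_space Z"
proof -
  obtain h where h: "continuous_map Y Z h" "\<And>x. x \<in> topspace X \<Longrightarrow> h (f x) = g x"
    by (rule quotient_map_lift_exists[OF f quotient_imp_continuous_map[OF g]]) (use fib in auto)
  obtain k where k: "continuous_map Z Y k" "\<And>x. x \<in> topspace X \<Longrightarrow> k (g x) = f x"
    by (rule quotient_map_lift_exists[OF g quotient_imp_continuous_map[OF f]]) (use fib in auto)
  have "homeomorphic_maps Y Z h k"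
    unfolding homeomorphic_maps_def
    using h k quotient_imp_surjective_map[OF f] quotient_imp_surjective_map[OF g] by force
  then show ?thesis unfolding homeomorphic_space_def by blast
qed

text \<open>The two points of the pair have the product \<open>cis (2 * pi * s)\<close> and lie symmetrically to the square
root \<open>cis (pi * s)\<close> of it, at angular distance \<open>pi * t\<close>. As \<open>s\<close> runs from 0 to 1, the square root changes
its sign, which reverses the direction of \<open>t\<close>: this is the gluing of the Moebius band.\<close>

definition square_pair :: "real \<times> real \<Rightarrow> complex set" where
  "square_pair = (\<lambda>(s, t). {cis (pi * (s + t)), cis (pi * (s - t))})"

lemma continuous_map_square_pair: "continuous_map (top_of_set S) (sym_potency 2 circle) square_pair"
  unfolding square_pair_def case_prod_unfold circle_def
  by (intro continuous_map_doubleton continuous_map_into_subtopology)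
    (auto intro!: continuous_intros)

lemma square_pair_sum_prod:
  assumes "square_pair (s, t) = {a, b}"
  shows "a + b = of_real (2 * cos (pi * t)) * cis (pi * s)" "a * b = cis (2 * pi * s)"
proof -
  have c: "cis (pi * (s + t)) + cis (pi * (s - t)) = of_real (2 * cos (pi * t)) * cis (pi * s)"
    by (simp add: complex_eq_iff distrib_left right_diff_distrib cos_add cos_diff sin_add sin_diff)
  have d: "cis (pi * (s + t)) * cis (pi * (s - t)) = cis (2 * pi * s)"
    by (simp add: cis_mult algebra_simps)
  have "(a = cis (pi * (s + t)) \<and> b = cis (pi * (s - t))) \<or> (b = cis (pi * (s + t)) \<and> a = cis (pi * (s - t)))"
    using assms by (auto simp: square_pair_def doubleton_eq_iff)
  then show "a + b = of_real (2 * cos (pi * t)) * cis (pi * s)" "a * b = cis (2 * pi * s)"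
    using c d by (auto simp: add.commute mult.commute)
qed

lemma cis_eq_iff_int: "cis x = cis y \<longleftrightarrow> (\<exists>n::int. x = y + 2 * pi * n)"
  using sin_cos_eq_iff[of x y] by (auto simp: complex_eq_iff)

text \<open>The product of the pair determines \<open>s\<close> up to an integer, and the sum then determines \<open>t\<close>, as the
cosine is injective on \<open>[0, pi]\<close>.\<close>

lemma square_pair_eq_iff:
  assumes "s \<in> {0..1}" "t \<in> {0..1}" "s' \<in> {0..1}" "t' \<in> {0..1}"
  shows "square_pair (s, t) = square_pair (s', t')
    \<longleftrightarrow> (s = s' \<and> t = t') \<or> (s = 0 \<and> s' = 1 \<and> t' = 1 - t) \<or> (s = 1 \<and> s' = 0 \<and> t' = 1 - t)"
proof
  assume eq: "square_pair (s, t) = square_pair (s', t')"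
  obtain a b where ab: "square_pair (s, t) = {a, b}" by (auto simp: square_pair_def)
  note S = square_pair_sum_prod[OF ab] and S' = square_pair_sum_prod[OF ab[unfolded eq]]
  have sum: "of_real (2 * cos (pi * t)) * cis (pi * s) = of_real (2 * cos (pi * t')) * cis (pi * s')"
    using S(1) S'(1) by simp
  have tt: "t' = u" if "cos (pi * t') = cos (pi * u)" "u \<in> {0..1}" for u
    using cos_inj_pi[of "pi * t'" "pi * u"] that assms by (auto simp: mult_left_le)
  \<comment> \<open>At the glued edges the square root changes its sign, and so does the cosine.\<close>
  have flip: "- cos (pi * t) = cos (pi * (1 - t))" by (simp add: right_diff_distrib cos_diff)
  have "cis (2 * pi * s) = cis (2 * pi * s')" using S(2) S'(2) by simp
  then obtain n :: int where "2 * pi * s = 2 * pi * s' + 2 * pi * n" using cis_eq_iff_int by blast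
  then have "2 * pi * s = 2 * pi * (s' + n)" by (simp add: distrib_left)
  then have n: "s = s' + n" by simp
  have "real_of_int n \<le> 1" "real_of_int n \<ge> - 1" using n assms by auto
  then have "n \<le> 1" "n \<ge> - 1" by linarith+
  then consider "n = 0" | "n = 1" | "n = - 1" by linarith
  then show "(s = s' \<and> t = t') \<or> (s = 0 \<and> s' = 1 \<and> t' = 1 - t) \<or> (s = 1 \<and> s' = 0 \<and> t' = 1 - t)"
  proof cases
    case 1
    then have "s = s'" using n by simp
    then have "cos (pi * t') = cos (pi * t)" using sum by simp
    then show ?thesis using tt[of t] assms \<open>s = s'\<close> by simp
  next
    case 2
    then have "s = 1" "s' = 0" using n assms by auto
    then have "complex_of_real (2 * cos (pi * t')) = of_real (- 2 * cos (pi * t))"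
      using sum by simp
    then have "cos (pi * t') = cos (pi * (1 - t))"
      unfolding of_real_eq_iff flip[symmetric] by simp
    then show ?thesis using tt[of "1 - t"] assms \<open>s = 1\<close> \<open>s' = 0\<close> by simp
  next
    case 3
    then have "s = 0" "s' = 1" using n assms by auto
    then have "complex_of_real (2 * cos (pi * t')) = of_real (- 2 * cos (pi * t))"
      using sum by simp
    then have "cos (pi * t') = cos (pi * (1 - t))"
      unfolding of_real_eq_iff flip[symmetric] by simp
    then show ?thesis using tt[of "1 - t"] assms \<open>s = 0\<close> \<open>s' = 1\<close> by simp
  qed
next
  assume "(s = s' \<and> t = t') \<or> (s = 0 \<and> s' = 1 \<and> t' = 1 - t) \<or> (s = 1 \<and> s' = 0 \<and> t' = 1 - t)"
  moreover have "square_pair (0, t) = square_pair (1, 1 - t)" for t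
  proof -
    have "cis (pi * (0 - t)) = cis (pi * (1 + (1 - t)))"
      unfolding cis_eq_iff_int by (intro exI[of _ "- 1"]) (simp add: algebra_simps)
    moreover have "cis (pi * (0 + t)) = cis (pi * (1 - (1 - t)))" by simp
    ultimately show ?thesis by (simp only: square_pair_def prod.case insert_commute)
  qed
  moreover from this[of "1 - t"] have "square_pair (1, t) = square_pair (0, 1 - t)" by simp
  ultimately show "square_pair (s, t) = square_pair (s', t')" by auto
qed

lemma doubleton_eq_of_sum_prod:
  fixes x y u v :: "'a::idom"
  assumes "x + y = u + v" "x * y = u * v"
  shows "{x, y} = {u, v}"
proof -
  have "(x - u) * (x - v) = x * x - (u + v) * x + u * v" by (simp add: algebra_simps)
  also have "\<dots> = 0" unfolding assms[symmetric] by (simp add: algebra_simps)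
  finally have "x = u \<or> x = v" by simp
  then show ?thesis
  proof
    assume "x = u"
    moreover from this have "y = v" using assms(1) by simp
    ultimately show ?thesis by simp
  next
    assume "x = v"
    moreover from this have "y = u" using assms(1) by (simp add: add.commute)
    ultimately show ?thesis by auto
  qed
qed

lemma unit_pair_sum:
  assumes "cmod a = 1" "cmod b = 1"
  shows "a + b = a * b * cnj (a + b)"
proof -
  have "a * b * cnj (a + b) = (a * cnj a) * b + (b * cnj b) * a" by (simp add: algebra_simps)
  then show ?thesis using assms by (simp add: unit_mult_cnj)
qed

text \<open>The sum of two unit numbers is a real multiple, between -2 and 2, of either square root of their
product.\<close>

lemma square_pair_with_angle:
  assumes ab: "cmod a = 1" "cmod b = 1" and prod: "a * b = cis (2 * pi * s)"
  obtains t where "t \<in> {0..1}" "square_pair (s, t) = {a, b}"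
proof -
  define k where "k = cis (pi * s)"
  have "pi * s + pi * s = 2 * pi * s" by simp
  then have k: "k * k = a * b" "k * cnj k = 1"
    by (simp_all only: k_def prod cis_mult unit_mult_cnj norm_cis)
  define c where "c = (a + b) * cnj k"
  have "c = a * b * cnj (a + b) * cnj k"
    unfolding c_def by (rule arg_cong[where f = "\<lambda>x. x * cnj k", OF unit_pair_sum[OF ab]])
  also have "\<dots> = k * k * cnj (a + b) * cnj k" by (simp only: k(1))
  also have "\<dots> = (k * cnj k) * (cnj (a + b) * k)" by (simp only: mult_ac)
  also have "\<dots> = cnj c" by (simp add: k c_def)
  finally have c: "c = of_real (Re c)" by (simp add: complex_eq_iff)
  have "cmod c \<le> 2"
    using norm_triangle_ineq[of a b] ab by (simp add: c_def k_def norm_mult)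
  then have c2: "\<bar>Re c\<bar> \<le> 2" using abs_Re_le_cmod[of c] by linarith
  define t where "t = arccos (Re c / 2) / pi"
  have pt: "cos (pi * t) = Re c / 2" using c2 by (simp add: t_def cos_arccos_abs)
  have t: "t \<in> {0..1}" using arccos_bounded[of "Re c / 2"] c2 by (simp add: t_def)
  obtain x y where xy: "square_pair (s, t) = {x, y}" by (auto simp: square_pair_def)
  have "x + y = c * k" using square_pair_sum_prod(1)[OF xy] c by (simp add: pt k_def)
  also have "\<dots> = (k * cnj k) * (a + b)" by (simp add: c_def mult_ac)
  finally have "x + y = a + b" by (simp add: k)
  moreover have "x * y = a * b" using square_pair_sum_prod(2)[OF xy] prod by simp
  ultimately have "{x, y} = {a, b}" by (rule doubleton_eq_of_sum_prod)
  then show ?thesis using that t xy by simp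
qed

lemma square_pair_surj:
  assumes "cmod a = 1" "cmod b = 1"
  obtains s t where "s \<in> {0..1}" "t \<in> {0..1}" "square_pair (s, t) = {a, b}"
proof -
  define s where "s = Arg2pi (a * b) / (2 * pi)"
  have "a * b = cis (2 * pi * s)"
    using Arg2pi_eq[of "a * b"] assms by (simp add: s_def norm_mult cis_conv_exp)
  then obtain t where "t \<in> {0..1}" "square_pair (s, t) = {a, b}"
    using square_pair_with_angle[OF assms] by blast
  moreover have "s \<in> {0..1}"
    using Arg2pi[of "a * b"] by (simp add: s_def field_simps)
  ultimately show ?thesis using that by blast
qed

text \<open>Both spaces are quotients of the unit square with the same fibres.\<close>

theorem sym_potency_2_homeomorphic_moebius_band: "sym_potency 2 circle homeomorphic_space moebius_band"
proof (rule homeomorphic_space_of_quotient_maps)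
  let ?Q = "top_of_set ({0..1::real} \<times> {0..1::real})"
  show "quotient_map ?Q (sym_potency 2 circle) square_pair"
  proof (rule continuous_imp_quotient_map)
    show "continuous_map ?Q (sym_potency 2 circle) square_pair" by (rule continuous_map_square_pair)
    show "compact_space ?Q" by (simp add: compact_space_subtopology compact_Times)
    show "Hausdorff_space (sym_potency 2 circle)" by (rule Hausdorff_space_sym_potency_circle) auto
    have "{a, b} \<in> square_pair ` ({0..1} \<times> {0..1})" if "cmod a = 1" "cmod b = 1" for a b
      using square_pair_surj[OF that] by (metis SigmaI image_eqI)
    moreover have "square_pair p \<in> topspace (sym_potency 2 circle)" for p
      unfolding sym_potency_2_points topspace_circle
      by (intro CollectI exI[of _ "cis (pi * (fst p + snd p))"] exI[of _ "cis (pi * (fst p - snd p))"])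
        (simp add: square_pair_def case_prod_unfold)
    ultimately show "square_pair ` topspace ?Q = topspace (sym_potency 2 circle)"
      by (auto simp: sym_potency_2_points topspace_circle)
  qed
  show "quotient_map ?Q moebius_band (\<lambda>p. moebius_rel `` {p})"
    unfolding moebius_band_def by (rule quotient_map_quotient_topology)
  fix p q assume "p \<in> topspace ?Q" "q \<in> topspace ?Q"
  then have pq: "p \<in> {0..1} \<times> {0..1}" "q \<in> {0..1} \<times> {0..1}" by auto
  obtain s t s' t' where st: "p = (s, t)" "q = (s', t')" by (cases p, cases q)
  have "moebius_rel `` {p} = moebius_rel `` {q} \<longleftrightarrow> (p, q) \<in> moebius_rel"
    by (rule eq_equiv_class_iff[OF equiv_moebius_rel pq])
  also have "\<dots> \<longleftrightarrow> square_pair p = square_pair q"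
    using pq square_pair_eq_iff[of s t s' t'] by (auto simp: st moebius_rel_def doubleton_eq_iff)
  finally show "square_pair p = square_pair q \<longleftrightarrow> moebius_rel `` {p} = moebius_rel `` {q}" by simp
qed

section \<open>The boundary of the second potency\<close>

text \<open>The factor \<open>3 - card A\<close> is 2 for a singleton and 1 for a pair, so that a singleton counts as a double
point; similarly for the exponent in \<open>pair_prod\<close>.\<close>

definition pair_sum :: "complex set \<Rightarrow> complex" where
  "pair_sum A = of_nat (3 - card A) * \<Sum>A"

definition pair_prod :: "complex set \<Rightarrow> complex" where
  "pair_prod A = \<Prod>A ^ (3 - card A)"

lemma pair_sum_doubleton [simp]: "pair_sum {a, b} = a + b"
  by (cases "a = b") (simp_all add: pair_sum_def)

lemma pair_prod_doubleton [simp]: "pair_prod {a, b} = a * b"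
  by (cases "a = b") (simp_all add: pair_prod_def power2_eq_square)

lemma continuous_map_pair_sum: "continuous_map (sym_potency 2 circle) euclidean pair_sum"
  unfolding continuous_map_from_sym_potency_iff image_lessThan_2 pair_sum_doubleton
  by (rule continuous_map_torus2[where f = "\<lambda>a b. a + b"]) (auto simp: case_prod_unfold intro!: continuous_intros)

lemma continuous_map_pair_prod: "continuous_map (sym_potency 2 circle) euclidean pair_prod"
  unfolding continuous_map_from_sym_potency_iff image_lessThan_2 pair_prod_doubleton
  by (rule continuous_map_torus2[where f = "\<lambda>a b. a * b"]) (auto simp: case_prod_unfold intro!: continuous_intros)

lemma openin_pair_condition:
  fixes P :: "complex \<Rightarrow> complex \<Rightarrow> bool"
  assumes "open {z. P (fst z) (snd z)}"
  shows "openin (sym_potency 2 circle) {A \<in> topspace (sym_potency 2 circle). P (pair_sum A) (pair_prod A)}"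
  using openin_continuous_map_preimage[OF continuous_map_euclidean_Pair[OF continuous_map_pair_sum continuous_map_pair_prod], of "{z. P (fst z) (snd z)}"] assms
  by simp

text \<open>The modulus records the length of \<open>pair_sum A\<close>, which is largest on singletons, and the direction
records \<open>pair_prod A\<close>. Only the sign of the sum is lost.\<close>

definition edge_chart :: "complex set \<Rightarrow> complex" where
  "edge_chart A = pair_prod A * of_real (1 + (cmod (pair_sum A))\<^sup>2)"

lemma continuous_map_edge_chart: "continuous_map (sym_potency 2 circle) euclidean edge_chart"
proof -
  have "continuous_map (sym_potency 2 circle) euclidean ((\<lambda>z. snd z * of_real (1 + (cmod (fst z))\<^sup>2)) \<circ> (\<lambda>A. (pair_sum A, pair_prod A)))"
    by (rule continuous_map_compose[OF continuous_map_euclidean_Pair[OF continuous_map_pair_sum continuous_map_pair_prod]])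
      (auto intro!: continuous_intros)
  then show ?thesis by (simp add: o_def edge_chart_def[abs_def])
qed

lemma edge_chart_norm_le:
  assumes "A \<in> topspace (sym_potency 2 circle)"
  shows "cmod (edge_chart A) \<le> 5"
proof -
  obtain a b where A: "A = {a, b}" "cmod a = 1" "cmod b = 1"
    using assms by (auto simp: sym_potency_2_points topspace_circle)
  have "cmod (a + b) \<le> 2" using norm_triangle_ineq[of a b] A by simp
  then have "(cmod (a + b))\<^sup>2 \<le> 2\<^sup>2" by (rule power_mono) simp
  moreover have "cmod (edge_chart A) = 1 + (cmod (a + b))\<^sup>2"
    using A by (simp add: edge_chart_def norm_mult del: of_real_add)
  ultimately show ?thesis by simp
qed

text \<open>The chart determines the product and the length of the sum, hence the square of the sum; the
half-plane condition selects the sign.\<close>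

lemma edge_chart_inj:
  assumes A: "A \<in> topspace (sym_potency 2 circle)" "Re (pair_sum A * cnj u) > 0"
    and B: "B \<in> topspace (sym_potency 2 circle)" "Re (pair_sum B * cnj u) > 0"
    and eq: "edge_chart A = edge_chart B"
  shows "A = B"
proof -
  obtain a b where a: "A = {a, b}" "cmod a = 1" "cmod b = 1"
    using A by (auto simp: sym_potency_2_points topspace_circle)
  obtain c d where c: "B = {c, d}" "cmod c = 1" "cmod d = 1"
    using B by (auto simp: sym_potency_2_points topspace_circle)
  have e: "a * b * of_real (1 + (cmod (a + b))\<^sup>2) = c * d * of_real (1 + (cmod (c + d))\<^sup>2)"
    using eq by (simp add: edge_chart_def a c)
  then have "cmod (a * b * of_real (1 + (cmod (a + b))\<^sup>2)) = cmod (c * d * of_real (1 + (cmod (c + d))\<^sup>2))" by simp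
  then have n: "(cmod (a + b))\<^sup>2 = (cmod (c + d))\<^sup>2"
    using a c by (simp add: norm_mult del: of_real_add)
  have "1 + (cmod (c + d))\<^sup>2 > 0" by (simp add: add_pos_nonneg)
  then have p: "a * b = c * d"
    using e unfolding n mult_cancel_right of_real_eq_0_iff by linarith
  have sq: "(x + y)\<^sup>2 = of_real ((cmod (x + y))\<^sup>2) * (x * y)" if "cmod x = 1" "cmod y = 1" for x y
  proof -
    have "(x + y)\<^sup>2 = (x + y) * (x * y * cnj (x + y))"
      unfolding power2_eq_square by (rule arg_cong[OF unit_pair_sum[OF that]])
    also have "\<dots> = of_real ((cmod (x + y))\<^sup>2) * (x * y)"
      unfolding complex_norm_square by (simp only: mult_ac)
    finally show ?thesis .
  qed
  have "(a + b)\<^sup>2 = (c + d)\<^sup>2" unfolding sq[OF a(2,3)] sq[OF c(2,3)] n p ..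
  then have "a + b = c + d \<or> a + b = - (c + d)" by (simp only: power2_eq_iff)
  then have "a + b = c + d"
  proof
    assume *: "a + b = - (c + d)"
    have "Re (pair_sum A * cnj u) = - Re (pair_sum B * cnj u)"
      unfolding a(1) c(1) pair_sum_doubleton * by (simp add: algebra_simps)
    then show ?thesis using A B by simp
  qed
  then show ?thesis unfolding a(1) c(1) using p by (rule doubleton_eq_of_sum_prod)
qed

text \<open>Composing a planar parametrization with \<open>edge_chart\<close> would give a continuous injection of an open
planar set into the closed disc of radius 5. Its image is open by invariance of domain, but contains the
image of the singleton, which lies on the rim.\<close>

lemma singleton_in_surface_boundary:
  assumes "cmod a = 1"
  shows "{a} \<in> surface_boundary (sym_potency 2 circle)"
proof -
  let ?X = "sym_potency 2 circle"
  have aX: "{a} \<in> topspace ?X" using assms by (auto simp: sym_potency_2_points topspace_circle)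
  have "\<not> (openin ?X U \<and> {a} \<in> U \<and> open V \<and> subtopology ?X U homeomorphic_space top_of_set V)"
    for U :: "complex set set" and V :: "(real \<times> real) set"
  proof
    assume *: "openin ?X U \<and> {a} \<in> U \<and> open V \<and> subtopology ?X U homeomorphic_space top_of_set V"
    then have U: "openin ?X U" "{a} \<in> U" and V: "open V" by auto
    have UX: "U \<subseteq> topspace ?X" using U(1) by (rule openin_subset)
    then have tU: "topspace (subtopology ?X U) = U" by auto
    obtain h g where hg: "homeomorphic_maps (subtopology ?X U) (top_of_set V) h g"
      using * unfolding homeomorphic_space_def by blast
    have g: "continuous_map (top_of_set V) ?X g" "\<And>v. v \<in> V \<Longrightarrow> g v \<in> U"
      using hg by (auto simp: homeomorphic_maps_def continuous_map_in_subtopology)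
    have h: "h {a} \<in> V" "g (h {a}) = {a}" and hgv: "\<And>v. v \<in> V \<Longrightarrow> h (g v) = v"
      using hg U(2) aX unfolding homeomorphic_maps_def by (auto simp: continuous_map_def Pi_iff)
    define W where "W = {A \<in> topspace ?X. Re (pair_sum A * cnj a) > 0}"
    have "openin ?X W"
      unfolding W_def by (rule openin_pair_condition[where P = "\<lambda>s p. Re (s * cnj a) > 0"])
        (intro open_Collect_less continuous_intros)
    then have "openin (top_of_set V) {v \<in> topspace (top_of_set V). g v \<in> W}"
      by (rule openin_continuous_map_preimage[OF g(1)])
    then have oV: "open {v \<in> V. g v \<in> W}" using V by (simp add: openin_open_eq)
    have "continuous_map (top_of_set V) euclidean (edge_chart \<circ> g)"
      by (rule continuous_map_compose[OF g(1) continuous_map_edge_chart])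
    then have "continuous_on V (edge_chart \<circ> g)" by simp
    then have c: "continuous_on {v \<in> V. g v \<in> W} (edge_chart \<circ> g)"
      by (rule continuous_on_subset) auto
    have "inj_on (edge_chart \<circ> g) {v \<in> V. g v \<in> W}"
    proof (rule inj_onI)
      fix v w assume v: "v \<in> {v \<in> V. g v \<in> W}" and w: "w \<in> {v \<in> V. g v \<in> W}"
        and e: "(edge_chart \<circ> g) v = (edge_chart \<circ> g) w"
      have "g v = g w" using v w e by (intro edge_chart_inj[of "g v" a "g w"]) (auto simp: W_def)
      then show "v = w" using hgv v w by (metis (mono_tags) mem_Collect_eq)
    qed
    then have op: "open ((edge_chart \<circ> g) ` {v \<in> V. g v \<in> W})"
      by (intro invariance_of_domain_gen[OF oV c]) simp_all
    have "(edge_chart \<circ> g) ` {v \<in> V. g v \<in> W} \<subseteq> cball 0 5"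
      using edge_chart_norm_le by (auto simp: W_def)
    then have "(edge_chart \<circ> g) ` {v \<in> V. g v \<in> W} \<subseteq> interior (cball 0 5)"
      by (rule interior_maximal[OF _ op])
    then have sub: "(edge_chart \<circ> g) ` {v \<in> V. g v \<in> W} \<subseteq> ball 0 5"
      by (simp only: interior_cball)
    have "{a} \<in> W"
    proof -
      have "pair_sum {a} * cnj a = 2"
        using pair_sum_doubleton[of a a] unit_mult_cnj[OF assms] by (simp add: distrib_right)
      then have "Re (pair_sum {a} * cnj a) > 0" by (simp only:) simp
      then show ?thesis unfolding W_def using aX by blast
    qed
    then have "h {a} \<in> {v \<in> V. g v \<in> W}" using h by simp
    then have "(edge_chart \<circ> g) (h {a}) \<in> ball 0 5" using sub by blast
    then have "edge_chart {a} \<in> ball 0 5" by (simp only: o_apply h(2))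
    moreover have "cmod (edge_chart {a}) = 5"
      using pair_sum_doubleton[of a a] pair_prod_doubleton[of a a] assms
      by (simp add: edge_chart_def norm_mult del: of_real_add flip: mult_2)
    ultimately show False by simp
  qed
  then show ?thesis using aX unfolding surface_boundary_def by blast
qed

text \<open>This describes the coordinate patch by conditions on sum and product that are visibly open: the
product lies in an open half-plane, and the discriminant of the pair is nonzero.\<close>

lemma square_pair_image_eq:
  fixes s\<^sub>0 :: real
  defines "V \<equiv> {s\<^sub>0 - 1/4 <..< s\<^sub>0 + 1/4} \<times> {0 <..< 1::real}"
  shows "square_pair ` V = {A \<in> topspace (sym_potency 2 circle).
      Re (pair_prod A * cnj (cis (2 * pi * s\<^sub>0))) > 0 \<and> (pair_sum A)\<^sup>2 \<noteq> 4 * pair_prod A}" (is "_ = ?U")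
proof -
  have val: "pair_sum (square_pair (s, t)) = of_real (2 * cos (pi * t)) * cis (pi * s)"
    "pair_prod (square_pair (s, t)) = cis (2 * pi * s)" for s t
  proof -
    obtain x y where xy: "square_pair (s, t) = {x, y}" by (auto simp: square_pair_def)
    show "pair_sum (square_pair (s, t)) = of_real (2 * cos (pi * t)) * cis (pi * s)"
      "pair_prod (square_pair (s, t)) = cis (2 * pi * s)"
      using square_pair_sum_prod[OF xy] by (simp_all add: xy)
  qed
  have disc: "(pair_sum (square_pair (s, t)))\<^sup>2 = 4 * pair_prod (square_pair (s, t)) \<longleftrightarrow> sin (pi * t) = 0" for s t
  proof -
    have "pi * s + pi * s = 2 * pi * s" by simp
    then have "(cis (pi * s))\<^sup>2 = cis (2 * pi * s)" by (simp only: power2_eq_square cis_mult)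
    then have "(pair_sum (square_pair (s, t)))\<^sup>2 = 4 * of_real ((cos (pi * t))\<^sup>2) * cis (2 * pi * s)"
      by (simp add: val power_mult_distrib)
    then have "(pair_sum (square_pair (s, t)))\<^sup>2 = 4 * pair_prod (square_pair (s, t)) \<longleftrightarrow> complex_of_real ((cos (pi * t))\<^sup>2) = 1"
      by (simp add: val del: of_real_power)
    also have "\<dots> \<longleftrightarrow> (cos (pi * t))\<^sup>2 = 1" by (simp only: of_real_eq_1_iff)
    also have "\<dots> \<longleftrightarrow> sin (pi * t) = 0" 
    proof -
      have "(cos (pi * t))\<^sup>2 = 1 \<longleftrightarrow> (sin (pi * t))\<^sup>2 = 0"
        using sin_cos_squared_add[of "pi * t"] by linarith
      then show ?thesis by simp
    qed
    finally show ?thesis .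
  qed
  have angle: "Re (cis (2 * pi * s) * cnj (cis (2 * pi * s\<^sub>0))) = cos (2 * pi * (s - s\<^sub>0))" for s
    by (simp add: right_diff_distrib cos_diff)
  show ?thesis
  proof
    show "square_pair ` V \<subseteq> ?U"
    proof
      fix A assume "A \<in> square_pair ` V"
      then obtain s t where st: "A = square_pair (s, t)" "0 < t" "t < 1"
        and s: "s\<^sub>0 - 1/4 < s" "s < s\<^sub>0 + 1/4"
        by (auto simp: V_def)
      have "A \<in> topspace (sym_potency 2 circle)"
        unfolding st using continuous_map_square_pair[of UNIV] by (auto simp: continuous_map_def)
      moreover have "2 * pi * (- 1/4) < 2 * pi * (s - s\<^sub>0)" "2 * pi * (s - s\<^sub>0) < 2 * pi * (1/4)"
        using s by (intro mult_strict_left_mono; simp)+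
      then have "cos (2 * pi * (s - s\<^sub>0)) > 0" by (intro cos_gt_zero_pi) simp_all
      moreover have "sin (pi * t) > 0" using st by (intro sin_gt_zero) auto
      ultimately show "A \<in> ?U" using disc[of s t] val[of s t] angle[of s] by (simp add: st(1))
    qed
    show "?U \<subseteq> square_pair ` V"
    proof
      fix A assume A: "A \<in> ?U"
      then obtain a b where ab: "A = {a, b}" "cmod a = 1" "cmod b = 1"
        by (auto simp: sym_potency_2_points topspace_circle)
      define z where "z = a * b * cnj (cis (2 * pi * s\<^sub>0))"
      have z: "Re z > 0" "z \<noteq> 0" "cmod z = 1" using A ab by (auto simp: z_def norm_mult)
      define s where "s = s\<^sub>0 + Arg z / (2 * pi)"
      have "\<bar>Arg z\<bar> < pi / 2"
        using Re_Ln_pos_lt[OF z(2)] z(1) by (simp add: Arg_eq_Im_Ln[OF z(2)])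
      then have s: "s\<^sub>0 - 1/4 < s" "s < s\<^sub>0 + 1/4" by (auto simp: s_def field_simps abs_less_iff)
      have "cis (2 * pi * s) = cis (2 * pi * s\<^sub>0) * cis (Arg z)"
        by (simp add: s_def cis_mult distrib_left)
      also have "cis (Arg z) = z" using cis_Arg[OF z(2)] z(3) by (simp add: sgn_div_norm)
      also have "cis (2 * pi * s\<^sub>0) * z = a * b"
        using unit_mult_cnj[of "cis (2 * pi * s\<^sub>0)"] by (simp add: z_def mult_ac)
      finally obtain t where t: "t \<in> {0..1}" "square_pair (s, t) = A"
        using square_pair_with_angle[OF ab(2,3)] ab(1) by metis
      have "sin (pi * t) \<noteq> 0" using disc[of s t] A unfolding t(2) by simp
      then have "t \<noteq> 0" "t \<noteq> 1" by auto
      then have "(s, t) \<in> V" using s t(1) by (simp add: V_def)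
      then show "A \<in> square_pair ` V" unfolding t(2)[symmetric] by (rule imageI)
    qed
  qed
qed

lemma inj_on_square_pair:
  "inj_on square_pair ({s\<^sub>0 - 1/4..s\<^sub>0 + 1/4} \<times> {0..1})"
proof (rule inj_onI, clarify)
  fix s t s' t' :: real
  assume s: "s \<in> {s\<^sub>0 - 1/4..s\<^sub>0 + 1/4}" "s' \<in> {s\<^sub>0 - 1/4..s\<^sub>0 + 1/4}"
    and t: "t \<in> {0..1}" "t' \<in> {0..1}" and eq: "square_pair (s, t) = square_pair (s', t')"
  obtain a b where ab: "square_pair (s, t) = {a, b}" by (auto simp: square_pair_def)
  note S = square_pair_sum_prod[OF ab] and S' = square_pair_sum_prod[OF ab[unfolded eq]]
  have "cis (2 * pi * s) = cis (2 * pi * s')" using S(2) S'(2) by simp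
  then obtain n :: int where "2 * pi * s = 2 * pi * s' + 2 * pi * n" using cis_eq_iff_int by blast
  then have "2 * pi * s = 2 * pi * (s' + n)" by (simp add: distrib_left)
  then have n: "s = s' + n" by simp
  then have "real_of_int n < 1" "real_of_int n > - 1" using s by auto
  then have "n = 0" by linarith
  then have ss: "s = s'" using n by simp
  then have "of_real (2 * cos (pi * t)) * cis (pi * s) = of_real (2 * cos (pi * t')) * cis (pi * s)"
    using S(1) S'(1) by simp
  then have "cos (pi * t) = cos (pi * t')" by simp
  moreover have "0 \<le> pi * u \<and> pi * u \<le> pi" if "u \<in> {0..1}" for u
    using that mult_left_mono[of u 1 pi] by simp
  ultimately have "pi * t = pi * t'" using t cos_inj_pi by blast
  then show "s = s' \<and> t = t'" using ss by simp
qed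

text \<open>On the closed rectangle around the patch \<open>square_pair\<close> is a continuous injection of a compact space,
thus an embedding, and this restricts to the open rectangle.\<close>

lemma doubleton_not_in_surface_boundary:
  assumes ab: "cmod a = 1" "cmod b = 1" and "a \<noteq> b"
  shows "{a, b} \<notin> surface_boundary (sym_potency 2 circle)"
proof -
  let ?X = "sym_potency 2 circle"
  obtain s\<^sub>0 t\<^sub>0 where st: "t\<^sub>0 \<in> {0..1}" "square_pair (s\<^sub>0, t\<^sub>0) = {a, b}"
    using square_pair_surj[OF ab] by metis
  define V where "V = {s\<^sub>0 - 1/4 <..< s\<^sub>0 + 1/4} \<times> {0 <..< 1::real}"
  define K where "K = {s\<^sub>0 - 1/4 .. s\<^sub>0 + 1/4} \<times> {0 .. 1::real}"
  have VK: "V \<subseteq> K" by (auto simp: V_def K_def)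
  have oV: "open V" by (simp add: V_def open_Times)
  have "openin ?X (square_pair ` V)"
    unfolding V_def square_pair_image_eq
    by (rule openin_pair_condition[where P = "\<lambda>s p. Re (p * cnj (cis (2 * pi * s\<^sub>0))) > 0 \<and> s\<^sup>2 \<noteq> 4 * p"])
      (intro open_Collect_conj open_Collect_less open_Collect_neq continuous_intros)
  moreover have "{a, b} \<in> square_pair ` V"
  proof -
    have "t\<^sub>0 \<noteq> 0" "t\<^sub>0 \<noteq> 1"
    proof -
      show "t\<^sub>0 \<noteq> 0" using st(2) \<open>a \<noteq> b\<close> by (auto simp: square_pair_def doubleton_eq_iff)
      show "t\<^sub>0 \<noteq> 1"
      proof
        assume "t\<^sub>0 = 1"
        moreover have "cis (pi * (s\<^sub>0 + 1)) = cis (pi * (s\<^sub>0 - 1))"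
          unfolding cis_eq_iff_int by (intro exI[of _ 1]) (simp add: algebra_simps)
        ultimately show False using st(2) \<open>a \<noteq> b\<close> by (auto simp: square_pair_def doubleton_eq_iff)
      qed
    qed
    then have "(s\<^sub>0, t\<^sub>0) \<in> V" using st(1) by (simp add: V_def)
    then show ?thesis unfolding st(2)[symmetric] by (rule imageI)
  qed
  moreover have "subtopology ?X (square_pair ` V) homeomorphic_space top_of_set V"
  proof -
    have "embedding_map (top_of_set K) ?X square_pair"
    proof (rule continuous_imp_embedding_map)
      show "continuous_map (top_of_set K) ?X square_pair" by (rule continuous_map_square_pair)
      show "compact_space (top_of_set K)" by (simp add: K_def compact_space_subtopology compact_Times)
      show "Hausdorff_space ?X" by (rule Hausdorff_space_sym_potency_circle) auto
      show "inj_on square_pair (topspace (top_of_set K))"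
        using inj_on_square_pair[of s\<^sub>0] by (simp add: K_def)
    qed
    then have hom: "homeomorphic_map (top_of_set K) (subtopology ?X (square_pair ` K)) square_pair"
      by (simp add: embedding_map_def)
    have sub: "square_pair ` K \<subseteq> topspace ?X"
      using continuous_map_square_pair[of K] by (auto simp: continuous_map_def)
    have "homeomorphic_map (subtopology (top_of_set K) V) (subtopology (subtopology ?X (square_pair ` K)) (square_pair ` V)) square_pair"
      by (rule homeomorphic_map_subtopologies[OF hom]) (use VK sub in auto)
    moreover have "K \<inter> V = V" "square_pair ` K \<inter> square_pair ` V = square_pair ` V" using VK by auto
    ultimately have "homeomorphic_map (top_of_set V) (subtopology ?X (square_pair ` V)) square_pair"
      by (simp only: subtopology_subtopology)
    then show ?thesis
      using homeomorphic_map_imp_homeomorphic_space homeomorphic_space_sym by blast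
  qed
  ultimately show ?thesis using oV unfolding surface_boundary_def by blast
qed

theorem surface_boundary_sym_potency_2:
  "surface_boundary (sym_potency 2 circle) = topspace (sym_potency 1 circle)"
proof
  show "surface_boundary (sym_potency 2 circle) \<subseteq> topspace (sym_potency 1 circle)"
  proof
    fix A assume A: "A \<in> surface_boundary (sym_potency 2 circle)"
    then have "A \<in> topspace (sym_potency 2 circle)" by (simp add: surface_boundary_def)
    then obtain a b where ab: "A = {a, b}" "cmod a = 1" "cmod b = 1"
      by (auto simp: sym_potency_2_points topspace_circle)
    then have "a = b" using doubleton_not_in_surface_boundary A by blast
    then show "A \<in> topspace (sym_potency 1 circle)"
      unfolding sym_potency_1_points topspace_circle using ab by auto
  qed
  show "topspace (sym_potency 1 circle) \<subseteq> surface_boundary (sym_potency 2 circle)"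
    unfolding sym_potency_1_points topspace_circle using singleton_in_surface_boundary by auto
qed

section \<open>The compactification of 3-space as the sphere of complex pairs\<close>

lemma continuous_map_from_Alexandroff_euclidean:
  fixes g :: "'a::euclidean_space option \<Rightarrow> 'b::topological_space"
  assumes cont: "continuous_on UNIV (\<lambda>q. g (Some q))"
    and lim: "((\<lambda>q. g (Some q)) \<longlongrightarrow> g None) at_infinity"
  shows "continuous_map (Alexandroff_compactification euclidean) euclidean g"
  unfolding continuous_map_def
proof (intro conjI allI impI)
  fix W :: "'b set" assume "openin euclidean W"
  then have W: "open W" by simp
  define P where "P = {q. g (Some q) \<in> W}"
  have oP: "open P" using cont W unfolding P_def by (simp add: continuous_on_open_vimage vimage_def)
  show "openin (Alexandroff_compactification euclidean) {p \<in> topspace (Alexandroff_compactification euclidean). g p \<in> W}"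
  proof (cases "g None \<in> W")
    case False
    then have "{p \<in> topspace (Alexandroff_compactification euclidean). g p \<in> W} = Some ` P"
      by (auto simp: P_def)
    then show ?thesis using oP by simp
  next
    case True
    have "eventually (\<lambda>q. g (Some q) \<in> W) at_infinity"
      using topological_tendstoD[OF lim W True] .
    then obtain B where B: "\<And>q. norm q \<ge> B \<Longrightarrow> g (Some q) \<in> W"
      by (auto simp: eventually_at_infinity)
    then have "- P \<subseteq> cball 0 B" by (force simp: P_def)
    then have "bounded (- P)" using bounded_cball bounded_subset by blast
    then have "compact (- P)" using oP by (simp add: compact_eq_bounded_closed closed_Compl)
    moreover have "{p \<in> topspace (Alexandroff_compactification euclidean). g p \<in> W} = insert None (Some ` (topspace euclidean - (- P)))"
      using True by (auto simp: P_def)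
    ultimately show ?thesis
      unfolding openin_Alexandroff_compactification
      by (intro disjI2 exI[of _ "- P"]) (use oP in auto)
  qed
qed auto

text \<open>The Cayley transform with parameter \<open>\<surd>3\<close> maps the right half-plane to the unit disc. The geometric
mean \<open>\<surd>3\<close> of 1 and 3 is the hyperbolic center of the disc \<open>\<bar>x - 2\<bar> \<le> 1\<close>, which is therefore mapped to a
disc around 0; its radius is \<open>2 - \<surd>3\<close>. Rotation of the disc \<open>\<bar>x - 2\<bar> \<le> 1\<close> about the axis gives the
solid torus that contains the model band.\<close>

abbreviation core_radius :: real where
  "core_radius \<equiv> 2 - sqrt 3"

lemma core_radius_bounds: "0 < core_radius" "core_radius < 1"
  using real_sqrt_less_mono[of 3 4] real_sqrt_less_mono[of 1 3] by simp_all

lemma core_radius_squared: "core_radius\<^sup>2 = 1 - 2 * sqrt 3 * core_radius"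
  by (simp add: power2_eq_square algebra_simps)

definition cayley :: "complex \<Rightarrow> complex" where
  "cayley x = (x - of_real (sqrt 3)) / (x + of_real (sqrt 3))"

lemma cayley_denominator:
  assumes "Re x \<ge> 0"
  shows "x + of_real (sqrt 3) \<noteq> 0" "cmod x \<le> cmod (x + of_real (sqrt 3))" "cmod (x + of_real (sqrt 3)) > 0"
proof -
  have "Re (x + of_real (sqrt 3)) > 0" using assms by (simp add: add_nonneg_pos)
  then show "x + of_real (sqrt 3) \<noteq> 0" by (metis less_irrefl zero_complex.simps(1))
  then show "cmod (x + of_real (sqrt 3)) > 0" by simp
  have "(cmod x)\<^sup>2 \<le> (cmod (x + of_real (sqrt 3)))\<^sup>2"
    using assms by (simp add: cmod_power2 power2_sum)
  then show "cmod x \<le> cmod (x + of_real (sqrt 3))" by (rule power2_le_imp_le) simp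
qed

lemma norm_cayley:
  assumes "Re x \<ge> 0"
  shows "1 - (cmod (cayley x))\<^sup>2 = 4 * sqrt 3 * Re x / (cmod (x + of_real (sqrt 3)))\<^sup>2"
proof -
  have "(cmod (x - of_real (sqrt 3)))\<^sup>2 = (cmod (x + of_real (sqrt 3)))\<^sup>2 - 4 * sqrt 3 * Re x"
    by (simp add: cmod_power2 power2_sum power2_diff)
  then have "(cmod (cayley x))\<^sup>2 = ((cmod (x + of_real (sqrt 3)))\<^sup>2 - 4 * sqrt 3 * Re x) / (cmod (x + of_real (sqrt 3)))\<^sup>2"
    by (simp only: cayley_def norm_divide power_divide)
  then show ?thesis
    using cayley_denominator(3)[OF assms] by (simp add: diff_divide_distrib)
qed

lemma cayley_inj:
  assumes "Re x \<ge> 0" "Re x' \<ge> 0" "cayley x = cayley x'"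
  shows "x = x'"
proof -
  have "(x - of_real (sqrt 3)) * (x' + of_real (sqrt 3)) = (x' - of_real (sqrt 3)) * (x + of_real (sqrt 3))"
    using assms cayley_denominator(1) by (simp add: cayley_def divide_simps)
  then have "2 * of_real (sqrt 3) * (x - x') = 0" by (simp add: algebra_simps)
  then show ?thesis by simp
qed

lemma cayley_surj:
  assumes "cmod v \<le> 1" "v \<noteq> 1"
  obtains x where "Re x \<ge> 0" "cayley x = v"
proof
  define s where "s = complex_of_real (sqrt 3)"
  have s: "s \<noteq> 0" by (simp add: s_def)
  define x where "x = s * ((1 + v) / (1 - v))"
  have v: "1 - v \<noteq> 0" using assms by simp
  have "Re ((1 + v) / (1 - v)) = (1 - (cmod v)\<^sup>2) / (cmod (1 - v))\<^sup>2"
  proof -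
    have "(cmod v)\<^sup>2 = Re v * Re v + Im v * Im v" unfolding cmod_power2 by (simp add: power2_eq_square)
    then show ?thesis
      by (simp add: Re_divide' cmod_power2 power2_eq_square algebra_simps)
  qed
  also have "\<dots> \<ge> 0" using assms by (intro divide_nonneg_nonneg) (auto simp: abs_square_le_1)
  finally have "0 \<le> sqrt 3 * Re ((1 + v) / (1 - v))" by simp
  moreover have "Re x = sqrt 3 * Re ((1 + v) / (1 - v))"
    unfolding x_def s_def times_complex.sel by simp
  ultimately show "Re x \<ge> 0" by (simp only:)
  have "x - s = 2 * s * v / (1 - v)" "x + s = 2 * s / (1 - v)"
    using v by (simp_all add: x_def field_simps)
  then show "cayley x = v" using v s unfolding cayley_def s_def[symmetric] by simp
qed

text \<open>All three conditions are the same inequality \<open>\<bar>x\<bar>\<^sup>2 + 3 \<le> 4 Re x\<close> in disguise.\<close>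

lemma core_disc_iff:
  assumes "Re x \<ge> 0"
  shows "cmod (x - 2) \<le> 1 \<longleftrightarrow> core_radius * (cmod (x + of_real (sqrt 3)))\<^sup>2 / 2 \<le> Re x"
    and "cmod (cayley x) \<le> core_radius \<longleftrightarrow> core_radius * (cmod (x + of_real (sqrt 3)))\<^sup>2 / 2 \<le> Re x"
proof -
  have "cmod (x - 2) \<le> 1 \<longleftrightarrow> (cmod (x - 2))\<^sup>2 \<le> 1" by (simp add: abs_square_le_1)
  also have "\<dots> \<longleftrightarrow> (cmod x)\<^sup>2 + 3 \<le> 4 * Re x"
    by (simp add: cmod_power2 power2_diff) linarith
  also have "\<dots> \<longleftrightarrow> core_radius * ((cmod x)\<^sup>2 + 3) \<le> core_radius * (4 * Re x)"
    using core_radius_bounds by simp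
  also have "\<dots> \<longleftrightarrow> core_radius * (cmod (x + of_real (sqrt 3)))\<^sup>2 / 2 \<le> Re x"
  proof -
    have "(cmod (x + of_real (sqrt 3)))\<^sup>2 = (cmod x)\<^sup>2 + 3 + 2 * sqrt 3 * Re x"
      by (simp add: cmod_power2 power2_sum)
    then have "core_radius * (cmod (x + of_real (sqrt 3)))\<^sup>2
        = core_radius * ((cmod x)\<^sup>2 + 3) + (2 * sqrt 3 * core_radius) * Re x"
      by (simp add: algebra_simps)
    moreover have "core_radius * (4 * Re x) + (2 * sqrt 3 * core_radius) * Re x = 2 * Re x"
      by (simp add: algebra_simps)
    ultimately show ?thesis by linarith
  qed
  finally show "cmod (x - 2) \<le> 1 \<longleftrightarrow> core_radius * (cmod (x + of_real (sqrt 3)))\<^sup>2 / 2 \<le> Re x" .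
  define N where "N = (cmod (x + of_real (sqrt 3)))\<^sup>2"
  have N: "N > 0" using cayley_denominator(3)[OF assms] by (simp add: N_def)
  have "cmod (cayley x) \<le> core_radius \<longleftrightarrow> (cmod (cayley x))\<^sup>2 \<le> core_radius\<^sup>2"
    using core_radius_bounds by (intro power_mono_iff[symmetric]) auto
  also have "\<dots> \<longleftrightarrow> 2 * sqrt 3 * core_radius \<le> 4 * sqrt 3 * Re x / N"
    using norm_cayley[OF assms] core_radius_squared unfolding N_def by linarith
  also have "\<dots> \<longleftrightarrow> 2 * sqrt 3 * core_radius * N \<le> 4 * sqrt 3 * Re x"
    using N by (simp add: pos_le_divide_eq)
  also have "\<dots> \<longleftrightarrow> (2 * sqrt 3) * (core_radius * N) \<le> (2 * sqrt 3) * (2 * Re x)"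
    by (simp only: mult_ac) simp
  also have "\<dots> \<longleftrightarrow> core_radius * N \<le> 2 * Re x" by (rule mult_le_cancel_left_pos) simp
  also have "\<dots> \<longleftrightarrow> core_radius * N / 2 \<le> Re x" by auto
  finally show "cmod (cayley x) \<le> core_radius \<longleftrightarrow> core_radius * (cmod (x + of_real (sqrt 3)))\<^sup>2 / 2 \<le> Re x"
    unfolding N_def .
qed

text \<open>For a point of 3-space at distance \<open>Re x\<close> from the axis and height \<open>Im x\<close>, the two coordinates
in the sphere, before normalization, are to be \<open>y / radial_part x\<close> and \<open>2 * disc_part x\<close>, where \<open>y\<close> is the
projection to the horizontal plane. The maxima here and in \<open>clamped\<close> switch between two regimes. Inside
the solid torus the first coordinate has modulus 1 and the second one is \<open>2 (x - 2)\<close>, an undistorted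
copy of the disc. Outside, the second coordinate has modulus 2, its direction being the
angular coordinate around the core, and the modulus of the first one decreases to 0 towards the axis
and infinity.\<close>

definition radial_part :: "complex \<Rightarrow> real" where
  "radial_part x = max (Re x) (core_radius * (cmod (x + of_real (sqrt 3)))\<^sup>2 / 2)"

definition clamped :: "complex \<Rightarrow> complex" where
  "clamped x = cayley x / of_real (max core_radius (cmod (cayley x)))"

text \<open>The automorphism corrects the distortion of angles by the Cayley transform, so that inside
the solid torus the composition is the translation by -2.\<close>

definition disc_part :: "complex \<Rightarrow> complex" where
  "disc_part x = disc_shift (of_real core_radius) (clamped x)"

lemma radial_part_pos: "Re x \<ge> 0 \<Longrightarrow> radial_part x > 0"
  using core_radius_bounds cayley_denominator(3)[of x]
  by (auto simp: radial_part_def less_max_iff_disj)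

lemma norm_core_radius: "cmod (complex_of_real core_radius) < 1"
  using core_radius_bounds by (simp only: norm_of_real)

lemma norm_clamped_le: "cmod (clamped x) \<le> 1"
proof -
  have "max core_radius (cmod (cayley x)) > 0" using core_radius_bounds by (simp add: less_max_iff_disj)
  then show ?thesis by (simp add: clamped_def norm_divide)
qed

lemma chart_inside:
  assumes "Re x \<ge> 0" "cmod (x - 2) \<le> 1"
  shows "radial_part x = Re x" "disc_part x = x - 2"
proof -
  have in1: "core_radius * (cmod (x + of_real (sqrt 3)))\<^sup>2 / 2 \<le> Re x" "cmod (cayley x) \<le> core_radius"
    using core_disc_iff[OF assms(1)] assms(2) by auto
  then show "radial_part x = Re x" by (simp add: radial_part_def)
  define s r where "s = complex_of_real (sqrt 3)" and "r = complex_of_real core_radius"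
  have r0: "r \<noteq> 0" using core_radius_bounds unfolding r_def by (simp only: of_real_eq_0_iff)
  have s2: "s * s = 3" by (simp add: s_def flip: of_real_mult)
  have s0: "s \<noteq> 0" using s2 by auto
  have rs: "r = 2 - s" by (simp add: r_def s_def)
  have xs: "x + s \<noteq> 0" using cayley_denominator(1)[OF assms(1)] by (simp add: s_def)
  \<comment> \<open>The radius is inverse to \<open>2 + \<surd>3\<close>; with this, \<open>clamped x\<close> is a Moebius transformation of \<open>x\<close>.\<close>
  have "r * (2 + s) = 1" using s2 by (simp add: rs algebra_simps)
  then have inv: "1 / r = 2 + s" using r0 by (simp add: field_simps)
  have "clamped x = ((x - s) / (x + s)) * (1 / r)"
    using in1 by (simp add: clamped_def cayley_def max_absorb1 s_def[symmetric] r_def[symmetric] del: of_real_diff)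
  then have c: "clamped x = (x - s) * (2 + s) / (x + s)" by (simp add: inv)
  have "r * clamped x = (x - s) / (x + s)"
    using \<open>r * (2 + s) = 1\<close> unfolding c by (simp add: mult.left_commute[of r])
  then have den: "1 - r * clamped x = 2 * s / (x + s)"
    using xs by (simp add: field_simps)
  have num: "clamped x - r = 2 * s * (x - 2) / (x + s)"
  proof -
    have "clamped x - r = ((x - s) * (2 + s) - (2 - s) * (x + s)) / (x + s)"
      using xs unfolding c rs by (simp add: field_simps)
    also have "(x - s) * (2 + s) - (2 - s) * (x + s) = 2 * s * (x - 2)"
      by (simp add: algebra_simps)
    finally show ?thesis .
  qed
  have "disc_part x = (clamped x - r) / (1 - r * clamped x)"
    unfolding disc_part_def disc_shift_def r_def[symmetric] by (simp add: r_def)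
  then show "disc_part x = x - 2" unfolding den num using xs s0 by simp
qed

text \<open>In the outer regime the modulus of the Cayley transform can be recovered from
\<open>Re x / radial_part x\<close>, and its direction from \<open>disc_part x\<close>.\<close>

lemma chart_outside:
  assumes "Re x \<ge> 0" "core_radius \<le> cmod (cayley x)"
  shows "cmod (clamped x) = 1" "cmod (disc_part x) = 1"
    "Re x / radial_part x = (1 - (cmod (cayley x))\<^sup>2) / (2 * sqrt 3 * core_radius)"
proof -
  have pos: "cmod (cayley x) > 0" using assms core_radius_bounds by linarith
  show c: "cmod (clamped x) = 1"
    using assms pos by (simp add: clamped_def max_absorb2 norm_divide)
  show "cmod (disc_part x) = 1"
    unfolding disc_part_def by (rule norm_disc_shift[OF norm_core_radius c])
  define N where "N = (cmod (x + of_real (sqrt 3)))\<^sup>2"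
  have N: "N > 0" using cayley_denominator(3)[OF assms(1)] by (simp add: N_def)
  have "Re x \<le> core_radius * N / 2"
  proof -
    have "cmod (cayley x) \<le> core_radius \<longleftrightarrow> core_radius * N / 2 \<le> Re x"
      using core_disc_iff(2)[OF assms(1)] by (simp add: N_def)
    moreover have "cmod (cayley x) = core_radius \<Longrightarrow> Re x = core_radius * N / 2"
    proof -
      assume "cmod (cayley x) = core_radius"
      then have "(cmod (cayley x))\<^sup>2 = core_radius\<^sup>2" by (simp only:)
      then have "2 * sqrt 3 * core_radius = 4 * sqrt 3 * Re x / N"
        using norm_cayley[OF assms(1)] core_radius_squared unfolding N_def by linarith
      then have "2 * sqrt 3 * (core_radius * N) = 2 * sqrt 3 * (2 * Re x)" using N by (simp add: field_simps)
      then have "core_radius * N = 2 * Re x" by (simp add: mult.commute)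
      then show ?thesis by linarith
    qed
    ultimately show ?thesis using assms(2) by linarith
  qed
  then have "radial_part x = core_radius * N / 2" by (simp add: radial_part_def N_def)
  moreover have "1 - (cmod (cayley x))\<^sup>2 = 4 * sqrt 3 * Re x / N"
    using norm_cayley[OF assms(1)] by (simp add: N_def)
  ultimately show "Re x / radial_part x = (1 - (cmod (cayley x))\<^sup>2) / (2 * sqrt 3 * core_radius)"
  proof -
    have gen: "R / (k * N / 2) = 4 * s * R / N / (2 * s * k)" if "s > 0" "k > 0" for R s k :: real
      using that N by (simp add: field_simps)
    have "sqrt 3 > (0::real)" by simp
    from gen[OF this core_radius_bounds(1), of "Re x"] show ?thesis
      unfolding \<open>radial_part x = core_radius * N / 2\<close> \<open>1 - (cmod (cayley x))\<^sup>2 = 4 * sqrt 3 * Re x / N\<close> .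
  qed
qed

text \<open>The chart takes values in the boundary of a bidisc, which meets every ray once. Positively
proportional values are therefore equal.\<close>

lemma chart_max_norm:
  assumes "Re x \<ge> 0"
  shows "max (Re x / radial_part x) (cmod (disc_part x)) = 1"
proof (cases "cmod (cayley x) \<le> core_radius")
  case True
  then have "cmod (x - 2) \<le> 1" using core_disc_iff[OF assms] by simp
  then show ?thesis using chart_inside[OF assms] radial_part_pos[OF assms] by simp
next
  case False
  then have "cmod (disc_part x) = 1" using chart_outside(2)[OF assms] by simp
  moreover have "Re x / radial_part x \<le> 1" using radial_part_pos[OF assms] by (simp add: radial_part_def)
  ultimately show ?thesis by simp
qed

lemma chart_inj:
  assumes x: "Re x \<ge> 0" "Re x' \<ge> 0"
    and eq: "Re x / radial_part x = Re x' / radial_part x'" "disc_part x = disc_part x'"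
  shows "x = x'"
proof -
  define p where "p = complex_of_real core_radius"
  have p: "cmod p < 1" unfolding p_def by (rule norm_core_radius)
  have den: "1 - cnj p * clamped x \<noteq> 0" "1 - cnj p * clamped x' \<noteq> 0"
    using disc_shift_denominator(1)[OF p] norm_clamped_le by auto
  have "disc_shift p (clamped x) - disc_shift p (clamped x') = 0"
    using eq(2) by (simp add: disc_part_def p_def)
  then have cl: "clamped x = clamped x'"
    unfolding disc_shift_diff[OF den] using den one_minus_norm_squared_nonzero[OF p] by simp
  have mp: "max core_radius (cmod (cayley y)) > 0" for y using core_radius_bounds by (simp add: less_max_iff_disj)
  have rec: "cayley y = clamped y * of_real (max core_radius (cmod (cayley y)))" for y
    using mp[of y] by (simp add: clamped_def)
  have big: "core_radius \<le> cmod (cayley y) \<longleftrightarrow> cmod (clamped y) = 1" for y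
    using mp[of y] core_radius_bounds by (auto simp: clamped_def norm_divide max_def)
  have "max core_radius (cmod (cayley x)) = max core_radius (cmod (cayley x'))"
  proof (cases "core_radius \<le> cmod (cayley x)")
    case True
    then have True': "core_radius \<le> cmod (cayley x')" using big cl by simp
    have "(1 - (cmod (cayley x))\<^sup>2) / (2 * sqrt 3 * core_radius) = (1 - (cmod (cayley x'))\<^sup>2) / (2 * sqrt 3 * core_radius)"
      unfolding chart_outside(3)[OF x(1) True, symmetric] chart_outside(3)[OF x(2) True', symmetric]
      by (rule eq(1))
    moreover have nz: "2 * sqrt 3 * core_radius \<noteq> 0"
      using core_radius_bounds by (simp only: mult_eq_0_iff) simp
    ultimately have "1 - (cmod (cayley x))\<^sup>2 = 1 - (cmod (cayley x'))\<^sup>2"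
      by (simp only: divide_cancel_right nz simp_thms)
    then have "(cmod (cayley x))\<^sup>2 = (cmod (cayley x'))\<^sup>2" by linarith
    then show ?thesis by simp
  next
    case False
    then have "\<not> core_radius \<le> cmod (cayley x')" using big cl by simp
    then show ?thesis using False by simp
  qed
  then have "cayley x = cayley x'" using rec[of x] rec[of x'] cl by metis
  then show ?thesis using cayley_inj[OF x] by simp
qed

text \<open>The excluded combination \<open>q = 0\<close>, \<open>d = 1\<close> is the value at infinity.\<close>

lemma chart_surj_outside:
  assumes "cmod d = 1" "0 \<le> q" "q \<le> 1" "\<not> (q = 0 \<and> d = 1)"
  obtains x where "Re x \<ge> 0" "Re x / radial_part x = q" "disc_part x = d"
proof -
  define p where "p = complex_of_real core_radius"
  have p: "cmod p < 1" "cnj p = p" using norm_core_radius by (simp_all add: p_def del: of_real_diff)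
  define e where "e = (d + p) / (1 + cnj p * d)"
  have e: "cmod e = 1" "disc_shift p e = d"
    using norm_disc_unshift[OF p(1) assms(1)] disc_shift_unshift[OF p(1)] disc_shift_denominator(2)[OF p(1)] assms(1)
    by (auto simp: e_def)
  \<comment> \<open>the modulus of the Cayley transform, obtained by solving the last equation of \<open>chart_outside\<close>\<close>
  define \<sigma> where "\<sigma> = sqrt (1 - 2 * sqrt 3 * core_radius * q)"
  have k: "0 \<le> 2 * sqrt 3 * core_radius" "2 * sqrt 3 * core_radius * q \<le> 2 * sqrt 3 * core_radius"
    using core_radius_bounds assms by (simp_all add: mult_left_le)
  have ge: "core_radius\<^sup>2 \<le> 1 - 2 * sqrt 3 * core_radius * q"
    unfolding core_radius_squared using k(2) by linarith
  have \<sigma>2: "\<sigma>\<^sup>2 = 1 - 2 * sqrt 3 * core_radius * q"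
    unfolding \<sigma>_def using ge zero_le_power2[of core_radius] by (intro real_sqrt_pow2) linarith
  have \<sigma>: "core_radius \<le> \<sigma>" unfolding \<sigma>_def using ge by (rule real_le_rsqrt)
  then have \<sigma>0: "\<sigma> > 0" using core_radius_bounds by linarith
  have "\<sigma>\<^sup>2 \<le> 1\<^sup>2" unfolding \<sigma>2 using k(1) assms(2) by simp
  then have \<sigma>1: "\<sigma> \<le> 1" by (rule power2_le_imp_le) simp
  define v where "v = of_real \<sigma> * e"
  have nv: "cmod v = \<sigma>" using e \<sigma>0 by (simp add: v_def norm_mult)
  have "v \<noteq> 1"
  proof
    assume v1: "v = 1"
    then have "\<sigma> = 1" using nv by simp
    then have "e = 1" using v1 by (simp add: v_def)
    have "1 - p \<noteq> 0" using p by auto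
    then have "disc_shift p 1 = 1" using p by (simp add: disc_shift_def)
    then have "d = 1" using e \<open>e = 1\<close> by simp
    moreover have "2 * sqrt 3 * core_radius * q = 0" using \<sigma>2 \<open>\<sigma> = 1\<close> by simp
    then have "q = 0" using core_radius_bounds by simp
    ultimately show False using assms(4) by simp
  qed
  then obtain x where x: "Re x \<ge> 0" "cayley x = v"
    using cayley_surj[of v] nv \<sigma>1 by auto
  have big: "core_radius \<le> cmod (cayley x)" using \<sigma> nv x by simp
  have "clamped x = e"
    using \<sigma>0 unfolding clamped_def x(2) nv max_absorb2[OF \<sigma>] by (simp add: v_def)
  then have "disc_part x = d" using e by (simp add: disc_part_def p_def)
  moreover have "Re x / radial_part x = q"
    unfolding chart_outside(3)[OF x(1) big] x(2) nv \<sigma>2 using core_radius_bounds by simp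
  ultimately show ?thesis using that x by blast
qed

definition half_plane_point :: "real^3 \<Rightarrow> complex" where
  "half_plane_point q = of_real (cmod (Complex (q $ 1) (q $ 2))) + \<i> * of_real (q $ 3)"

definition space_vector :: "real^3 \<Rightarrow> complex \<times> complex" where
  "space_vector q = (Complex (q $ 1) (q $ 2) / of_real (radial_part (half_plane_point q)),
     2 * disc_part (half_plane_point q))"

definition space_sphere :: "(real^3) option \<Rightarrow> complex \<times> complex" where
  "space_sphere p = (case p of None \<Rightarrow> (0, 1) | Some q \<Rightarrow> sgn (space_vector q))"

lemma half_plane_point_Re [simp]: "Re (half_plane_point q) = cmod (Complex (q $ 1) (q $ 2))"
  and half_plane_point_Im [simp]: "Im (half_plane_point q) = q $ 3"
  by (simp_all add: half_plane_point_def)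

text \<open>The half-plane is a fundamental domain of the rotations about the vertical axis.\<close>

lemma norm_half_plane_point: "cmod (half_plane_point q) = norm q"
proof -
  have "(cmod (half_plane_point q))\<^sup>2 = (norm q)\<^sup>2"
    unfolding cmod_power2 half_plane_point_Re half_plane_point_Im
    by (simp add: norm_vec_def L2_set_def sum_3 sum_nonneg)
  then show ?thesis by simp
qed

lemma space_vector_fst_norm:
  "cmod (fst (space_vector q)) = Re (half_plane_point q) / radial_part (half_plane_point q)"
  using radial_part_pos[of "half_plane_point q"] by (simp add: space_vector_def norm_divide)

lemma space_vector_max_norm:
  "max (cmod (fst (space_vector q))) (cmod (snd (space_vector q)) / 2) = 1"
  using chart_max_norm[of "half_plane_point q"] unfolding space_vector_fst_norm
  by (simp add: space_vector_def norm_mult)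

lemma space_vector_nonzero: "space_vector q \<noteq> 0"
  using space_vector_max_norm[of q] by auto

lemma space_vector_inj:
  assumes "space_vector q = space_vector q'"
  shows "q = q'"
proof -
  have "half_plane_point q = half_plane_point q'"
  proof (rule chart_inj)
    show "Re (half_plane_point q) / radial_part (half_plane_point q) = Re (half_plane_point q') / radial_part (half_plane_point q')"
      using assms unfolding space_vector_fst_norm[symmetric] by simp
    show "disc_part (half_plane_point q) = disc_part (half_plane_point q')"
      using assms by (simp add: space_vector_def)
  qed simp_all
  moreover from this have "Complex (q $ 1) (q $ 2) = Complex (q' $ 1) (q' $ 2)"
    using assms radial_part_pos[of "half_plane_point q'"] by (simp add: space_vector_def)
  moreover from \<open>half_plane_point q = half_plane_point q'\<close> have "q $ 3 = q' $ 3"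
    by (metis half_plane_point_Im)
  ultimately show ?thesis by (simp add: vec_eq_iff forall_3)
qed

lemma space_vector_ray_inj:
  assumes "c > 0" "space_vector q = c *\<^sub>R space_vector q'"
  shows "q = q'"
proof -
  have "1 = max (cmod (fst (space_vector q))) (cmod (snd (space_vector q)) / 2)"
    using space_vector_max_norm by simp
  also have "\<dots> = max (c * cmod (fst (space_vector q'))) (c * (cmod (snd (space_vector q')) / 2))"
    unfolding assms(2) using assms(1) by simp
  also have "\<dots> = c * max (cmod (fst (space_vector q'))) (cmod (snd (space_vector q')) / 2)"
    using assms(1) by (simp add: max_mult_distrib_left)
  also have "\<dots> = c" using space_vector_max_norm by simp
  finally have "space_vector q = space_vector q'" using assms(2) by simp
  then show ?thesis by (rule space_vector_inj)
qed

text \<open>A finite point with the value of infinity would lie on the axis and have the Cayley transform 1, which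
only infinity has.\<close>

lemma space_vector_not_at_infinity:
  assumes "c > 0" shows "space_vector q \<noteq> c *\<^sub>R (0, 1)"
proof
  assume eq: "space_vector q = c *\<^sub>R (0, 1)"
  define x where "x = half_plane_point q"
  have x: "Re x \<ge> 0" by (simp add: x_def)
  have f0: "cmod (fst (space_vector q)) = 0" and s: "snd (space_vector q) = of_real c"
    using eq by (simp_all add: scaleR_conv_of_real)
  then have "c = 2" using space_vector_max_norm[of q] assms by (simp add: max_def split: if_splits)
  then have d: "disc_part x = 1" using s by (simp add: space_vector_def x_def)
  have q0: "Re x / radial_part x = 0" using f0 by (simp add: space_vector_fst_norm x_def)
  have "\<not> cmod (x - 2) \<le> 1" using q0 chart_inside(1)[OF x] radial_part_pos[OF x] by auto
  then have big: "core_radius \<le> cmod (cayley x)" using core_disc_iff[OF x] by simp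
  have cl: "cmod (clamped x) = 1" by (rule chart_outside(1)[OF x big])
  define p where "p = complex_of_real core_radius"
  have p: "cmod p < 1" "cnj p = p" using norm_core_radius by (simp_all add: p_def del: of_real_diff)
  have p1: "1 - p \<noteq> 0" using p by auto
  then have "disc_shift p 1 = 1" using p by (simp add: disc_shift_def)
  then have "clamped x = 1"
    using d disc_shift_eq_iff[OF p(1) cl, of 1] by (simp add: disc_part_def p_def)
  have "Re x = 0" using q0 radial_part_pos[OF x] by simp
  then have "(cmod (cayley x))\<^sup>2 = 1" using norm_cayley[OF x] by simp
  then have n1: "cmod (cayley x) = 1" by (simp add: power2_eq_1_iff)
      (smt (verit) norm_ge_zero)
  have "cayley x = 1"
    using \<open>clamped x = 1\<close> core_radius_bounds unfolding clamped_def n1 by (simp add: max_absorb2)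
  then have "x - of_real (sqrt 3) = x + of_real (sqrt 3)"
    using cayley_denominator(1)[OF x] by (simp add: cayley_def)
  then show False by simp
qed

lemma space_point_exists:
  assumes "Re x \<ge> 0" "cmod z = Re x / radial_part x"
  obtains q where "space_vector q = (z, 2 * disc_part x)"
proof -
  define y where "y = z * of_real (radial_part x)"
  define q :: "real^3" where "q = vector [Re y, Im y, Im x]"
  have m: "radial_part x > 0" using radial_part_pos assms(1) by simp
  have c: "Complex (q $ 1) (q $ 2) = y" by (simp add: q_def vector_3)
  have "cmod y = Re x" using m assms(2) by (simp add: y_def norm_mult)
  then have "half_plane_point q = x"
    unfolding half_plane_point_def c by (simp add: complex_eq_iff q_def vector_3)
  then have "space_vector q = (z, 2 * disc_part x)"
    unfolding space_vector_def c using m by (simp add: y_def)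
  then show ?thesis using that by blast
qed

text \<open>The two regimes of the chart correspond to \<open>\<bar>w\<bar> \<le> 2 \<bar>z\<bar>\<close> and \<open>\<bar>w\<bar> > 2 \<bar>z\<bar>\<close>. The excluded ray is the
image of infinity.\<close>

lemma space_vector_surj:
  assumes "v \<noteq> (0, 0)" "\<nexists>c. c > 0 \<and> v = c *\<^sub>R (0, 1)"
  obtains q c where "c > 0" "v = c *\<^sub>R space_vector q"
proof -
  obtain z w where v: "v = (z, w)" by (cases v)
  show ?thesis
  proof (cases "cmod w \<le> 2 * cmod z")
    case True
    then have z: "z \<noteq> 0" using assms v by auto
    define x where "x = 2 + w / of_real (2 * cmod z)"
    have xin: "cmod (x - 2) \<le> 1" using True z by (simp add: x_def norm_divide norm_mult)
    then have "\<bar>Re (x - 2)\<bar> \<le> 1" using abs_Re_le_cmod[of "x - 2"] by linarith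
    then have x: "Re x > 0" by auto
    have ch: "radial_part x = Re x" "disc_part x = x - 2" using chart_inside[of x] x xin by auto
    obtain q where "space_vector q = (sgn z, 2 * disc_part x)"
      by (rule space_point_exists[of x "sgn z"]) (use x z ch in \<open>auto simp: norm_sgn\<close>)
    moreover have "cmod z *\<^sub>R sgn z = z" using z by (simp add: sgn_div_norm)
    moreover have "cmod z *\<^sub>R (2 * disc_part x) = w"
    proof -
      note ch(2)
      also have "x - 2 = w / of_real (2 * cmod z)" by (simp add: x_def)
      finally show ?thesis using z by (simp add: scaleR_conv_of_real)
    qed
    ultimately show ?thesis using that[of "cmod z" q] z v by simp
  next
    case False
    then have w: "w \<noteq> 0" by auto
    define u where "u = 2 * z / of_real (cmod w)"
    have nu: "cmod u = 2 * cmod z / cmod w" by (simp add: u_def norm_divide norm_mult)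
    have "\<not> (cmod u = 0 \<and> sgn w = 1)"
    proof
      assume *: "cmod u = 0 \<and> sgn w = 1"
      then have "z = 0" using w nu by simp
      moreover have "w = cmod w *\<^sub>R sgn w" using w by (simp add: sgn_div_norm)
      then have "w = cmod w *\<^sub>R 1" using * by simp
      ultimately have "v = cmod w *\<^sub>R (0, 1)" using v by simp
      then show False using assms(2) w by auto
    qed
    moreover have "cmod u \<le> 1" using False w by (simp add: nu)
    ultimately obtain x where x: "Re x \<ge> 0" "Re x / radial_part x = cmod u" "disc_part x = sgn w"
      using chart_surj_outside[of "sgn w" "cmod u"] w by (auto simp: norm_sgn)
    obtain q where "space_vector q = (u, 2 * disc_part x)"
      by (rule space_point_exists[of x u]) (use x in auto)
    moreover have "(cmod w / 2) *\<^sub>R u = z" using w by (simp add: u_def scaleR_conv_of_real)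
    moreover have "(cmod w / 2) *\<^sub>R (2 * disc_part x) = w"
      using w by (simp add: x sgn_div_norm scaleR_conv_of_real)
    ultimately show ?thesis using that[of "cmod w / 2" q] w v by simp
  qed
qed

lemma continuous_on_half_plane_point: "continuous_on UNIV half_plane_point"
proof -
  have eq: "half_plane_point = (\<lambda>q. of_real (cmod (of_real (q $ 1) + \<i> * of_real (q $ 2))) + \<i> * of_real (q $ 3))"
    by (simp add: half_plane_point_def Complex_eq fun_eq_iff)
  show ?thesis unfolding eq by (intro continuous_intros)
qed

lemma continuous_on_space_vector: "continuous_on UNIV space_vector"
proof -
  have c: "continuous_on UNIV (\<lambda>q::real^3. Complex (q $ 1) (q $ 2))"
    unfolding Complex_eq by (intro continuous_intros)
  have r: "continuous_on UNIV (\<lambda>q. radial_part (half_plane_point q))"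
    unfolding radial_part_def
    by (intro continuous_intros continuous_on_half_plane_point continuous_on_max) auto
  have v: "continuous_on UNIV (\<lambda>q. cayley (half_plane_point q))"
    unfolding cayley_def
    by (intro continuous_intros continuous_on_half_plane_point) (simp add: cayley_denominator)
  have mp: "max core_radius (cmod (cayley y)) \<noteq> 0" for y
    by (metis less_max_iff_disj less_irrefl core_radius_bounds(1))
  have k: "continuous_on UNIV (\<lambda>q. clamped (half_plane_point q))"
    unfolding clamped_def by (intro continuous_intros v continuous_on_max) (use mp in simp)
  have d: "continuous_on UNIV (\<lambda>q. disc_part (half_plane_point q))"
    unfolding disc_part_def disc_shift_def
    by (intro continuous_intros k) (use disc_shift_denominator(1)[OF norm_core_radius norm_clamped_le] in auto)
  show ?thesis
    unfolding space_vector_def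
    by (intro continuous_intros c r d) (use radial_part_pos in \<open>auto simp: less_imp_neq[symmetric]\<close>)
qed

text \<open>The Cayley transform tends to 1, which the automorphism fixes, and the first coordinate is bounded by
a multiple of \<open>1 / \<bar>x + \<surd>3\<bar>\<close>.\<close>

lemma space_vector_tendsto_infinity: "(space_vector \<longlongrightarrow> (0, 2)) at_infinity"
proof -
  define s where "s = complex_of_real (sqrt 3)"
  define X where "X q = half_plane_point q + s" for q
  have Xq: "norm q \<le> cmod (X q)" "X q \<noteq> 0" "cmod (half_plane_point q) \<le> cmod (X q)" for q
    using cayley_denominator[of "half_plane_point q"] by (simp_all add: X_def s_def norm_half_plane_point)
  have inv: "((\<lambda>q. inverse (X q)) \<longlongrightarrow> 0) at_infinity"
  proof (rule Lim_null_comparison)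
    show "((\<lambda>q::real^3. inverse (norm q)) \<longlongrightarrow> 0) at_infinity"
      by (intro tendsto_inverse_0_at_top filterlim_norm_at_top)
    show "eventually (\<lambda>q. norm (inverse (X q)) \<le> inverse (norm q)) at_infinity"
      unfolding eventually_at_infinity
    proof (intro exI[of _ 1] allI impI)
      fix q :: "real^3" assume "1 \<le> norm q"
      then have "norm q > 0" by linarith
      then show "norm (inverse (X q)) \<le> inverse (norm q)"
        unfolding norm_inverse by (rule le_imp_inverse_le[OF Xq(1)])
    qed
  qed
  have "((\<lambda>q. 1 - 2 * s * inverse (X q)) \<longlongrightarrow> 1 - 2 * s * 0) at_infinity"
    by (intro tendsto_intros inv)
  moreover have "1 - 2 * s * inverse (X q) = cayley (half_plane_point q)" for q
    using Xq(2)[of q] by (simp add: cayley_def X_def s_def field_simps)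
  ultimately have v: "((\<lambda>q. cayley (half_plane_point q)) \<longlongrightarrow> 1) at_infinity" by simp
  have m1: "max core_radius (cmod 1) = 1" using core_radius_bounds by simp
  have "((\<lambda>q. clamped (half_plane_point q)) \<longlongrightarrow> 1 / of_real (max core_radius (cmod 1))) at_infinity"
    unfolding clamped_def by (intro tendsto_intros v tendsto_max) (simp add: m1)
  then have k: "((\<lambda>q. clamped (half_plane_point q)) \<longlongrightarrow> 1) at_infinity" unfolding m1 by simp
  define p where "p = complex_of_real core_radius"
  have p: "cmod p < 1" "cnj p = p" using norm_core_radius by (simp_all add: p_def del: of_real_diff)
  have p1: "1 - cnj p * 1 \<noteq> 0" using p by auto
  have "((\<lambda>q. disc_part (half_plane_point q)) \<longlongrightarrow> (1 - p) / (1 - cnj p * 1)) at_infinity"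
    unfolding disc_part_def disc_shift_def p_def[symmetric] by (intro tendsto_intros k p1)
  then have d: "((\<lambda>q. disc_part (half_plane_point q)) \<longlongrightarrow> 1) at_infinity" using p p1 by simp
  have f: "((\<lambda>q::real^3. Complex (q $ 1) (q $ 2) / of_real (radial_part (half_plane_point q))) \<longlongrightarrow> 0) at_infinity"
  proof (rule Lim_null_comparison)
    show "((\<lambda>q. 2 / core_radius * cmod (inverse (X q))) \<longlongrightarrow> 0) at_infinity"
      using tendsto_mult[OF tendsto_const[of "2 / core_radius"] tendsto_norm[OF inv]] by simp
    show "eventually (\<lambda>q::real^3. norm (Complex (q $ 1) (q $ 2) / of_real (radial_part (half_plane_point q)))
        \<le> 2 / core_radius * cmod (inverse (X q))) at_infinity"
    proof (intro always_eventually allI)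
      fix q :: "real^3"
      have X0: "cmod (X q) > 0" using Xq(2) by simp
      have "cmod (Complex (q $ 1) (q $ 2)) \<le> cmod (X q)"
        using Xq(3)[of q] complex_Re_le_cmod[of "half_plane_point q"] by simp
      moreover have "core_radius * (cmod (X q))\<^sup>2 / 2 \<le> radial_part (half_plane_point q)"
        unfolding radial_part_def X_def s_def by (rule max.cobounded2)
      moreover have cr: "core_radius * (cmod (X q))\<^sup>2 / 2 > 0" using X0 core_radius_bounds by simp
      ultimately have "cmod (Complex (q $ 1) (q $ 2)) / radial_part (half_plane_point q)
          \<le> cmod (X q) / (core_radius * (cmod (X q))\<^sup>2 / 2)"
        by (intro frac_le) auto
      also have "\<dots> = 2 / core_radius * cmod (inverse (X q))"
      proof -
        have "n / (k * n\<^sup>2 / 2) = 2 / k * inverse n" if "n > 0" for n k :: real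
          using that by (cases "k = 0") (simp_all add: power2_eq_square field_simps)
        from this[OF X0] show ?thesis unfolding norm_inverse .
      qed
      finally show "norm (Complex (q $ 1) (q $ 2) / of_real (radial_part (half_plane_point q)))
        \<le> 2 / core_radius * cmod (inverse (X q))"
        using radial_part_pos[of "half_plane_point q"] by (simp add: norm_divide)
    qed
  qed
  have "((\<lambda>q. (Complex (q $ 1) (q $ 2) / of_real (radial_part (half_plane_point q)), 2 * disc_part (half_plane_point q)))
      \<longlongrightarrow> (0, 2 * 1)) at_infinity"
    by (intro tendsto_Pair f tendsto_mult tendsto_const d)
  then show ?thesis by (simp add: space_vector_def[abs_def])
qed

theorem homeomorphic_map_space_sphere:
  "homeomorphic_map (Alexandroff_compactification euclidean) (top_of_set (sphere 0 1)) space_sphere"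
proof (rule continuous_imp_homeomorphic_map)
  have S: "space_sphere (Some q) = sgn (space_vector q)" "space_sphere None = (0, 1)" for q
    by (simp_all add: space_sphere_def)
  have n01: "norm ((0, 1) :: complex \<times> complex) = 1" by (simp add: norm_Pair)
  have n1: "norm (space_sphere p) = 1" for p
    using space_vector_nonzero by (cases p) (simp_all add: S n01 norm_sgn)
  have "continuous_map (Alexandroff_compactification euclidean) euclidean space_sphere"
  proof (rule continuous_map_from_Alexandroff_euclidean)
    show "continuous_on UNIV (\<lambda>q. space_sphere (Some q))"
      unfolding S by (rule continuous_on_sgn[OF continuous_on_space_vector space_vector_nonzero])
    have "((\<lambda>q. sgn (space_vector q)) \<longlongrightarrow> sgn (0, 2)) at_infinity"
      by (rule tendsto_sgn[OF space_vector_tendsto_infinity]) (simp add: zero_prod_def)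
    moreover have "sgn (0 :: complex, 2 :: complex) = (0, 1)"
      by (simp add: sgn_div_norm norm_Pair scaleR_conv_of_real)
    ultimately show "((\<lambda>q. space_sphere (Some q)) \<longlongrightarrow> space_sphere None) at_infinity"
      by (simp add: S)
  qed
  then show "continuous_map (Alexandroff_compactification euclidean) (top_of_set (sphere 0 1)) space_sphere"
    by (rule continuous_map_into_subtopology) (simp add: n1)
  show "compact_space (Alexandroff_compactification (euclidean :: (real^3) topology))" by simp
  show "Hausdorff_space (top_of_set (sphere 0 (1::real) :: (complex \<times> complex) set))"
    by (simp add: Hausdorff_space_subtopology)
  show "space_sphere ` topspace (Alexandroff_compactification euclidean) = topspace (top_of_set (sphere 0 1))"
  proof
    show "space_sphere ` topspace (Alexandroff_compactification euclidean) \<subseteq> topspace (top_of_set (sphere 0 1))"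
      using n1 by auto
    show "topspace (top_of_set (sphere 0 1)) \<subseteq> space_sphere ` topspace (Alexandroff_compactification euclidean)"
    proof
      fix v :: "complex \<times> complex" assume "v \<in> topspace (top_of_set (sphere 0 1))"
      then have v: "norm v = 1" by simp
      then have sv: "sgn v = v" by (simp add: sgn_div_norm)
      have v0: "v \<noteq> (0, 0)" using v by (auto simp: norm_Pair)
      have "\<exists>p. v = space_sphere p"
      proof (cases "\<exists>c. c > 0 \<and> v = c *\<^sub>R (0, 1)")
        case True
        then obtain c where c: "c > 0" "v = c *\<^sub>R (0, 1)" by blast
        then have "norm v = c * norm ((0, 1) :: complex \<times> complex)" by (simp only: norm_scaleR abs_of_pos)
        then have "c = 1" using v n01 by simp
        then have "v = space_sphere None" using c S by simp
        then show ?thesis by blast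
      next
        case False
        obtain q c where "c > 0" "v = c *\<^sub>R space_vector q"
          by (rule space_vector_surj[OF v0 False])
        then have "v = space_sphere (Some q)" using sv by (simp add: S sgn_scaleR)
        then show ?thesis by blast
      qed
      then obtain p where "v = space_sphere p" by blast
      then show "v \<in> space_sphere ` topspace (Alexandroff_compactification euclidean)"
        by (cases p) auto
    qed
  qed
  show "inj_on space_sphere (topspace (Alexandroff_compactification euclidean))"
  proof (rule inj_onI)
    fix p p' assume eq: "space_sphere p = space_sphere p'"
    have sgn01: "sgn ((0, 1) :: complex \<times> complex) = (0, 1)" by (simp add: sgn_div_norm n01)
    have nz01: "((0, 1) :: complex \<times> complex) \<noteq> 0" by (simp add: zero_prod_def)
    have inf: "space_sphere (Some q) \<noteq> space_sphere None" for q
    proof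
      assume "space_sphere (Some q) = space_sphere None"
      then have "sgn (space_vector q) = sgn (0, 1)" by (simp only: S sgn01)
      then obtain r where "r > 0" "space_vector q = r *\<^sub>R (0, 1)"
        by (rule sgn_eq_imp_ray[OF _ space_vector_nonzero nz01])
      then show False using space_vector_not_at_infinity by blast
    qed
    show "p = p'"
    proof (cases p)
      case None
      then show ?thesis using eq inf by (cases p') metis+
    next
      case (Some q)
      then obtain q' where q': "p' = Some q'" using eq inf by (cases p') metis+
      have "sgn (space_vector q) = sgn (space_vector q')" using eq by (simp only: Some q' S)
      then obtain r where "r > 0" "space_vector q = r *\<^sub>R space_vector q'"
        by (rule sgn_eq_imp_ray[OF _ space_vector_nonzero space_vector_nonzero])
      then show ?thesis using space_vector_ray_inj Some q' by blast
    qed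
  qed
qed

section \<open>The band and the trefoil\<close>

text \<open>With \<open>\<theta> = 2 * pi * s\<close> this is the direction of a band with three half twists: the second
coordinate turns by three halves of the angle of the first.\<close>

lemma potency_sphere_square_pair:
  "potency_sphere (square_pair (s, t))
    = sgn (cis (2 * pi * s), of_real (2 * cos (pi * t)) * cis (3 * (2 * pi * s) / 2))"
proof -
  define a b where ab: "a = cis (pi * (s + t))" "b = cis (pi * (s - t))"
  have sp: "square_pair (s, t) = {a, b}" by (simp add: square_pair_def ab)
  have n: "cmod a = 1" "cmod b = 1" by (simp_all add: ab)
  have "2 * pi * s + pi * s = 3 * (2 * pi * s) / 2" by simp
  then have cube: "cis (2 * pi * s) * cis (pi * s) = cis (3 * (2 * pi * s) / 2)" by (simp only: cis_mult)
  have "a * b * (a + b) = of_real (2 * cos (pi * t)) * (cis (2 * pi * s) * cis (pi * s))"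
    unfolding square_pair_sum_prod[OF sp] by (rule mult.left_commute)
  then have "a * b * (a + b) = of_real (2 * cos (pi * t)) * cis (3 * (2 * pi * s) / 2)"
    by (simp only: cube)
  then show ?thesis
    unfolding sp potency_sphere_doubleton[OF n] square_pair_sum_prod(2)[OF sp] by simp
qed

lemma potency_sphere_singleton:
  "potency_sphere {cis s} = sgn (cis (2 * s), 2 * cis (3 * s))"
proof -
  have "s + s = 2 * s" "2 * s + s = 3 * s" by simp_all
  then have "cis s * cis s = cis (2 * s)" "cis (2 * s) * cis s = cis (3 * s)" by (simp_all only: cis_mult)
  then have scale: "cis (2 * s) * (2 * cis s) = 2 * cis (3 * s)" by (metis mult.left_commute)
  have "potency_sphere {cis s} = sgn (cis (2 * s), cis (2 * s) * (2 * cis s))"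
    using potency_sphere_doubleton[of "cis s" "cis s"] \<open>cis s * cis s = cis (2 * s)\<close> by simp
  then show ?thesis by (simp only: scale)
qed

text \<open>The parametrization of the model band; its edge \<open>t = 1\<close>, traversed twice around the axis, parametrizes
the model trefoil.\<close>

definition band_point :: "real \<Rightarrow> real \<Rightarrow> real^3" where
  "band_point \<theta> t = vector [(2 + t * cos (3 * \<theta> / 2)) * cos \<theta>,
     (2 + t * cos (3 * \<theta> / 2)) * sin \<theta>, t * sin (3 * \<theta> / 2)]"

text \<open>The band lies inside the solid torus, where the half-plane coordinate \<open>x = 2 + t e\<^sup>3\<^sup>i\<^sup>\<theta>\<^sup>/\<^sup>2\<close> enters the
chart without distortion.\<close>

lemma space_sphere_band_point:
  assumes "\<bar>t\<bar> \<le> 1"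
  shows "space_sphere (Some (band_point \<theta> t)) = sgn (cis \<theta>, of_real (2 * t) * cis (3 * \<theta> / 2))"
proof -
  define q where "q = band_point \<theta> t"
  define \<rho> where "\<rho> = 2 + t * cos (3 * \<theta> / 2)"
  have "\<bar>t * cos (3 * \<theta> / 2)\<bar> \<le> 1"
    using assms abs_cos_le_one[of "3 * \<theta> / 2"] by (simp add: abs_mult mult_le_one)
  then have \<rho>: "\<rho> > 0" by (simp add: \<rho>_def)
  have y: "Complex (q $ 1) (q $ 2) = of_real \<rho> * cis \<theta>"
    by (simp add: q_def band_point_def vector_3 \<rho>_def complex_eq_iff)
  have "half_plane_point q = of_real \<rho> + \<i> * of_real (t * sin (3 * \<theta> / 2))"
    unfolding half_plane_point_def y using \<rho> by (simp add: norm_mult q_def band_point_def vector_3)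
  also have "\<dots> = 2 + of_real t * cis (3 * \<theta> / 2)"
    by (simp add: \<rho>_def complex_eq_iff)
  finally have x: "half_plane_point q = 2 + of_real t * cis (3 * \<theta> / 2)" .
  have in1: "cmod (half_plane_point q - 2) \<le> 1"
    using assms by (simp add: x norm_mult)
  have Re: "Re (half_plane_point q) = \<rho>" using \<rho> by (simp add: y norm_mult)
  have ch: "radial_part (half_plane_point q) = \<rho>" "disc_part (half_plane_point q) = of_real t * cis (3 * \<theta> / 2)"
    using chart_inside[of "half_plane_point q"] in1 Re \<rho> x by auto
  have "space_vector q = (cis \<theta>, of_real (2 * t) * cis (3 * \<theta> / 2))"
    unfolding space_vector_def ch y using \<rho> by simp
  then show ?thesis by (simp add: space_sphere_def q_def)
qed

lemma three_half_twist_band_eq: "three_half_twist_band = {band_point \<theta> t | \<theta> t. \<theta> \<in> {0..2 * pi} \<and> t \<in> {-1..1}}"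
  by (simp add: three_half_twist_band_def band_point_def)

lemma trefoil_eq: "trefoil = {band_point (2 * s) 1 | s. s \<in> {0..2 * pi}}"
  by (simp add: trefoil_def band_point_def)

lemma potency_sphere_image_2:
  "potency_sphere ` topspace (sym_potency 2 circle) = space_sphere ` Some ` three_half_twist_band"
proof
  show "potency_sphere ` topspace (sym_potency 2 circle) \<subseteq> space_sphere ` Some ` three_half_twist_band"
  proof
    fix v assume "v \<in> potency_sphere ` topspace (sym_potency 2 circle)"
    then obtain a b where ab: "cmod a = 1" "cmod b = 1" "v = potency_sphere {a, b}"
      by (auto simp: sym_potency_2_points topspace_circle)
    obtain s t where st: "s \<in> {0..1}" "square_pair (s, t) = {a, b}"
      using square_pair_surj[OF ab(1,2)] by metis
    have "v = space_sphere (Some (band_point (2 * pi * s) (cos (pi * t))))"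
      unfolding ab(3) st(2)[symmetric] potency_sphere_square_pair
      by (rule space_sphere_band_point[symmetric]) simp
    moreover have "band_point (2 * pi * s) (cos (pi * t)) \<in> three_half_twist_band"
      unfolding three_half_twist_band_eq using st(1) by (intro CollectI exI conjI refl) auto
    ultimately show "v \<in> space_sphere ` Some ` three_half_twist_band" by blast
  qed
  show "space_sphere ` Some ` three_half_twist_band \<subseteq> potency_sphere ` topspace (sym_potency 2 circle)"
  proof
    fix v assume "v \<in> space_sphere ` Some ` three_half_twist_band"
    then obtain \<theta> t where t: "t \<in> {-1..1}" "v = space_sphere (Some (band_point \<theta> t))"
      unfolding three_half_twist_band_eq by blast
    define s u where "s = \<theta> / (2 * pi)" and "u = arccos t / pi"
    have su: "2 * pi * s = \<theta>" "cos (pi * u) = t" using t by (simp_all add: s_def u_def cos_arccos_abs)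
    have "v = potency_sphere (square_pair (s, u))"
      unfolding t(2) potency_sphere_square_pair su by (rule space_sphere_band_point) (use t in auto)
    moreover have "square_pair (s, u) \<in> topspace (sym_potency 2 circle)"
      using continuous_map_square_pair[of UNIV] by (auto simp: continuous_map_def)
    ultimately show "v \<in> potency_sphere ` topspace (sym_potency 2 circle)" by blast
  qed
qed

lemma potency_sphere_image_1:
  "(\<lambda>x. potency_sphere {x}) ` topspace circle = space_sphere ` Some ` trefoil"
proof -
  have circ: "topspace circle = cis ` {0..2 * pi}"
  proof
    show "topspace circle \<subseteq> cis ` {0..2 * pi}"
    proof
      fix x assume "x \<in> topspace circle"
      then have "x = cis (Arg2pi x)"
        using Arg2pi_eq[of x] by (simp add: topspace_circle cis_conv_exp)
      moreover have "Arg2pi x \<in> {0..2 * pi}" using Arg2pi[of x] by simp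
      ultimately show "x \<in> cis ` {0..2 * pi}" by (rule image_eqI)
    qed
  qed (auto simp: topspace_circle)
  have pt: "potency_sphere {cis s} = space_sphere (Some (band_point (2 * s) 1))" for s
    using space_sphere_band_point[of 1 "2 * s"] by (simp add: potency_sphere_singleton)
  have tr: "trefoil = (\<lambda>s. band_point (2 * s) 1) ` {0..2 * pi}" unfolding trefoil_eq by auto
  show ?thesis unfolding circ tr image_image by (simp only: pt)
qed

lemma sphere3_homeomorphic: "top_of_set (sphere 0 1 :: (complex \<times> complex) set) homeomorphic_space sphere3"
proof -
  have "sphere (0 :: complex \<times> complex) 1 homeomorphic sphere (0 :: real^4) 1"
    by (rule homeomorphic_spheres_gen) simp_all
  then obtain f g where fg: "homeomorphism (sphere (0 :: complex \<times> complex) 1) (sphere (0 :: real^4) 1) f g"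
    unfolding homeomorphic_def by blast
  have "homeomorphic_maps (top_of_set (sphere 0 1)) sphere3 f g"
    using fg unfolding homeomorphic_maps_def sphere3_def homeomorphism_def
    by (auto simp: continuous_map_in_subtopology)
  then show ?thesis unfolding homeomorphic_space_def by blast
qed

text \<open>Two identifications of \<open>X\<close> and \<open>Z\<close> with the same space \<open>Y\<close> transport any homeomorphism of \<open>X\<close> to \<open>Z\<close>.\<close>

lemma homeomorphic_map_inverse_comp:
  assumes f: "homeomorphic_map X Y f" and g: "homeomorphic_map Z Y g" and h: "homeomorphic_map X W h"
  obtains \<phi> where "homeomorphic_map Z W \<phi>"
    "\<And>S T. S \<subseteq> topspace X \<Longrightarrow> f ` S = g ` T \<Longrightarrow> h ` S = \<phi> ` T"
proof -
  obtain f' where f': "homeomorphic_maps X Y f f'" using f homeomorphic_map_maps by blast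
  then have hf': "homeomorphic_map Y X f'" and inv: "\<And>x. x \<in> topspace X \<Longrightarrow> f' (f x) = x"
    by (auto simp: homeomorphic_maps_map)
  show ?thesis
  proof
    show "homeomorphic_map Z W (h \<circ> (f' \<circ> g))"
      by (rule homeomorphic_map_compose[OF homeomorphic_map_compose[OF g hf'] h])
    fix S T assume S: "S \<subseteq> topspace X" and eq: "f ` S = g ` T"
    have "f' ` f ` S = S" using S inv by (force simp: image_image)
    then have "h ` S = h ` f' ` g ` T" using eq by simp
    then show "h ` S = (h \<circ> (f' \<circ> g)) ` T" by (simp add: image_comp comp_assoc)
  qed
qed

text \<open>Both claims reduce to the images under the explicit map \<open>potency_sphere\<close>, since \<open>h\<close> differs
from it by a homeomorphism of spheres.\<close>

lemma embeds_as_models: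
  assumes h: "homeomorphic_map (sym_potency 3 circle) sphere3 h"
  shows "embeds_as (sym_potency 2 circle) h three_half_twist_band"
    and "embeds_as circle (\<lambda>x. h {x}) trefoil"
proof -
  obtain \<phi> where \<phi>: "homeomorphic_map (Alexandroff_compactification euclidean) sphere3 \<phi>"
    and im: "\<And>S T. S \<subseteq> topspace (sym_potency 3 circle) \<Longrightarrow> potency_sphere ` S = space_sphere ` T \<Longrightarrow> h ` S = \<phi> ` T"
    using homeomorphic_map_inverse_comp[OF homeomorphic_map_potency_sphere homeomorphic_map_space_sphere h] by blast
  have emb_h: "embedding_map (sym_potency 3 circle) sphere3 h"
    using h surjective_embedding_map by blast
  have emb: "embedding_map (sym_potency k circle) sphere3 h" if "1 \<le> k" "k \<le> 3" for k
    using embedding_map_compose[OF embedding_map_sym_potency_circle[OF that(1,2) order_refl] emb_h]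
    by (simp add: o_def)
  have sub: "topspace (sym_potency k circle) \<subseteq> topspace (sym_potency 3 circle)" if "1 \<le> k" "k \<le> 3" for k
    using continuous_map_sym_potency_inclusion[OF that, of circle] by (auto simp: continuous_map_def)
  have "h ` topspace (sym_potency 2 circle) = \<phi> ` Some ` three_half_twist_band"
    by (rule im[OF sub potency_sphere_image_2]) auto
  then show "embeds_as (sym_potency 2 circle) h three_half_twist_band"
    unfolding embeds_as_def using emb[of 2] \<phi> by auto
  have emb_s: "embedding_map circle (sym_potency 1 circle) (\<lambda>x. {x})"
    using homeomorphic_map_circle_singleton surjective_embedding_map by blast
  have "embedding_map circle sphere3 (\<lambda>x. h {x})"
    using embedding_map_compose[OF emb_s emb[of 1]] by (simp add: o_def)
  moreover have "(\<lambda>x. h {x}) ` topspace circle = \<phi> ` Some ` trefoil"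
  proof -
    have "(\<lambda>x. {x}) ` topspace circle \<subseteq> topspace (sym_potency 3 circle)"
      unfolding homeomorphic_imp_surjective_map[OF homeomorphic_map_circle_singleton] by (rule sub) auto
    moreover have "potency_sphere ` (\<lambda>x. {x}) ` topspace circle = space_sphere ` Some ` trefoil"
      using potency_sphere_image_1 by (simp only: image_image)
    ultimately have "h ` (\<lambda>x. {x}) ` topspace circle = \<phi> ` Some ` trefoil"
      by (rule im)
    then show ?thesis by (simp only: image_image)
  qed
  ultimately show "embeds_as circle (\<lambda>x. h {x}) trefoil"
    unfolding embeds_as_def using \<phi> by auto
qed

theorem theorem3p1:
  shows "homeomorphic_map circle (sym_potency 1 circle) (\<lambda>x. {x})
    \<and> embedding_map (sym_potency 1 circle) (sym_potency 2 circle) (\<lambda>A. A)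
    \<and> embedding_map (sym_potency 2 circle) (sym_potency 3 circle) (\<lambda>A. A)
    \<and> sym_potency 3 circle homeomorphic_space sphere3
    \<and> sym_potency 2 circle homeomorphic_space moebius_band
    \<and> topspace (sym_potency 1 circle) = surface_boundary (sym_potency 2 circle)
    \<and> (\<forall>h. homeomorphic_map (sym_potency 3 circle) sphere3 h \<longrightarrow>
          embeds_as (sym_potency 2 circle) h three_half_twist_band
        \<and> embeds_as circle (\<lambda>x. h {x}) trefoil)"
proof (intro conjI allI impI)
  show "homeomorphic_map circle (sym_potency 1 circle) (\<lambda>x. {x})"
    by (rule homeomorphic_map_circle_singleton)
  show "embedding_map (sym_potency 1 circle) (sym_potency 2 circle) (\<lambda>A. A)"
    "embedding_map (sym_potency 2 circle) (sym_potency 3 circle) (\<lambda>A. A)"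
    by (rule embedding_map_sym_potency_circle; simp)+
  show "sym_potency 3 circle homeomorphic_space sphere3"
    by (rule homeomorphic_space_trans[OF
        homeomorphic_map_imp_homeomorphic_space[OF homeomorphic_map_potency_sphere] sphere3_homeomorphic])
  show "sym_potency 2 circle homeomorphic_space moebius_band"
    by (rule sym_potency_2_homeomorphic_moebius_band)
  show "topspace (sym_potency 1 circle) = surface_boundary (sym_potency 2 circle)"
    by (rule surface_boundary_sym_potency_2[symmetric])
qed (simp_all add: embeds_as_models)

end
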